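(* There exist absolute constants $c,C>0$ such that the following holds. Let $K_1,\ldots,K_m\subseteq\mathbb{R}^n$ be convex bodies containing the origin in their interiors, let $U_1,\ldots,U_m$ be independent Haar-distributed orthogonal transformations of $\mathbb{R}^n$ and let $\lambda_j\geq0$ with $\sum_{j=1}^m\lambda_j=1$. For $q>0$ put $$ A_\lambda=\sum_{j=1}^m\lambda_jU_j^*(K_j^\circ),\qquad b_\lambda=\sum_{j=1}^m\lambda_jb(K_j),\qquad a_q(\lambda)=\prod_{j=1}^mM_{-q\lambda_j}(K_j)^{\lambda_j}, $$ where factors with $\lambda_j=0$ are interpreted as $1$. Independently, let $F$ be Haar-distributed on $G_{n,k}$, where $1\leq k\leq n$. Assume that $q\geq2k$ and put $\Delta=q-k+1$. Then, for every $u\geq0$, with probability at least $1-e^{-u}$, $$ P_FA_\lambda\supseteq c\,a_q(\lambda)\left(\frac{c\,a_q(\lambda)}{b_\lambda}\right)^{\frac{k-1}{\Delta}}e^{-u/\Delta}B_F. $$ Moreover, if $$ \overline M_\lambda=\sum_{j=1}^m\lambda_jM(K_j),\qquad B_\lambda=\left(\sum_{j=1}^m\lambda_j^2b(K_j)^2\right)^{1/2}, $$ then, with probability at least $1-e^{-ck}$, $$ P_FA_\lambda\subseteq C\left(\overline M_\lambda+\sqrt{\frac kn}\,B_\lambda\right)B_F. $$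
   Context: A convex body is a compact convex set with nonempty interior. $p_K(x)=\inf\{t>0:x\in tK\}$ is the Minkowski functional; with $\sigma$ the rotationally invariant probability measure on $S^{n-1}$, $M_q(K)=\left(\int_{S^{n-1}}p_K(\theta)^q\,d\sigma(\theta)\right)^{1/q}$ for $q\neq0$, $M(K)=M_1(K)$, and $b(K)=\max_{S^{n-1}}p_K$. $K^\circ=\{x:\langle x,y\rangle\leq1\ \forall y\in K\}$ is the polar body, $U^*$ is the adjoint of $U$, and sums of sets are Minkowski sums. $G_{n,k}$ is the Grassmannian of $k$-dimensional subspaces of $\mathbb{R}^n$ with its rotationally invariant (Haar) probability measure, $P_F$ is the orthogonal projection onto $F$, and $B_F=B_2^n\cap F$ is the Euclidean unit ball of $F$. *)

theory Defs
  imports "HOL-Probability.Probability" "HOL-Library.Set_Algebras"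
begin

text \<open>
  The constants of the theorem are absolute, i.e. chosen before the dimension n, so the dimension
  cannot be a type. All spaces R^n are therefore realised inside one real inner product space, the
  finitely supported real sequences with the Euclidean inner product, as the subspaces
  \<open>Rn n\<close> of sequences vanishing from index n on.
\<close>

typedef rvec = "{f :: nat \<Rightarrow> real. finite {i. f i \<noteq> 0}}"
  morphisms coord Rvec
  by (rule exI[of _ "\<lambda>_. 0"]) simp

setup_lifting type_definition_rvec

lemma finite_support: "finite {i. coord x i \<noteq> 0}"
  using coord[of x] by simp

lemma rvec_eqI: "(\<And>i. coord x i = coord y i) \<Longrightarrow> x = y"
  by (metis coord_inject ext)

instantiation rvec :: real_vector
begin

lift_definition zero_rvec :: rvec is "\<lambda>_. 0" by simp

lift_definition plus_rvec :: "rvec \<Rightarrow> rvec \<Rightarrow> rvec" is "\<lambda>f g i. f i + g i"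
  subgoal for f g
    by (rule finite_subset[of _ "{i. f i \<noteq> 0} \<union> {i. g i \<noteq> 0}"]) auto
  done

lift_definition uminus_rvec :: "rvec \<Rightarrow> rvec" is "\<lambda>f i. - f i" by simp

lift_definition minus_rvec :: "rvec \<Rightarrow> rvec \<Rightarrow> rvec" is "\<lambda>f g i. f i - g i"
  subgoal for f g
    by (rule finite_subset[of _ "{i. f i \<noteq> 0} \<union> {i. g i \<noteq> 0}"]) auto
  done

lift_definition scaleR_rvec :: "real \<Rightarrow> rvec \<Rightarrow> rvec" is "\<lambda>r f i. r * f i"
  subgoal for r f
    by (rule finite_subset[of _ "{i. f i \<noteq> 0}"]) auto
  done

instance
  by standard (transfer; auto simp: algebra_simps)+

end

lemma coord_simps [simp]:
  "coord 0 i = 0"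
  "coord (x + y) i = coord x i + coord y i"
  "coord (x - y) i = coord x i - coord y i"
  "coord (- x) i = - coord x i"
  "coord (r *\<^sub>R x) i = r * coord x i"
  by (transfer, simp)+

instantiation rvec :: real_inner
begin

definition inner_rvec :: "rvec \<Rightarrow> rvec \<Rightarrow> real"
  where "inner_rvec x y = (\<Sum>i | coord x i \<noteq> 0. coord x i * coord y i)"

definition norm_rvec :: "rvec \<Rightarrow> real"
  where "norm_rvec x = sqrt (inner x x)"

definition dist_rvec :: "rvec \<Rightarrow> rvec \<Rightarrow> real"
  where "dist_rvec x y = norm (x - y)"

definition sgn_rvec :: "rvec \<Rightarrow> rvec"
  where "sgn_rvec x = x /\<^sub>R norm x"

definition uniformity_rvec :: "(rvec \<times> rvec) filter"
  where "uniformity_rvec = (INF e\<in>{0<..}. principal {(x, y). dist x y < e})"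

definition open_rvec :: "rvec set \<Rightarrow> bool"
  where "open_rvec U \<longleftrightarrow> (\<forall>x\<in>U. \<forall>\<^sub>F (x', y) in uniformity. x' = x \<longrightarrow> y \<in> U)"

lemma inner_rvec_superset:
  assumes "finite S" "{i. coord x i \<noteq> 0} \<subseteq> S"
  shows "inner x y = (\<Sum>i\<in>S. coord x i * coord y i)"
  unfolding inner_rvec_def by (rule sum.mono_neutral_left) (use assms in auto)

instance
proof
  fix x y z :: rvec and r :: real
  define S where "S = {i. coord x i \<noteq> 0} \<union> {i. coord y i \<noteq> 0}"
  have fin: "finite S"
    unfolding S_def using finite_support by blast
  have expand: "inner w v = (\<Sum>i\<in>S. coord w i * coord v i)"
    if "{i. coord w i \<noteq> 0} \<subseteq> S" for w v :: rvec
    using inner_rvec_superset[OF fin that] .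
  have sx: "{i. coord x i \<noteq> 0} \<subseteq> S" and sy: "{i. coord y i \<noteq> 0} \<subseteq> S"
    and sxy: "{i. coord (x + y) i \<noteq> 0} \<subseteq> S" and sr: "{i. coord (r *\<^sub>R x) i \<noteq> 0} \<subseteq> S"
    unfolding S_def by auto
  show "dist x y = norm (x - y)"
    by (rule dist_rvec_def)
  show "sgn x = x /\<^sub>R norm x"
    by (rule sgn_rvec_def)
  show "uniformity = (INF e\<in>{0<..}. principal {(x, y :: rvec). dist x y < e})"
    by (rule uniformity_rvec_def)
  show "open U \<longleftrightarrow> (\<forall>x\<in>U. \<forall>\<^sub>F (x', y) in uniformity. x' = x \<longrightarrow> y \<in> U)" for U :: "rvec set"
    by (rule open_rvec_def)
  show "inner x y = inner y x"
    by (simp add: expand[OF sx] expand[OF sy] mult.commute)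
  show "inner (x + y) z = inner x z + inner y z"
    by (simp add: expand[OF sx] expand[OF sy] expand[OF sxy] sum.distrib algebra_simps)
  show "inner (r *\<^sub>R x) y = r * inner x y"
    by (simp add: expand[OF sx] expand[OF sr] sum_distrib_left algebra_simps)
  show "0 \<le> inner x x"
    unfolding inner_rvec_def by (rule sum_nonneg) simp
  show "inner x x = 0 \<longleftrightarrow> x = 0"
  proof
    assume "inner x x = 0"
    then have "\<forall>i\<in>{i. coord x i \<noteq> 0}. coord x i * coord x i = 0"
      unfolding inner_rvec_def by (subst (asm) sum_nonneg_eq_0_iff) (auto simp: finite_support)
    then show "x = 0"
      by (intro rvec_eqI) auto
  qed (simp add: inner_rvec_def)
  show "norm x = sqrt (inner x x)"
    by (rule norm_rvec_def)
qed

end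

definition Rn :: "nat \<Rightarrow> rvec set"
  where "Rn n = {x. \<forall>i\<ge>n. coord x i = 0}"

lemma subspace_Rn: "subspace (Rn n)"
  by (auto simp: Rn_def intro!: subspaceI)

lemma inner_Rn: "x \<in> Rn n \<Longrightarrow> inner x y = (\<Sum>i<n. coord x i * coord y i)"
  by (rule inner_rvec_superset) (auto simp: Rn_def not_le[symmetric])

lemma norm_Rn: "x \<in> Rn n \<Longrightarrow> norm x = sqrt (\<Sum>i<n. (coord x i)\<^sup>2)"
  by (simp add: norm_eq_sqrt_inner inner_Rn power2_eq_square)

definition unit_sphere :: "nat \<Rightarrow> rvec set"
  where "unit_sphere n = sphere 0 1 \<inter> Rn n"

text \<open>An orthogonal transformation of R^n is extended by the identity on the orthogonal complement
  of \<open>Rn n\<close>, which makes it unique as an operator on the ambient space.\<close>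

definition orth_group :: "nat \<Rightarrow> (rvec \<Rightarrow>\<^sub>L rvec) set"
  where "orth_group n =
    {U. orthogonal_transformation (blinfun_apply U) \<and>
        (\<forall>x. (\<forall>y\<in>Rn n. orthogonal x y) \<longrightarrow> blinfun_apply U x = x)}"

definition grassmannian :: "nat \<Rightarrow> nat \<Rightarrow> rvec set set"
  where "grassmannian n k = {F. subspace F \<and> F \<subseteq> Rn n \<and> dim F = k}"

definition orth_proj :: "rvec set \<Rightarrow> rvec \<Rightarrow> rvec"
  where "orth_proj F x = (THE y. y \<in> F \<and> (\<forall>z\<in>F. orthogonal (x - y) z))"

text \<open>The Borel sets of the Grassmannian are those of its usual topology, induced by the embedding
  of F as the operator \<open>P\<^sub>F\<close>.\<close>

definition grassmann_borel :: "nat \<Rightarrow> nat \<Rightarrow> rvec set measure"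
  where "grassmann_borel n k =
    vimage_algebra (grassmannian n k) (\<lambda>F. Blinfun (orth_proj F)) borel"

text \<open>Each of the next three predicates determines its measure uniquely. On the sphere, rotational
  invariance means invariance under the full orthogonal group; for n = 1 invariance under
  determinant-one maps would be no condition at all.\<close>

definition sphere_prob :: "nat \<Rightarrow> rvec measure \<Rightarrow> bool"
  where "sphere_prob n \<sigma> \<longleftrightarrow>
    prob_space \<sigma> \<and> sets \<sigma> = sets (restrict_space borel (unit_sphere n)) \<and>
    (\<forall>V\<in>orth_group n. distr \<sigma> \<sigma> (blinfun_apply V) = \<sigma>)"

definition haar_orth :: "nat \<Rightarrow> (rvec \<Rightarrow>\<^sub>L rvec) measure \<Rightarrow> bool"
  where "haar_orth n \<mu> \<longleftrightarrow>
    prob_space \<mu> \<and> sets \<mu> = sets (restrict_space borel (orth_group n)) \<and>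
    (\<forall>V\<in>orth_group n. distr \<mu> \<mu> (\<lambda>U. V o\<^sub>L U) = \<mu>)"

definition haar_grassmann :: "nat \<Rightarrow> nat \<Rightarrow> rvec set measure \<Rightarrow> bool"
  where "haar_grassmann n k \<nu> \<longleftrightarrow>
    prob_space \<nu> \<and> sets \<nu> = sets (grassmann_borel n k) \<and>
    (\<forall>V\<in>orth_group n. distr \<nu> \<nu> (\<lambda>F. blinfun_apply V ` F) = \<nu>)"

text \<open>Interiors are taken relative to R^n: \<open>Rn n\<close> has empty interior in the ambient space.\<close>

definition interior_Rn :: "nat \<Rightarrow> rvec set \<Rightarrow> rvec set"
  where "interior_Rn n K = top_of_set (Rn n) interior_of K"

definition convex_body :: "nat \<Rightarrow> rvec set \<Rightarrow> bool"
  where "convex_body n K \<longleftrightarrow> K \<subseteq> Rn n \<and> compact K \<and> convex K \<and> interior_Rn n K \<noteq> {}"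

definition polar :: "nat \<Rightarrow> rvec set \<Rightarrow> rvec set"
  where "polar n K = {x \<in> Rn n. \<forall>y\<in>K. inner x y \<le> 1}"

definition minkowski :: "rvec set \<Rightarrow> rvec \<Rightarrow> real"
  where "minkowski K x = Inf {t. t > 0 \<and> x \<in> (\<lambda>y. t *\<^sub>R y) ` K}"

text \<open>Only meaningful for \<open>q \<noteq> 0\<close>. The measure \<open>\<sigma>\<close> is meant to satisfy \<open>sphere_prob n \<sigma>\<close>.\<close>

definition Mq :: "rvec measure \<Rightarrow> real \<Rightarrow> rvec set \<Rightarrow> real"
  where "Mq \<sigma> q K = (\<integral>\<theta>. minkowski K \<theta> powr q \<partial>\<sigma>) powr (1 / q)"

text \<open>For convex bodies with 0 in the interior the supremum is attained, hence a maximum.\<close>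

definition bK :: "nat \<Rightarrow> rvec set \<Rightarrow> real"
  where "bK n K = (SUP \<theta>\<in>unit_sphere n. minkowski K \<theta>)"

text \<open>The sum of sets is the Minkowski sum of \<^theory>\<open>HOL-Library.Set_Algebras\<close>.\<close>

definition A_lam ::
    "nat \<Rightarrow> nat \<Rightarrow> (nat \<Rightarrow> real) \<Rightarrow> (nat \<Rightarrow> rvec set) \<Rightarrow> (nat \<Rightarrow> rvec \<Rightarrow>\<^sub>L rvec) \<Rightarrow> rvec set"
  where "A_lam n m lam K U =
    (\<Sum>j\<in>{1..m}. (\<lambda>x. lam j *\<^sub>R x) ` adjoint (blinfun_apply (U j)) ` polar n (K j))"

definition b_lam :: "nat \<Rightarrow> nat \<Rightarrow> (nat \<Rightarrow> real) \<Rightarrow> (nat \<Rightarrow> rvec set) \<Rightarrow> real"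
  where "b_lam n m lam K = (\<Sum>j\<in>{1..m}. lam j * bK n (K j))"

definition a_lam ::
    "rvec measure \<Rightarrow> nat \<Rightarrow> real \<Rightarrow> (nat \<Rightarrow> real) \<Rightarrow> (nat \<Rightarrow> rvec set) \<Rightarrow> real"
  where "a_lam \<sigma> m q lam K =
    (\<Prod>j\<in>{1..m}. if lam j = 0 then 1 else Mq \<sigma> (- q * lam j) (K j) powr lam j)"

definition M_bar :: "rvec measure \<Rightarrow> nat \<Rightarrow> (nat \<Rightarrow> real) \<Rightarrow> (nat \<Rightarrow> rvec set) \<Rightarrow> real"
  where "M_bar \<sigma> m lam K = (\<Sum>j\<in>{1..m}. lam j * Mq \<sigma> 1 (K j))"

definition B_lam :: "nat \<Rightarrow> nat \<Rightarrow> (nat \<Rightarrow> real) \<Rightarrow> (nat \<Rightarrow> rvec set) \<Rightarrow> real"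
  where "B_lam n m lam K = sqrt (\<Sum>j\<in>{1..m}. (lam j)\<^sup>2 * (bK n (K j))\<^sup>2)"

definition scaled_ball :: "real \<Rightarrow> rvec set \<Rightarrow> rvec set"
  where "scaled_ball r F = (\<lambda>x. r *\<^sub>R x) ` (cball 0 1 \<inter> F)"

end

theory Submission
  imports Defs
begin

text \<open>
  The support function of \<open>A\<^sub>\<lambda>\<close> is the random function
  \<open>h(\<theta>) = (\<Sum>j. \<lambda>\<^sub>j * p\<^sub>j(U\<^sub>j \<theta>))\<close> with \<open>p\<^sub>j\<close> the Minkowski functional of \<open>K\<^sub>j\<close>, and
  the two inclusions say that \<open>h\<close> is bounded below or above on the unit sphere of \<open>F\<close>. For every
  fixed \<open>F\<close> both bounds come from a tail bound at one point and a union bound over a net.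

  For the lower bound, the weighted AM-GM inequality and independence give
  \<open>E h(\<theta>)\<^sup>-\<^sup>q \<le> a\<^sup>-\<^sup>q\<close>. If \<open>h < r\<close> somewhere on the sphere of \<open>F\<close>, then \<open>h < 2 r\<close> at a point of an
  \<open>r/b\<close>-net, and the net can be chosen with at most \<open>C\<^sup>k (b/r)\<^sup>k\<^sup>-\<^sup>1\<close> points; this yields the exponents
  \<open>(k - 1)/\<Delta>\<close> and \<open>u/\<Delta>\<close>.

  For the upper bound, \<open>p\<^sub>j\<close> is sub-Gaussian with variance proxy of order \<open>b(K\<^sub>j)\<^sup>2/n\<close> on the sphere. To
  see this, divide a great circle arc from \<open>x\<close> to \<open>z\<close> into \<open>N\<close> steps. By convexity
  each increment of \<open>p\<^sub>j\<close> is at most the inner product of a subgradient at the end of the step with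
  the step itself, by invariance the tangent direction is uniform given the end point, and convexity of
  \<open>exp\<close> combines the steps; then \<open>N\<close> tends to infinity.
\<close>

section \<open>Finitely supported sequences\<close>

text \<open>The ambient space is infinite-dimensional and incomplete, so compactness, projections
  and adjoints are derived from \<open>Rn n\<close>, and joint measurability of \<open>U x\<close>
  from finite coordinate expansions. The events quantify over all directions of a random subspace;
  their measurability comes from projecting a fixed countable dense set of test vectors. The size of
  the net decides the lower bound: with \<open>(C b / r)^k\<close> points, \<open>r\<close> would
  occur with power \<open>q - k\<close> and the correction exponent would become
  \<open>k / (q - k)\<close>; saving one factor \<open>b / r\<close> turns this into
  \<open>(k - 1) / \<Delta>\<close>. The arc has to be cut into short steps because a subgradient
  bound over an angle \<open>\<epsilon>\<close> loses \<open>b (1 - cos \<epsilon>)\<close>. This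
  loss is of second order, so the total loss vanishes as the steps shrink, while the quadratic terms
  recombine to a bound that depends only on the total angle.\<close>

lift_definition unitvec :: "nat \<Rightarrow> rvec" is "\<lambda>j i. if i = j then 1 else 0"
  by (rule finite_subset[of _ "{_}"]) auto

lemma coord_unitvec: "coord (unitvec j) i = (if i = j then 1 else 0)"
  by (simp add: unitvec.rep_eq)

lemma coord_sum: "coord (\<Sum>a\<in>A. f a) i = (\<Sum>a\<in>A. coord (f a) i)"
  by (induction A rule: infinite_finite_induct) auto

lemma inner_unitvec [simp]: "inner x (unitvec i) = coord x i" "inner (unitvec i) x = coord x i"
proof -
  have "inner (unitvec i) x = (\<Sum>j\<in>{i}. coord (unitvec i) j * coord x j)"
    by (rule inner_rvec_superset) (auto simp: coord_unitvec)
  then show "inner (unitvec i) x = coord x i" by (simp add: coord_unitvec)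
  then show "inner x (unitvec i) = coord x i" by (simp add: inner_commute)
qed

lemma unitvec_in_Rn [simp]: "unitvec i \<in> Rn n \<longleftrightarrow> i < n"
  by (auto simp: Rn_def coord_unitvec not_le[symmetric])

lemma coord_bounded: "\<bar>coord x i\<bar> \<le> norm x"
proof -
  have "norm (unitvec i) = 1" by (simp add: norm_eq_sqrt_inner coord_unitvec)
  then show ?thesis using Cauchy_Schwarz_ineq2[of x "unitvec i"] by simp
qed

lemma continuous_on_coord [continuous_intros]:
  "continuous_on S f \<Longrightarrow> continuous_on S (\<lambda>x. coord (f x) i)"
  using continuous_on_inner[of S f "\<lambda>_. unitvec i"] by simp

lemma Rn_add: "x \<in> Rn n \<Longrightarrow> y \<in> Rn n \<Longrightarrow> x + y \<in> Rn n"
  and Rn_diff: "x \<in> Rn n \<Longrightarrow> y \<in> Rn n \<Longrightarrow> x - y \<in> Rn n"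
  and Rn_scale: "x \<in> Rn n \<Longrightarrow> r *\<^sub>R x \<in> Rn n"
  and Rn_uminus: "x \<in> Rn n \<Longrightarrow> - x \<in> Rn n"
  and Rn_0: "0 \<in> Rn n"
  by (auto simp: Rn_def)

lemma Rn_sum: "(\<And>a. a \<in> A \<Longrightarrow> f a \<in> Rn n) \<Longrightarrow> (\<Sum>a\<in>A. f a) \<in> Rn n"
  by (auto simp: Rn_def coord_sum)

lemmas Rn_intros = Rn_add Rn_diff Rn_scale Rn_uminus Rn_0 Rn_sum

definition truncate :: "nat \<Rightarrow> rvec \<Rightarrow> rvec"
  where "truncate n x = (\<Sum>i<n. coord x i *\<^sub>R unitvec i)"

lemma coord_truncate: "coord (truncate n x) i = (if i < n then coord x i else 0)"
proof -
  have "(\<Sum>j<n. coord x j * (if i = j then 1 else 0)) = (\<Sum>j<n. if j = i then coord x i else 0)"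
    by (rule sum.cong) auto
  then show ?thesis by (simp add: truncate_def coord_sum coord_unitvec)
qed

lemma truncate_in_Rn: "truncate n x \<in> Rn n"
  by (simp add: Rn_def coord_truncate)

lemma truncate_eq: "x \<in> Rn n \<Longrightarrow> truncate n x = x"
  by (rule rvec_eqI) (auto simp: coord_truncate Rn_def not_le[symmetric])

lemma orthogonal_truncate: "y \<in> Rn n \<Longrightarrow> inner y (x - truncate n x) = 0"
  by (simp add: inner_Rn coord_truncate)

lemma Rn_subset_span_unitvec: "x \<in> Rn n \<Longrightarrow> x \<in> span (unitvec ` {..<n})"
  using truncate_eq[of x n, unfolded truncate_def]
  by (metis (no_types, lifting) imageI span_base span_scale span_sum)

lemma exists_in_Rn: "\<exists>n. x \<in> Rn n"
proof -
  obtain n where "\<forall>i\<in>{i. coord x i \<noteq> 0}. i < n"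
    using finite_nat_set_iff_bounded[of "{i. coord x i \<noteq> 0}"] finite_support by blast
  then show ?thesis by (force simp: Rn_def intro!: exI[of _ n])
qed

section \<open>Compactness in \<open>Rn n\<close> and separability of the ambient space\<close>

lemma closed_Rn: "closed (Rn n)"
proof -
  have "Rn n = (\<Inter>i\<in>{n..}. {x. coord x i = 0})" by (auto simp: Rn_def)
  moreover have "closed {x. coord x i = 0}" for i
    by (intro closed_Collect_eq continuous_intros)
  ultimately show ?thesis by auto
qed

text \<open>Induction on \<open>n\<close>: the box in \<open>Rn (Suc n)\<close> is a continuous
  image of the lower box times an interval. The ambient space is not locally compact; compactness of
  polars and separability both start here.\<close>

lemma compact_Rn_box: "compact {x \<in> Rn n. \<forall>i. \<bar>coord x i\<bar> \<le> R}"
proof (cases "R < 0")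
  case True
  have "\<not> \<bar>coord x 0\<bar> \<le> R" for x
    using True by linarith
  then have "{x \<in> Rn n. \<forall>i. \<bar>coord x i\<bar> \<le> R} = {}"
    by blast
  then show ?thesis by (metis compact_empty)
next
  case False
  show ?thesis
  proof (induction n)
    case 0
    have "{x \<in> Rn 0. \<forall>i. \<bar>coord x i\<bar> \<le> R} \<subseteq> {0}"
      by (auto simp: Rn_def intro: rvec_eqI)
    then show ?case by (rule finite_imp_compact[OF finite_subset]) simp
  next
    case (Suc n)
    let ?f = "\<lambda>(x, t). x + t *\<^sub>R unitvec n"
    let ?B = "{x \<in> Rn n. \<forall>i. \<bar>coord x i\<bar> \<le> R}"
    have "{x \<in> Rn (Suc n). \<forall>i. \<bar>coord x i\<bar> \<le> R} = ?f ` (?B \<times> {-R..R})"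
    proof (intro equalityI subsetI)
      fix x assume x: "x \<in> {x \<in> Rn (Suc n). \<forall>i. \<bar>coord x i\<bar> \<le> R}"
      have eq: "x = truncate n x + coord x n *\<^sub>R unitvec n"
      proof (rule rvec_eqI)
        fix i
        have "i \<ge> Suc n \<Longrightarrow> coord x i = 0" using x by (simp add: Rn_def)
        then show "coord x i = coord (truncate n x + coord x n *\<^sub>R unitvec n) i"
          by (cases i n rule: linorder_cases) (auto simp: coord_truncate coord_unitvec)
      qed
      have "\<bar>coord x i\<bar> \<le> R" for i using x by simp
      then have "(truncate n x, coord x n) \<in> ?B \<times> {-R..R}"
        using False by (simp add: truncate_in_Rn coord_truncate abs_le_iff minus_le_iff)
      then show "x \<in> ?f ` (?B \<times> {-R..R})" using eq by (intro image_eqI[of x _ "(truncate n x, coord x n)"]) simp_all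
    next
      fix x assume "x \<in> ?f ` (?B \<times> {-R..R})"
      then show "x \<in> {x \<in> Rn (Suc n). \<forall>i. \<bar>coord x i\<bar> \<le> R}"
        by (auto simp: Rn_def coord_unitvec abs_le_iff)
    qed
    moreover have "continuous_on (?B \<times> {-R..R}) ?f"
      by (auto simp: case_prod_unfold intro!: continuous_intros)
    ultimately show ?case
      using Suc by (auto intro!: compact_continuous_image compact_Times)
  qed
qed

lemma compact_bounded_Rn:
  assumes "closed S" "S \<subseteq> Rn n" "bounded S"
  shows "compact S"
proof -
  obtain R where R: "\<And>x. x \<in> S \<Longrightarrow> norm x \<le> R" using assms(3) by (auto simp: bounded_iff)
  then have "S \<subseteq> {x \<in> Rn n. \<forall>i. \<bar>coord x i\<bar> \<le> R}"
    using assms(2) coord_bounded order_trans by blast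
  then have "{x \<in> Rn n. \<forall>i. \<bar>coord x i\<bar> \<le> R} \<inter> S = S" by blast
  moreover have "compact ({x \<in> Rn n. \<forall>i. \<bar>coord x i\<bar> \<le> R} \<inter> S)"
    by (rule compact_Int_closed[OF compact_Rn_box assms(1)])
  ultimately show ?thesis by simp
qed

text \<open>Finite nets of the boxes at all scales form a countable dense set. Second countability
  makes sums and pairs of measurable maps measurable and later provides a countable set of test
  directions.\<close>

instance rvec :: second_countable_topology
proof
  define cover where "cover n k D \<longleftrightarrow> finite D \<and>
    {x \<in> Rn n. \<forall>i. \<bar>coord x i\<bar> \<le> real n} \<subseteq> (\<Union>x\<in>D. ball x (1 / Suc k))" for n k D
  have "\<exists>D. cover n k D" for n k
    unfolding cover_def
    using compact_Rn_box[of n "real n"] unfolding compact_eq_totally_bounded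
    by (meson of_nat_0_less_iff zero_less_Suc zero_less_divide_1_iff)
  then obtain D where coverD: "\<And>n k. cover n k (D n k)" by metis
  then have finD: "\<And>n k. finite (D n k)"
    and D: "\<And>n k. {x \<in> Rn n. \<forall>i. \<bar>coord x i\<bar> \<le> real n} \<subseteq> (\<Union>x\<in>D n k. ball x (1 / Suc k))"
    by (simp_all add: cover_def)
  define E where "E = (\<Union>n k. D n k)"
  have dense: "\<exists>y\<in>E. dist y x < 1 / Suc k" for x :: rvec and k
  proof -
    obtain n where n: "x \<in> Rn n" using exists_in_Rn by blast
    obtain N where N: "norm x \<le> real N" using real_arch_simple by blast
    have "\<bar>coord x i\<bar> \<le> real (max n N)" for i
      using N coord_bounded[of x i] by linarith
    then have "x \<in> {x \<in> Rn (max n N). \<forall>i. \<bar>coord x i\<bar> \<le> real (max n N)}"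
      using n by (simp add: Rn_def)
    then have "x \<in> (\<Union>x\<in>D (max n N) k. ball x (1 / Suc k))" using D by blast
    then show ?thesis unfolding E_def by auto
  qed
  define B where "B = (\<lambda>(x, k). ball x (1 / Suc k)) ` (E \<times> (UNIV :: nat set))"
  have "countable E"
    unfolding E_def using finD by (intro countable_UN) (auto intro: countable_finite)
  then have "countable B" unfolding B_def by (intro countable_image countable_SIGMA) auto
  moreover have "topological_basis B"
  proof (rule topological_basisI)
    fix O' and x :: rvec
    assume "open O'" "x \<in> O'"
    then obtain e where e: "e > 0" "ball x e \<subseteq> O'" by (auto simp: open_contains_ball)
    obtain k where k: "1 / Suc k < e / 2"
      using e(1) nat_approx_posE[of "e/2"] by auto
    obtain y where y: "y \<in> E" "dist y x < 1 / Suc k" using dense by blast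
    have "ball y (1 / Suc k) \<subseteq> ball x e"
    proof
      fix z assume z: "z \<in> ball y (1 / Suc k)"
      have "dist x z \<le> dist y x + dist y z" by (metis dist_commute dist_triangle)
      with z y k show "z \<in> ball x e" by auto
    qed
    then show "\<exists>B'\<in>B. x \<in> B' \<and> B' \<subseteq> O'"
      using y e unfolding B_def by (intro bexI[of _ "ball y (1 / Suc k)"]) auto
  qed (auto simp: B_def)
  ultimately show "\<exists>B::rvec set set. countable B \<and> open = generate_topology B"
    using topological_basis_imp_subbasis by blast
qed

section \<open>Orthonormal bases of finite-dimensional subspaces\<close>

text \<open>Orthogonalising a basis could produce zero vectors; normalising the nonzero ones leaves
  at most \<open>k\<close>, and since they still span \<open>F\<close> they number exactly
  \<open>k\<close>.\<close>

lemma grassmannian_orthonormal_basis: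
  assumes "F \<in> grassmannian n k"
  obtains e :: "nat \<Rightarrow> rvec" where "\<And>i. i < k \<Longrightarrow> e i \<in> F"
    "\<And>i j. i < k \<Longrightarrow> j < k \<Longrightarrow> inner (e i) (e j) = (if i = j then 1 else 0)"
    "\<And>x. x \<in> F \<Longrightarrow> x = (\<Sum>i<k. inner x (e i) *\<^sub>R e i)"
proof -
  have F: "subspace F" "F \<subseteq> Rn n" "dim F = k" using assms by (auto simp: grassmannian_def)
  obtain B where B: "B \<subseteq> F" "independent B" "F \<subseteq> span B" "card B = dim F"
    using basis_exists by blast
  have "B \<subseteq> span (unitvec ` {..<n})" using B(1) F(2) Rn_subset_span_unitvec by blast
  then have finB: "finite B" using independent_span_bound B(2) by blast
  obtain C where C: "finite C" "card C \<le> card B" "span C = span B" "pairwise orthogonal C"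
    using basis_orthogonal[OF finB] by blast
  have spanC: "span C = F" using C(3) B F(1) by (metis span_minimal subset_antisym)
  define C' where "C' = (\<lambda>x. x /\<^sub>R norm x) ` (C - {0})"
  have fin': "finite C'" using C(1) by (simp add: C'_def)
  have cardC': "card C' \<le> k"
  proof -
    have "card C' \<le> card (C - {0})" unfolding C'_def using C(1) by (intro card_image_le) auto
    also have "\<dots> \<le> card C" using C(1) by (intro card_mono) auto
    finally show ?thesis using C(2) B(4) F(3) by simp
  qed
  have orth: "inner x y = (if x = y then 1 else 0)" if xy: "x \<in> C'" "y \<in> C'" for x y
  proof -
    obtain u v where uv: "u \<in> C" "v \<in> C" "u \<noteq> 0" "v \<noteq> 0" "x = u /\<^sub>R norm u" "y = v /\<^sub>R norm v"
      using xy unfolding C'_def by blast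
    show ?thesis
    proof (cases "u = v")
      case True
      then show ?thesis using uv by (simp add: dot_square_norm power2_eq_square)
    next
      case False
      then have o: "inner u v = 0" using C(4) uv by (auto simp: pairwise_def orthogonal_def)
      have "x \<noteq> y"
      proof
        assume "x = y"
        then have "inner x x = 0" using o uv by (metis inner_scaleR_left inner_scaleR_right mult_zero_right)
        then show False using uv by simp
      qed
      then show ?thesis using o uv by simp
    qed
  qed
  have spanC': "span C' = F"
  proof (rule antisym)
    have "C \<subseteq> F" using spanC span_superset by blast
    then show "span C' \<subseteq> F" unfolding C'_def
      by (intro span_minimal F(1)) (auto intro!: subspace_scale[OF F(1)])
    have "C \<subseteq> span C'"
    proof
      fix x assume "x \<in> C"
      show "x \<in> span C'"
      proof (cases "x = 0")
        case False
        have "x = norm x *\<^sub>R (x /\<^sub>R norm x)" using False by simp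
        moreover have "x /\<^sub>R norm x \<in> C'" using \<open>x \<in> C\<close> False by (auto simp: C'_def)
        ultimately show ?thesis by (metis span_base span_scale)
      qed (simp add: span_zero)
    qed
    then show "F \<subseteq> span C'" using spanC by (metis span_minimal subspace_span)
  qed
  have "dim F \<le> card C'" using dim_le_card[of F C'] spanC' fin' by simp
  then have card: "card C' = k" using cardC' F(3) by simp
  obtain e where e: "bij_betw e {..<k} C'"
    using ex_bij_betw_nat_finite[OF fin'] card by (auto simp: atLeast0LessThan)
  have eC: "e i \<in> C'" if "i < k" for i using e that by (auto simp: bij_betw_def)
  have eorth: "inner (e i) (e j) = (if i = j then 1 else 0)" if "i < k" "j < k" for i j
    using e that orth[OF eC eC] by (auto simp: bij_betw_def inj_on_def)
  have expand: "x = (\<Sum>i<k. inner x (e i) *\<^sub>R e i)" if "x \<in> F" for x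
  proof -
    have "x \<in> span C'" using that spanC' by simp
    then show ?thesis
    proof (induction rule: span_induct_alt)
      case base then show ?case by simp
    next
      case (step c x y)
      obtain j where j: "j < k" "x = e j" using e step(1) by (auto simp: bij_betw_def)
      have "(\<Sum>i<k. inner (c *\<^sub>R x + y) (e i) *\<^sub>R e i)
          = (\<Sum>i<k. (if j = i then c *\<^sub>R e i else 0)) + (\<Sum>i<k. inner y (e i) *\<^sub>R e i)"
        unfolding sum.distrib[symmetric]
        by (rule sum.cong) (use j in \<open>auto simp: inner_add_left scaleR_add_left eorth\<close>)
      also have "\<dots> = c *\<^sub>R x + y" using j step by simp
      finally show ?case by simp
    qed
  qed
  have "e i \<in> F" if "i < k" for i using eC[OF that] spanC' span_base by blast
  then show ?thesis using eorth expand that by blast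
qed

section \<open>The orthogonal group and its Haar measure\<close>

lemma orth_group_inner: "U \<in> orth_group n \<Longrightarrow> inner (blinfun_apply U x) (blinfun_apply U y) = inner x y"
  by (auto simp: orth_group_def orthogonal_transformation_def)

lemma orth_group_norm: "U \<in> orth_group n \<Longrightarrow> norm (blinfun_apply U x) = norm x"
  by (simp add: norm_eq_sqrt_inner orth_group_inner)

text \<open>\<open>U\<close> fixes each \<open>unitvec i\<close> with \<open>i \<ge> n\<close>, so
  preservation of inner products preserves the coordinates from \<open>n\<close> on.\<close>

lemma orth_group_maps:
  assumes "U \<in> orth_group n" "x \<in> Rn n"
  shows "blinfun_apply U x \<in> Rn n"
  unfolding Rn_def
proof safe
  fix i assume "i \<ge> n"
  then have "\<forall>y\<in>Rn n. orthogonal (unitvec i) y"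
    by (auto simp: orthogonal_def Rn_def)
  then have "blinfun_apply U (unitvec i) = unitvec i"
    using assms(1) by (auto simp: orth_group_def)
  then have "coord (blinfun_apply U x) i = inner (blinfun_apply U x) (blinfun_apply U (unitvec i))"
    by simp
  also have "\<dots> = coord x i" using orth_group_inner[OF assms(1)] by simp
  finally show "coord (blinfun_apply U x) i = 0" using assms(2) \<open>i \<ge> n\<close> by (simp add: Rn_def)
qed

lemma orth_group_compose: "V \<in> orth_group n \<Longrightarrow> U \<in> orth_group n \<Longrightarrow> V o\<^sub>L U \<in> orth_group n"
  using orthogonal_transformation_compose[of "blinfun_apply V" "blinfun_apply U"]
  by (simp add: orth_group_def o_def fun_eq_iff[of "blinfun_apply (V o\<^sub>L U)"] orthogonal_transformation_def linear_iff)

text \<open>Householder reflection in the hyperplane orthogonal to \<open>w\<close>; for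
  \<open>w = 0\<close> division by zero gives the identity, which is what
  \<open>reflection_swap\<close> needs when the two points coincide.\<close>

definition reflection :: "rvec \<Rightarrow> rvec \<Rightarrow> rvec"
  where "reflection w x = x - (2 * inner x w / inner w w) *\<^sub>R w"

lemma blinfun_reflection: "blinfun_apply (Blinfun (reflection w)) = reflection w"
proof (rule bounded_linear_Blinfun_apply)
  show "bounded_linear (reflection w)"
    unfolding reflection_def
    by (intro bounded_linear_sub bounded_linear_ident bounded_linear_compose[OF bounded_linear_scaleR_left]
        bounded_linear_compose[OF bounded_linear_divide] bounded_linear_mult_right[THEN bounded_linear_compose]
        bounded_linear_inner_left)
qed

lemma reflection_orth_group:
  assumes "w \<in> Rn n"
  shows "Blinfun (reflection w) \<in> orth_group n"
proof -
  have lin: "linear (reflection w)"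
    using blinfun.bounded_linear_right[of "Blinfun (reflection w)"]
    by (simp add: blinfun_reflection bounded_linear.linear)
  have "inner (reflection w x) (reflection w y) = inner x y" for x y
  proof (cases "w = 0")
    case False
    define \<alpha> where "\<alpha> = 2 * inner x w / inner w w"
    define \<beta> where "\<beta> = 2 * inner y w / inner w w"
    have *: "\<alpha> * inner w w = 2 * inner x w" "\<beta> * inner w w = 2 * inner y w"
      using False by (simp_all add: \<alpha>_def \<beta>_def)
    have "inner (x - \<alpha> *\<^sub>R w) (y - \<beta> *\<^sub>R w)
        = inner x y - \<beta> * inner x w - \<alpha> * inner y w + \<alpha> * (\<beta> * inner w w)"
      by (simp add: inner_diff_left inner_diff_right inner_commute[of w y] algebra_simps)
    also have "\<dots> = inner x y - \<beta> * inner x w + \<alpha> * inner y w" unfolding * by simp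
    also have "\<beta> * inner x w = \<alpha> * inner y w" by (simp add: \<alpha>_def \<beta>_def)
    finally show ?thesis by (simp add: reflection_def \<alpha>_def \<beta>_def)
  qed (simp add: reflection_def)
  moreover have "reflection w x = x" if "\<forall>y\<in>Rn n. orthogonal x y" for x
    using that assms by (simp add: reflection_def orthogonal_def)
  ultimately show ?thesis
    using lin by (auto simp: orth_group_def blinfun_reflection orthogonal_transformation_def)
qed

lemma reflection_uminus: "reflection (- w) = reflection w"
  by (simp add: reflection_def fun_eq_iff)

lemma reflection_swap:
  assumes "norm x = norm y"
  shows "reflection (x - y) x = y"
proof (cases "x = y")
  case False
  have "inner x x = inner y y" using assms by (simp add: norm_eq_sqrt_inner)
  then have "inner (x - y) (x - y) = 2 * inner x (x - y)"
    by (simp add: inner_diff_left inner_diff_right inner_commute)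
  moreover have "inner (x - y) (x - y) \<noteq> 0" using False by simp
  ultimately have "2 * inner x (x - y) / inner (x - y) (x - y) = 1" by (metis (no_types) divide_self)
  then have "reflection (x - y) x = x - 1 *\<^sub>R (x - y)" unfolding reflection_def by (simp only:)
  then show ?thesis by simp
qed (simp add: reflection_def)

text \<open>A reflection is an involution, so the map carrying \<open>x\<close> to \<open>y\<close>
  also carries \<open>y\<close> back; the exchange in both directions is used for symmetrisation in
  \<open>increment_two_sided\<close>.\<close>

lemma orth_group_transitive:
  assumes "x \<in> Rn n" "y \<in> Rn n" "norm x = norm y"
  obtains V where "V \<in> orth_group n" "blinfun_apply V x = y" "blinfun_apply V y = x"
proof
  show "Blinfun (reflection (x - y)) \<in> orth_group n"
    by (intro reflection_orth_group Rn_intros assms)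
  show "blinfun_apply (Blinfun (reflection (x - y))) x = y"
    by (simp add: blinfun_reflection reflection_swap assms)
  have "reflection (x - y) y = reflection (y - x) y"
    using reflection_uminus[of "y - x"] by simp
  then show "blinfun_apply (Blinfun (reflection (x - y))) y = x"
    by (simp add: blinfun_reflection reflection_swap assms)
qed

text \<open>Once \<open>x\<close> has been moved to \<open>x'\<close>, a second reflection along
  \<open>z - y'\<close> moves the image \<open>z\<close> of \<open>y\<close> to \<open>y'\<close>;
  it fixes \<open>x'\<close> because \<open>z\<close> and \<open>y'\<close> are both orthogonal to
  \<open>x'\<close>.\<close>

lemma orth_group_transitive_pairs:
  assumes "x \<in> Rn n" "y \<in> Rn n" "norm x = 1" "norm y = 1" "inner x y = 0"
    and "x' \<in> Rn n" "y' \<in> Rn n" "norm x' = 1" "norm y' = 1" "inner x' y' = 0"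
  obtains V where "V \<in> orth_group n" "blinfun_apply V x = x'" "blinfun_apply V y = y'"
proof -
  obtain V where V: "V \<in> orth_group n" "blinfun_apply V x = x'"
    using orth_group_transitive[of x n x'] assms by auto
  define z where "z = blinfun_apply V y"
  have z: "z \<in> Rn n" "norm z = 1" "inner x' z = 0"
    using V assms orth_group_inner[OF V(1), of x y]
    by (auto simp: z_def orth_group_maps orth_group_norm)
  let ?W = "Blinfun (reflection (z - y'))"
  show ?thesis
  proof
    show "?W o\<^sub>L V \<in> orth_group n"
      by (intro orth_group_compose reflection_orth_group Rn_intros assms z V)
    show "blinfun_apply (?W o\<^sub>L V) x = x'"
      using V z assms by (simp add: blinfun_reflection reflection_def inner_diff_right)
    show "blinfun_apply (?W o\<^sub>L V) y = y'"
      using z assms by (simp add: blinfun_reflection reflection_swap flip: z_def)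
  qed
qed

text \<open>For \<open>U\<close> in \<open>orth_group n\<close> this is, on \<open>Rn n\<close>, the
  adjoint and hence the inverse of \<open>U\<close>. The finite coordinate sum makes sense for every
  operator and is measurable in \<open>U\<close> and \<open>y\<close> jointly.\<close>

definition pullback :: "nat \<Rightarrow> (rvec \<Rightarrow>\<^sub>L rvec) \<Rightarrow> rvec \<Rightarrow> rvec"
  where "pullback n U y = (\<Sum>i<n. inner y (blinfun_apply U (unitvec i)) *\<^sub>R unitvec i)"

lemma pullback_apply:
  assumes "U \<in> orth_group n" "x \<in> Rn n"
  shows "pullback n U (blinfun_apply U x) = x"
  using truncate_eq[OF assms(2)]
  by (simp add: pullback_def orth_group_inner[OF assms(1)] truncate_def)

lemma pullback_compose:
  assumes "V \<in> orth_group n"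
  shows "pullback n (V o\<^sub>L U) (blinfun_apply V y) = pullback n U y"
  by (simp add: pullback_def orth_group_inner[OF assms])

locale haar_orthogonal =
  fixes n :: nat and \<mu> :: "(rvec \<Rightarrow>\<^sub>L rvec) measure"
  assumes haar: "haar_orth n \<mu>"
begin

sublocale prob_space \<mu>
  using haar by (simp add: haar_orth_def)

lemma sets_haar: "sets \<mu> = sets (restrict_space borel (orth_group n))"
  using haar by (simp add: haar_orth_def)

lemma space_haar: "space \<mu> = orth_group n"
  using sets_eq_imp_space_eq[OF sets_haar] by (simp add: space_restrict_space)

lemma measurable_apply: "(\<lambda>U. blinfun_apply U x) \<in> borel_measurable \<mu>"
  by (subst measurable_cong_sets[OF sets_haar refl], rule measurable_restrict_space1)
     (intro borel_measurable_continuous_onI continuous_intros)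

lemma measurable_compose_left:
  assumes "V \<in> orth_group n"
  shows "(\<lambda>U. V o\<^sub>L U) \<in> measurable \<mu> \<mu>"
proof -
  have "(\<lambda>U. V o\<^sub>L U) \<in> measurable (restrict_space borel (orth_group n)) (restrict_space borel (orth_group n))"
    by (intro measurable_restrict_space3 borel_measurable_continuous_onI continuous_intros)
       (use assms orth_group_compose in auto)
  then show ?thesis by (simp cong: measurable_cong_sets add: sets_haar)
qed

lemma nn_integral_left:
  assumes "V \<in> orth_group n" "g \<in> borel_measurable \<mu>"
  shows "(\<integral>\<^sup>+U. g (V o\<^sub>L U) \<partial>\<mu>) = (\<integral>\<^sup>+U. g U \<partial>\<mu>)"
proof -
  have "distr \<mu> \<mu> (\<lambda>U. V o\<^sub>L U) = \<mu>" using haar assms(1) by (simp add: haar_orth_def)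
  then show ?thesis
    using nn_integral_distr[OF measurable_compose_left[OF assms(1)], of g] assms(2) by simp
qed

lemma measurable_pullback [measurable]:
  assumes [measurable]: "f \<in> borel_measurable N" "h \<in> measurable N \<mu>"
  shows "(\<lambda>w. pullback n (h w) (f w)) \<in> borel_measurable N"
proof -
  have [measurable]: "(\<lambda>w. blinfun_apply (h w) (unitvec i)) \<in> borel_measurable N" for i
    using measurable_compose[OF assms(2) measurable_apply] .
  show ?thesis unfolding pullback_def by measurable
qed

text \<open>Right invariance. With \<open>\<Psi>\<close> the average of \<open>G\<close> over the inverses, left invariance gives
  \<open>\<Psi> (V x) (V y) = \<Psi> x y\<close>, and integrating \<open>G (W\<^sup>-\<^sup>1 U x) (W\<^sup>-\<^sup>1 U y)\<close> over both \<open>U\<close> and \<open>W\<close>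
  shows that \<open>\<Psi> x y\<close> is the average of \<open>G\<close> itself.\<close>

lemma nn_integral_right:
  assumes [measurable]: "case_prod G \<in> borel_measurable (borel \<Otimes>\<^sub>M borel)"
    and xy: "x \<in> Rn n" "y \<in> Rn n" and V: "V \<in> orth_group n"
  shows "(\<integral>\<^sup>+U. G (blinfun_apply U (blinfun_apply V x)) (blinfun_apply U (blinfun_apply V y)) \<partial>\<mu>)
    = (\<integral>\<^sup>+U. G (blinfun_apply U x) (blinfun_apply U y) \<partial>\<mu>)"
proof -
  note [measurable] = measurable_apply
  have G [measurable]: "(\<lambda>w. G (f w) (g w)) \<in> borel_measurable N"
    if "f \<in> borel_measurable N" "g \<in> borel_measurable N" for f g and N :: "'z measure"
    using measurable_compose[OF measurable_Pair[OF that] assms(1)] by simp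
  define \<Psi> where "\<Psi> x y = (\<integral>\<^sup>+U. G (pullback n U x) (pullback n U y) \<partial>\<mu>)" for x y
  have inv: "\<Psi> (blinfun_apply V x) (blinfun_apply V y) = \<Psi> x y" if "V \<in> orth_group n" for V x y
  proof -
    have "\<Psi> (blinfun_apply V x) (blinfun_apply V y)
        = (\<integral>\<^sup>+U. G (pullback n (V o\<^sub>L U) (blinfun_apply V x)) (pullback n (V o\<^sub>L U) (blinfun_apply V y)) \<partial>\<mu>)"
      unfolding \<Psi>_def by (rule nn_integral_left[symmetric, OF that]) measurable
    then show ?thesis unfolding \<Psi>_def by (simp add: pullback_compose[OF that])
  qed
  interpret pair_sigma_finite \<mu> \<mu> ..
  have eq: "(\<integral>\<^sup>+U. G (blinfun_apply U x) (blinfun_apply U y) \<partial>\<mu>) = \<Psi> x y"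
    if xy: "x \<in> Rn n" "y \<in> Rn n" for x y
  proof -
    have "(\<integral>\<^sup>+U. G (blinfun_apply U x) (blinfun_apply U y) \<partial>\<mu>)
        = (\<integral>\<^sup>+W. (\<integral>\<^sup>+U. G (blinfun_apply U x) (blinfun_apply U y) \<partial>\<mu>) \<partial>\<mu>)"
      by (simp add: emeasure_space_1)
    also have "\<dots> = (\<integral>\<^sup>+W. (\<integral>\<^sup>+U. G (pullback n W (blinfun_apply U x)) (pullback n W (blinfun_apply U y)) \<partial>\<mu>) \<partial>\<mu>)"
    proof (rule nn_integral_cong)
      fix W assume "W \<in> space \<mu>"
      then have W: "W \<in> orth_group n" by (simp add: space_haar)
      have [measurable]: "(\<lambda>U. W) \<in> measurable \<mu> \<mu>" using \<open>W \<in> space \<mu>\<close> by simp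
      have "(\<integral>\<^sup>+U. G (pullback n W (blinfun_apply U x)) (pullback n W (blinfun_apply U y)) \<partial>\<mu>)
        = (\<integral>\<^sup>+U. G (pullback n W (blinfun_apply (W o\<^sub>L U) x)) (pullback n W (blinfun_apply (W o\<^sub>L U) y)) \<partial>\<mu>)"
        by (rule nn_integral_left[symmetric, OF W]) measurable
      also have "\<dots> = (\<integral>\<^sup>+U. G (blinfun_apply U x) (blinfun_apply U y) \<partial>\<mu>)"
        by (rule nn_integral_cong)
           (simp add: space_haar pullback_apply[OF W] orth_group_maps xy)
      finally show "(\<integral>\<^sup>+U. G (blinfun_apply U x) (blinfun_apply U y) \<partial>\<mu>)
        = (\<integral>\<^sup>+U. G (pullback n W (blinfun_apply U x)) (pullback n W (blinfun_apply U y)) \<partial>\<mu>)" ..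
    qed
    also have "\<dots> = (\<integral>\<^sup>+U. (\<integral>\<^sup>+W. G (pullback n W (blinfun_apply U x)) (pullback n W (blinfun_apply U y)) \<partial>\<mu>) \<partial>\<mu>)"
      by (rule Fubini'[symmetric]) measurable
    also have "\<dots> = (\<integral>\<^sup>+U. \<Psi> x y \<partial>\<mu>)"
      by (rule nn_integral_cong) (simp add: space_haar inv flip: \<Psi>_def)
    finally show ?thesis by (simp add: emeasure_space_1)
  qed
  show ?thesis using eq[OF xy] eq[OF orth_group_maps[OF V xy(1)] orth_group_maps[OF V xy(2)]] inv[OF V] by simp
qed

text \<open>Evaluation is jointly continuous, but the operator space is not second countable, so
  continuity alone does not give measurability for the product sigma-algebra. Expanding in the first
  \<open>n\<close> unit vectors leaves only evaluations at fixed vectors.\<close>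

lemma measurable_apply_Rn:
  assumes f: "f \<in> borel_measurable N" and h: "h \<in> measurable N \<mu>"
    and Rn: "\<And>w. w \<in> space N \<Longrightarrow> f w \<in> Rn n"
  shows "(\<lambda>w. blinfun_apply (h w) (f w)) \<in> borel_measurable N"
proof -
  have [measurable]: "(\<lambda>w. blinfun_apply (h w) (unitvec i)) \<in> borel_measurable N" for i
    by (rule measurable_compose[OF h measurable_apply])
  have [measurable]: "(\<lambda>w. coord (f w) i) \<in> borel_measurable N" for i
    by (rule measurable_compose[OF f]) (intro borel_measurable_continuous_onI continuous_intros)
  have "blinfun_apply (h w) (f w) = (\<Sum>i<n. coord (f w) i *\<^sub>R blinfun_apply (h w) (unitvec i))"
    if "w \<in> space N" for w
  proof -
    have "blinfun_apply (h w) (f w) = blinfun_apply (h w) (truncate n (f w))"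
      using truncate_eq[OF Rn[OF that]] by simp
    then show ?thesis by (simp add: truncate_def blinfun.sum_right blinfun.scaleR_right)
  qed
  then show ?thesis by (simp cong: measurable_cong)
qed

end

section \<open>The uniform measure on the sphere as the law of a randomly rotated point\<close>

locale haar_sphere = haar_orthogonal +
  fixes \<sigma> :: "rvec measure"
  assumes sphere: "sphere_prob n \<sigma>"
begin

sublocale \<sigma>: prob_space \<sigma>
  using sphere by (simp add: sphere_prob_def)

sublocale pair_sigma_finite \<mu> \<sigma> ..

lemma sets_sphere: "sets \<sigma> = sets (restrict_space borel (unit_sphere n))"
  using sphere by (simp add: sphere_prob_def)

lemma space_sphere: "space \<sigma> = unit_sphere n"
  by (simp add: sets_eq_imp_space_eq[OF sets_sphere] space_restrict_space)

lemma measurable_sphere: "g \<in> measurable borel N \<Longrightarrow> g \<in> measurable \<sigma> N"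
  by (subst measurable_cong_sets[OF sets_sphere refl], rule measurable_restrict_space1)

lemma nn_integral_rotate:
  assumes "f \<in> borel_measurable borel" "U \<in> orth_group n"
  shows "(\<integral>\<^sup>+y. f (blinfun_apply U y) \<partial>\<sigma>) = (\<integral>\<^sup>+y. f y \<partial>\<sigma>)"
proof -
  have "blinfun_apply U \<in> measurable (restrict_space borel (unit_sphere n)) (restrict_space borel (unit_sphere n))"
    by (intro measurable_restrict_space3 borel_measurable_continuous_onI continuous_intros)
       (use assms orth_group_maps orth_group_norm in \<open>auto simp: unit_sphere_def\<close>)
  then have "blinfun_apply U \<in> measurable \<sigma> \<sigma>" by (simp cong: measurable_cong_sets add: sets_sphere)
  then have "(\<integral>\<^sup>+y. f y \<partial>distr \<sigma> \<sigma> (blinfun_apply U)) = (\<integral>\<^sup>+y. f (blinfun_apply U y) \<partial>\<sigma>)"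
    by (rule nn_integral_distr) (simp add: measurable_sphere assms)
  then show ?thesis using sphere assms by (simp add: sphere_prob_def)
qed

lemma measurable_apply_sphere:
  "f \<in> borel_measurable borel \<Longrightarrow> (\<lambda>(U, y). f (blinfun_apply U y)) \<in> borel_measurable (\<mu> \<Otimes>\<^sub>M \<sigma>)"
  unfolding case_prod_unfold
  by (rule measurable_compose[OF measurable_apply_Rn])
     (auto simp: space_pair_measure space_sphere unit_sphere_def
       intro!: measurable_compose[OF measurable_snd] measurable_sphere)

text \<open>By right invariance and transitivity the left side is the same for all \<open>x\<close>
  on the sphere. Averaging it over \<open>\<sigma>\<close> and exchanging the integrals leaves the
  rotation invariance of \<open>\<sigma>\<close>.\<close>

lemma nn_integral_sphere:
  assumes f: "f \<in> borel_measurable borel" and x: "x \<in> unit_sphere n"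
  shows "(\<integral>\<^sup>+U. f (blinfun_apply U x) \<partial>\<mu>) = (\<integral>\<^sup>+y. f y \<partial>\<sigma>)"
proof -
  note [measurable] = f
  have const: "(\<integral>\<^sup>+U. f (blinfun_apply U y) \<partial>\<mu>) = (\<integral>\<^sup>+U. f (blinfun_apply U x) \<partial>\<mu>)"
    if y: "y \<in> unit_sphere n" for y
  proof -
    obtain V where V: "V \<in> orth_group n" "blinfun_apply V x = y"
      using x y orth_group_transitive[of x n y thesis] unfolding unit_sphere_def by simp
    have "case_prod (\<lambda>x y :: rvec. f x) \<in> borel_measurable (borel \<Otimes>\<^sub>M borel)"
      unfolding case_prod_unfold by measurable
    from nn_integral_right[OF this _ _ V(1), of x x] show ?thesis
      using x V by (simp add: unit_sphere_def)
  qed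
  have "(\<integral>\<^sup>+U. f (blinfun_apply U x) \<partial>\<mu>) = (\<integral>\<^sup>+y. (\<integral>\<^sup>+U. f (blinfun_apply U x) \<partial>\<mu>) \<partial>\<sigma>)"
    by (simp add: \<sigma>.emeasure_space_1)
  also have "\<dots> = (\<integral>\<^sup>+y. (\<integral>\<^sup>+U. f (blinfun_apply U y) \<partial>\<mu>) \<partial>\<sigma>)"
    by (rule nn_integral_cong) (simp add: space_sphere const)
  also have "\<dots> = (\<integral>\<^sup>+U. (\<integral>\<^sup>+y. f (blinfun_apply U y) \<partial>\<sigma>) \<partial>\<mu>)"
    by (rule Fubini'[OF measurable_apply_sphere[OF f]])
  also have "\<dots> = (\<integral>\<^sup>+U. (\<integral>\<^sup>+y. f y \<partial>\<sigma>) \<partial>\<mu>)"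
    by (rule nn_integral_cong) (simp add: space_haar nn_integral_rotate f)
  finally show ?thesis by (simp add: emeasure_space_1)
qed

end

section \<open>Nets on the spheres of subspaces\<close>

text \<open>Two geometric series with ratio \<open>exp (- (1 / L))\<close>, whose gap to 1 is at
  least \<open>1 / (2 * L)\<close> because \<open>1 / L \<le> 1\<close>.\<close>

lemma sum_exp_int_interval:
  fixes L :: real
  assumes "L \<ge> 1"
  shows "(\<Sum>a\<in>{- int M..int M}. exp (- (\<bar>real_of_int a\<bar> / L))) \<le> 4 * L"
proof -
  let ?g = "\<lambda>a. exp (- (\<bar>real_of_int a\<bar> / L))"
  let ?x = "exp (- (1 / L))"
  have x: "?x < 1" "?x \<ge> 0" using assms by simp_all
  define s where "s = 1 / L"
  have s: "0 < s" "s \<le> 1" using assms by (auto simp: s_def)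
  have "exp (- s) \<le> 1 - s / 2"
  proof -
    have "exp (- s) = 1 / exp s" by (simp add: exp_minus inverse_eq_divide)
    also have "\<dots> \<le> 1 / (1 + s)"
      using s exp_ge_add_one_self[of s] by (intro divide_left_mono) auto
    also have "\<dots> \<le> 1 - s / 2"
    proof -
      have "s * s \<le> s" using s mult_left_le[of s s] by simp
      then show ?thesis using s by (simp add: divide_simps algebra_simps)
    qed
    finally show ?thesis .
  qed
  then have x': "1 - ?x \<ge> 1 / (2 * L)" by (simp add: s_def)
  have geo: "(\<Sum>j\<in>{..M}. ?x ^ j) \<le> 2 * L"
  proof -
    have "(\<Sum>j\<in>{..M}. ?x ^ j) = (\<Sum>j<Suc M. ?x ^ j)" by (simp add: lessThan_Suc_atMost)
    also have "\<dots> = (1 - ?x ^ Suc M) / (1 - ?x)"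
      using x by (subst sum_gp_strict) auto
    also have "\<dots> \<le> 1 / (1 - ?x)"
      using x by (intro divide_right_mono) auto
    also have "\<dots> \<le> 1 / (1 / (2 * L))"
      using x x' assms by (intro divide_left_mono) auto
    finally show ?thesis using assms by simp
  qed
  have gx: "?g (int j) = ?x ^ j" "?g (- int j) = ?x ^ j" for j
    by (simp_all add: exp_of_nat_mult[symmetric])
  \<comment> \<open>Zero lies in both halves; counting it twice is harmless in an upper
    bound.\<close>
  have A: "{- int M..int M} = int ` {..M} \<union> (\<lambda>j. - int j) ` {..M}" (is "_ = ?X \<union> ?Y")
  proof (intro equalityI subsetI)
    fix a assume a: "a \<in> {- int M..int M}"
    show "a \<in> ?X \<union> ?Y"
    proof (cases "a \<ge> 0")
      case True then show ?thesis using a by (intro UnI1 image_eqI[of _ _ "nat a"]) auto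
    next
      case False then show ?thesis using a by (intro UnI2 image_eqI[of _ _ "nat (- a)"]) auto
    qed
  qed auto
  have "(\<Sum>a\<in>?X \<union> ?Y. ?g a) \<le> (\<Sum>a\<in>?X. ?g a) + (\<Sum>a\<in>?Y. ?g a)"
    using sum.union_inter[of ?X ?Y ?g] sum_nonneg[of "?X \<inter> ?Y" ?g] by simp
  also have "(\<Sum>a\<in>?X. ?g a) = (\<Sum>j\<in>{..M}. ?x ^ j)"
    unfolding gx[symmetric] by (subst sum.reindex) (auto simp: inj_on_def)
  also have "(\<Sum>a\<in>?Y. ?g a) = (\<Sum>j\<in>{..M}. ?x ^ j)"
    unfolding gx[symmetric] by (subst sum.reindex) (auto simp: inj_on_def)
  finally show ?thesis using geo A by simp
qed

text \<open>Exponential weights replace a volume estimate: after multiplication by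
  \<open>exp k\<close> every point of \<open>S\<close> has weight at least 1, and the weights over
  the surrounding box factor into \<open>k\<close> one-dimensional sums. The 12 is
  \<open>4 * exp 1\<close> rounded up.\<close>

lemma card_int_l1_ball:
  fixes L :: real and k :: nat
  assumes "L \<ge> 1"
  defines "S \<equiv> {z \<in> {..<k} \<rightarrow>\<^sub>E (UNIV :: int set). (\<Sum>i<k. \<bar>real_of_int (z i)\<bar>) \<le> L * k}"
  shows "finite S" and "real (card S) \<le> (12 * L) ^ k"
proof -
  define M where "M = nat \<lfloor>L * k\<rfloor>"
  let ?P = "{..<k} \<rightarrow>\<^sub>E {- int M..int M}"
  have sub: "S \<subseteq> ?P"
  proof
    fix z assume z: "z \<in> S"
    have "z i \<in> {- int M..int M}" if "i < k" for i
    proof -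
      have "\<bar>real_of_int (z i)\<bar> \<le> (\<Sum>i<k. \<bar>real_of_int (z i)\<bar>)"
        using that by (intro member_le_sum) auto
      also have "\<dots> \<le> L * k" using z by (simp add: S_def)
      finally have "\<bar>z i\<bar> \<le> \<lfloor>L * k\<rfloor>" by (simp add: le_floor_iff)
      then have "\<bar>z i\<bar> \<le> int M" unfolding M_def by linarith
      then show ?thesis by auto
    qed
    then show "z \<in> ?P" using z by (auto simp: S_def PiE_def)
  qed
  show fin: "finite S" by (rule finite_subset[OF sub]) (auto intro: finite_PiE)
  have "real (card S) = (\<Sum>z\<in>S. 1)" by simp
  also have "\<dots> \<le> (\<Sum>z\<in>S. exp k * (\<Prod>i<k. exp (- (\<bar>real_of_int (z i)\<bar> / L))))"
  proof (rule sum_mono)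
    fix z assume "z \<in> S"
    then have "(\<Sum>i<k. \<bar>real_of_int (z i)\<bar>) \<le> L * k" by (simp add: S_def)
    then have "(\<Sum>i<k. \<bar>real_of_int (z i)\<bar> / L) \<le> k"
      using assms(1) by (simp add: field_simps flip: sum_divide_distrib)
    then show "1 \<le> exp k * (\<Prod>i<k. exp (- (\<bar>real_of_int (z i)\<bar> / L)))"
      by (simp add: exp_sum[symmetric] sum_negf flip: exp_add)
  qed
  also have "\<dots> \<le> (\<Sum>z\<in>?P. exp k * (\<Prod>i<k. exp (- (\<bar>real_of_int (z i)\<bar> / L))))"
    using sub by (intro sum_mono2) (auto intro: finite_PiE intro!: prod_nonneg mult_nonneg_nonneg)
  also have "\<dots> = exp k * (\<Prod>i<k. \<Sum>a\<in>{- int M..int M}. exp (- (\<bar>real_of_int a\<bar> / L)))"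
    by (subst prod_sum_PiE) (auto simp: sum_distrib_left)
  also have "\<dots> \<le> exp k * (\<Prod>i<k. 4 * L)"
    using sum_exp_int_interval[OF assms(1)] by (intro mult_left_mono prod_mono) (auto intro: sum_nonneg)
  also have "\<dots> = (exp 1 * (4 * L)) ^ k"
    by (simp add: power_mult_distrib exp_of_nat_mult[symmetric])
  also have "\<dots> \<le> (12 * L) ^ k"
    using assms(1) exp_le by (intro power_mono) auto
  finally show "real (card S) \<le> (12 * L) ^ k" .
qed

text \<open>The points of a lattice of spacing \<open>\<delta> / (2 * sqrt k)\<close> within distance \<open>\<delta> / 2\<close> of a sphere of
  radius \<open>t\<close> project to a net of the unit sphere. There are about \<open>1 / \<delta>\<close> radii in \<open>{1..2}\<close> for which
  these shells are disjoint, so one of them contains few of the at most \<open>(72 / \<delta>) ^ k\<close> lattice points;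
  this is what gives the exponent \<open>k - 1\<close>.\<close>

lemma sphere_net:
  assumes F: "F \<in> grassmannian n k" and k: "k \<ge> 1" and \<delta>: "0 < \<delta>" "\<delta> \<le> 1"
  obtains N where "finite N" "N \<subseteq> F" "\<And>x. x \<in> N \<Longrightarrow> norm x = 1"
    "real (card N) \<le> 108 ^ k * (1 / \<delta>) ^ (k - 1)"
    "\<And>\<theta>. \<theta> \<in> F \<Longrightarrow> norm \<theta> = 1 \<Longrightarrow> \<exists>x\<in>N. norm (\<theta> - x) \<le> \<delta>"
proof -
  obtain e where e: "\<And>i. i < k \<Longrightarrow> e i \<in> F"
    "\<And>i j. i < k \<Longrightarrow> j < k \<Longrightarrow> inner (e i) (e j) = (if i = j then 1 else 0)"
    and expand: "\<And>x. x \<in> F \<Longrightarrow> x = (\<Sum>i<k. inner x (e i) *\<^sub>R e i)"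
    using grassmannian_orthonormal_basis[OF F] by metis
  have subF: "subspace F" using F by (simp add: grassmannian_def)
  have normsq: "(norm (\<Sum>i<k. c i *\<^sub>R e i))\<^sup>2 = (\<Sum>i<k. (c i)\<^sup>2)" for c
  proof -
    have "inner (\<Sum>i<k. c i *\<^sub>R e i) (\<Sum>i<k. c i *\<^sub>R e i) = (\<Sum>i<k. \<Sum>j<k. c i * (c j * inner (e j) (e i)))"
      by (simp add: inner_sum_left inner_sum_right sum_distrib_left)
    also have "\<dots> = (\<Sum>i<k. \<Sum>j<k. if i = j then c i * c i else 0)"
      by (intro sum.cong refl) (auto simp: e(2))
    also have "\<dots> = (\<Sum>i<k. (c i)\<^sup>2)" by (simp add: power2_eq_square)
    finally show ?thesis by (simp add: power2_norm_eq_inner)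
  qed
  \<comment> \<open>Half of \<open>\<delta>\<close> pays for the distance to the lattice, the other
    half for the radial rescaling to the unit sphere.\<close>
  define d where "d = \<delta> / 2"
  define \<eta> where "\<eta> = d / sqrt k"
  \<comment> \<open>By Cauchy-Schwarz a vector of norm at most 2 has coordinates with absolute sum
    at most \<open>2 * sqrt k\<close>. In units of \<open>\<eta>\<close> and after rounding this is
    at most \<open>(2 / d + 1) * k\<close>, and \<open>3 / d\<close> dominates because
    \<open>d \<le> 1\<close>.\<close>
  define L where "L = 3 / d"
  have d: "0 < d" "d \<le> 1/2" using \<delta> by (auto simp: d_def)
  have \<eta>: "\<eta> > 0" using d k by (simp add: \<eta>_def)
  have L: "L \<ge> 1" using d by (simp add: L_def)
  define S where "S = {z \<in> {..<k} \<rightarrow>\<^sub>E (UNIV :: int set). (\<Sum>i<k. \<bar>real_of_int (z i)\<bar>) \<le> L * k}"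
  note S = card_int_l1_ball[OF L, of k, folded S_def]
  define w where "w z = (\<Sum>i<k. (\<eta> * real_of_int (z i)) *\<^sub>R e i)" for z
  have wF: "w z \<in> F" for z
    unfolding w_def by (intro subspace_sum[OF subF] subspace_scale[OF subF] e(1)) simp
  have approx: "\<exists>z\<in>S. norm (y - w z) \<le> d" if y: "y \<in> F" "norm y \<le> 2" for y
  proof -
    define c where "c i = inner y (e i)" for i
    define z where "z = restrict (\<lambda>i. \<lfloor>c i / \<eta>\<rfloor>) {..<k}"
    have yc: "y = (\<Sum>i<k. c i *\<^sub>R e i)" using expand[OF y(1)] by (simp add: c_def)
    have "(\<Sum>i<k. \<bar>c i\<bar>)\<^sup>2 = (\<Sum>i<k. \<bar>c i\<bar> * 1)\<^sup>2" by simp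
    also have "\<dots> \<le> (\<Sum>i<k. \<bar>c i\<bar>\<^sup>2) * (\<Sum>i<k. 1\<^sup>2)" by (rule Cauchy_Schwarz_ineq_sum)
    also have "\<dots> = (norm y)\<^sup>2 * k" using normsq[of c] yc by simp
    also have "\<dots> \<le> 2\<^sup>2 * real k" using y(2) by (intro mult_right_mono power_mono) auto
    also have "\<dots> = (2 * sqrt k)\<^sup>2" by (simp add: power_mult_distrib)
    finally have c1: "(\<Sum>i<k. \<bar>c i\<bar>) \<le> 2 * sqrt k" by (rule power2_le_imp_le) simp
    have "(\<Sum>i<k. \<bar>real_of_int (z i)\<bar>) \<le> (\<Sum>i<k. \<bar>c i\<bar> / \<eta> + 1)"
    proof (rule sum_mono)
      fix i assume "i \<in> {..<k}"
      then have "z i = \<lfloor>c i / \<eta>\<rfloor>" by (simp add: z_def)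
      then have "\<bar>real_of_int (z i)\<bar> \<le> \<bar>c i / \<eta>\<bar> + 1" by linarith
      then show "\<bar>real_of_int (z i)\<bar> \<le> \<bar>c i\<bar> / \<eta> + 1" using \<eta> by (simp add: abs_divide)
    qed
    also have "\<dots> = (\<Sum>i<k. \<bar>c i\<bar>) / \<eta> + k" by (simp add: sum.distrib sum_divide_distrib)
    also have "\<dots> \<le> 2 * sqrt k / \<eta> + k" using c1 \<eta> by (intro add_right_mono divide_right_mono) auto
    also have "2 * sqrt k / \<eta> = 2 / d * k" using d k by (simp add: \<eta>_def field_simps)
    also have "2 / d * k + k \<le> L * k"
    proof -
      have "2 / d + 1 \<le> L" using d by (simp add: L_def field_simps)
      then have "(2 / d + 1) * k \<le> L * k" by (intro mult_right_mono) auto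
      then show ?thesis by (simp add: algebra_simps)
    qed
    finally have "z \<in> S" by (simp add: S_def z_def)
    have "y - w z = (\<Sum>i<k. (c i - \<eta> * z i) *\<^sub>R e i)"
      by (subst yc) (simp add: w_def sum_subtractf scaleR_diff_left)
    then have "(norm (y - w z))\<^sup>2 = (\<Sum>i<k. (c i - \<eta> * z i)\<^sup>2)" using normsq by simp
    also have "\<dots> \<le> (\<Sum>i<k. \<eta>\<^sup>2)"
    proof (rule sum_mono)
      fix i assume "i \<in> {..<k}"
      then have "z i = \<lfloor>c i / \<eta>\<rfloor>" by (simp add: z_def)
      then have "0 \<le> c i / \<eta> - z i" "c i / \<eta> - z i \<le> 1" by linarith+
      moreover have "c i - \<eta> * z i = \<eta> * (c i / \<eta> - z i)" using \<eta> by (simp add: field_simps)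
      ultimately have "0 \<le> c i - \<eta> * z i" "c i - \<eta> * z i \<le> \<eta>"
        using \<eta> by (simp, metis mult.right_neutral mult_le_cancel_left_pos)
      then show "(c i - \<eta> * z i)\<^sup>2 \<le> \<eta>\<^sup>2" by (intro power_mono) auto
    qed
    also have "\<dots> = d\<^sup>2" using k by (simp add: \<eta>_def power_divide)
    finally have "norm (y - w z) \<le> d" by (rule power2_le_imp_le) (use d in simp)
    then show ?thesis using \<open>z \<in> S\<close> by blast
  qed
  \<comment> \<open>Radii \<open>3 * d\<close> apart keep shells of half-width \<open>d\<close>
    disjoint; there are \<open>J + 1 \<ge> 1 / (3 * d)\<close> of them, and the last radius stays at
    most 2.\<close>
  define J where "J = nat \<lfloor>1 / (3 * d)\<rfloor>"
  define t where "t j = 1 + 3 * d * real j" for j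
  have t: "1 \<le> t j" "t j \<le> 2" if "j \<le> J" for j
  proof -
    have "0 \<le> 1 / (3 * d)" using d(1) by (intro divide_nonneg_nonneg) auto
    then have "0 \<le> \<lfloor>1 / (3 * d)\<rfloor>" by (subst zero_le_floor)
    then have "int j \<le> \<lfloor>1 / (3 * d)\<rfloor>" using that by (simp only: J_def le_nat_iff)
    then have "real j \<le> 1 / (3 * d)" by linarith
    then show "t j \<le> 2" using d by (simp add: t_def field_simps)
  qed (use d in \<open>simp add: t_def\<close>)
  have J: "1 / (3 * d) \<le> real (card {..J})" unfolding J_def by simp linarith
  define Z where "Z j = {z \<in> S. \<bar>norm (w z) - t j\<bar> \<le> d}" for j
  have disj: "disjoint_family_on Z {..J}"
  proof -
    have "Z i \<inter> Z j = {}" if "i < j" for i j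
    proof -
      have "3 * d * real (i + 1) \<le> 3 * d * real j" using that d by (intro mult_left_mono) auto
      then have "t j \<ge> t i + 3 * d" by (simp add: t_def algebra_simps)
      then show ?thesis using d by (auto simp: Z_def)
    qed
    then show ?thesis unfolding disjoint_family_on_def by (metis Int_commute linorder_neqE_nat)
  qed
  have finZ: "finite (Z j)" for j using S(1) by (simp add: Z_def)
  have "(\<Sum>j\<in>{..J}. card (Z j)) = card (\<Union>j\<in>{..J}. Z j)"
    using disj finZ by (intro card_UN_disjoint[symmetric]) (auto simp: disjoint_family_on_def)
  also have "\<dots> \<le> card S" using S(1) by (intro card_mono) (auto simp: Z_def)
  finally have sumZ: "(\<Sum>j\<in>{..J}. card (Z j)) \<le> card S" .
  \<comment> \<open>Pigeonhole: some shell holds at most the average share of the lattice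
    points.\<close>
  obtain j where j: "j \<le> J" "card {..J} * card (Z j) \<le> card S"
  proof (rule ccontr)
    assume "\<not> thesis"
    then have "\<forall>j\<in>{..J}. card {..J} * card (Z j) \<ge> card S + 1" using that by fastforce
    then have "(\<Sum>j\<in>{..J}. card S + 1) \<le> (\<Sum>j\<in>{..J}. card {..J} * card (Z j))" by (intro sum_mono) auto
    then have "card {..J} * (card S + 1) \<le> card {..J} * (\<Sum>j\<in>{..J}. card (Z j))"
      by (simp only: sum_constant sum_distrib_left of_nat_id)
    then have "card S + 1 \<le> (\<Sum>j\<in>{..J}. card (Z j))"
      by (subst (asm) mult_le_cancel1) simp
    then show False using sumZ by simp
  qed
  define N where "N = (\<lambda>z. w z /\<^sub>R norm (w z)) ` Z j"
  have wpos: "norm (w z) > 0" if "z \<in> Z j" for z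
    using that t(1)[OF j(1)] d by (auto simp: Z_def)
  show ?thesis
  proof
    show "finite N" using finZ by (simp add: N_def)
    show "N \<subseteq> F" using wF by (auto simp: N_def intro!: subspace_scale[OF subF])
    show "norm x = 1" if "x \<in> N" for x using that wpos by (auto simp: N_def)
    have "card N \<le> card (Z j)" unfolding N_def using finZ by (rule card_image_le)
    then have "1 / (3 * d) * real (card N) \<le> real (card {..J}) * real (card (Z j))"
      using J d by (intro mult_mono) auto
    also have "\<dots> \<le> real (card S)" using j(2) by (metis of_nat_mult of_nat_le_iff)
    also have "\<dots> \<le> (12 * L) ^ k" by (rule S(2))
    finally have "real (card N) \<le> 3 * d * (12 * L) ^ k" using d by (simp add: field_simps)
    \<comment> \<open>With \<open>3 * d = 3 / 2 * \<delta>\<close> and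
      \<open>12 * L = 72 / \<delta>\<close>, one power of \<open>\<delta>\<close> cancels. The
      leftover \<open>3 / 2\<close> is absorbed into the k-th power, whence
      \<open>108 = 72 * 3 / 2\<close>.\<close>
    also have "\<dots> = 3 / 2 * 72 ^ k * (1 / \<delta>) ^ (k - 1)"
      using k \<delta> by (cases k) (auto simp: d_def L_def power_divide power_mult_distrib field_simps)
    also have "\<dots> \<le> (3 / 2) ^ k * 72 ^ k * (1 / \<delta>) ^ (k - 1)"
      using k \<delta> power_increasing[of 1 k "3/2 :: real"] by (intro mult_right_mono) auto
    also have "(3 / 2) ^ k * 72 ^ k = (108 :: real) ^ k" by (simp flip: power_mult_distrib)
    finally show "real (card N) \<le> 108 ^ k * (1 / \<delta>) ^ (k - 1)" .
    show "\<exists>x\<in>N. norm (\<theta> - x) \<le> \<delta>" if \<theta>: "\<theta> \<in> F" "norm \<theta> = 1" for \<theta>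
    proof -
      have "norm (t j *\<^sub>R \<theta>) = t j" using t(1)[OF j(1)] \<theta> by simp
      then obtain z where z: "z \<in> S" "norm (t j *\<^sub>R \<theta> - w z) \<le> d"
        using approx[of "t j *\<^sub>R \<theta>"] t(2)[OF j(1)] \<theta>(1) subspace_scale[OF subF] by auto
      have near: "\<bar>norm (w z) - t j\<bar> \<le> d"
        using z(2) \<open>norm (t j *\<^sub>R \<theta>) = t j\<close> norm_triangle_ineq3[of "t j *\<^sub>R \<theta>" "w z"] by simp
      then have zZ: "z \<in> Z j" using z by (simp add: Z_def)
      let ?x = "w z /\<^sub>R norm (w z)"
      \<comment> \<open>Rescaling \<open>w z\<close> to norm \<open>t j\<close> costs only the
        deviation of its norm from \<open>t j\<close>; division by \<open>t j \<ge> 1\<close> then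
        carries both errors to the unit sphere.\<close>
      have "t j *\<^sub>R (\<theta> - ?x) = (t j *\<^sub>R \<theta> - w z) + (norm (w z) - t j) *\<^sub>R ?x"
        using wpos[OF zZ] by (simp add: algebra_simps)
      then have "norm (t j *\<^sub>R (\<theta> - ?x)) \<le> norm (t j *\<^sub>R \<theta> - w z) + norm ((norm (w z) - t j) *\<^sub>R ?x)"
        by (metis norm_triangle_ineq)
      also have "norm ((norm (w z) - t j) *\<^sub>R ?x) = \<bar>norm (w z) - t j\<bar>"
      proof -
        have "norm ?x = 1" using wpos[OF zZ] by simp
        then show ?thesis by (simp only: norm_scaleR mult_1_right)
      qed
      also have "norm (t j *\<^sub>R \<theta> - w z) + \<bar>norm (w z) - t j\<bar> \<le> \<delta>"
        using z(2) near by (simp add: d_def)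
      finally have "t j * norm (\<theta> - ?x) \<le> \<delta>" using t(1)[OF j(1)] by simp
      moreover have "1 * norm (\<theta> - ?x) \<le> t j * norm (\<theta> - ?x)"
        using t(1)[OF j(1)] by (intro mult_right_mono) auto
      ultimately have "norm (\<theta> - ?x) \<le> \<delta>" by simp
      then show ?thesis using zZ by (auto simp: N_def)
    qed
  qed
qed

section \<open>Support functions\<close>

definition supp :: "rvec set \<Rightarrow> rvec \<Rightarrow> real"
  where "supp P x = (SUP v\<in>P. inner v x)"

lemma supp_attained:
  assumes "compact P" "P \<noteq> {}"
  obtains v where "v \<in> P" "supp P x = inner v x"
proof -
  obtain v where v: "v \<in> P" "\<And>w. w \<in> P \<Longrightarrow> inner w x \<le> inner v x"
    using continuous_attains_sup[OF assms, of "\<lambda>v. inner v x"] continuous_on_inner[OF continuous_on_id continuous_on_const]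
    by blast
  have "supp P x = inner v x"
    unfolding supp_def using v by (intro cSup_eq_maximum) auto
  with v(1) show ?thesis by (rule that)
qed

lemma supp_upper:
  assumes "compact P" "v \<in> P"
  shows "inner v x \<le> supp P x"
proof -
  have "bounded ((\<lambda>v. inner v x) ` P)"
    by (intro compact_imp_bounded compact_continuous_image continuous_intros assms)
  then show ?thesis
    unfolding supp_def using assms(2) by (intro cSUP_upper bounded_imp_bdd_above)
qed

lemma supp_least:
  assumes "compact P" "P \<noteq> {}" "\<And>v. v \<in> P \<Longrightarrow> inner v x \<le> r"
  shows "supp P x \<le> r"
  using supp_attained[OF assms(1,2), of x] assms(3) by metis

lemma supp_scale:
  assumes "compact P" "P \<noteq> {}" "r \<ge> 0"
  shows "supp P (r *\<^sub>R x) = r * supp P x"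
proof (rule antisym)
  show "supp P (r *\<^sub>R x) \<le> r * supp P x"
    using assms supp_upper by (intro supp_least) (auto intro!: mult_left_mono)
  obtain v where "v \<in> P" "supp P x = inner v x" using supp_attained[OF assms(1,2)] by blast
  then show "r * supp P x \<le> supp P (r *\<^sub>R x)" using supp_upper[OF assms(1), of v "r *\<^sub>R x"] by simp
qed

lemma supp_add:
  assumes "compact P" "P \<noteq> {}"
  shows "supp P (x + y) \<le> supp P x + supp P y"
  using assms supp_upper by (intro supp_least) (auto simp: inner_add_right intro!: add_mono)

lemma supp_nonneg:
  assumes "compact P" "0 \<in> P"
  shows "0 \<le> supp P x"
  using supp_upper[OF assms, of x] by simp

lemma supp_le_norm:
  assumes "compact P" "P \<noteq> {}" "\<And>v. v \<in> P \<Longrightarrow> norm v \<le> b"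
  shows "supp P x \<le> b * norm x"
proof (rule supp_least[OF assms(1,2)])
  fix v assume "v \<in> P"
  have "inner v x \<le> norm v * norm x" by (rule norm_cauchy_schwarz)
  also have "\<dots> \<le> b * norm x" using assms(3)[OF \<open>v \<in> P\<close>] by (intro mult_right_mono) auto
  finally show "inner v x \<le> b * norm x" .
qed

text \<open>Subadditivity and a bound on the norms in \<open>P\<close> make the support function
  Lipschitz with that bound as constant.\<close>

lemma continuous_supp:
  assumes "compact P" "P \<noteq> {}"
  shows "continuous_on UNIV (supp P)"
proof -
  obtain b where b: "b > 0" "\<And>v. v \<in> P \<Longrightarrow> norm v \<le> b"
    using compact_imp_bounded[OF assms(1)] by (auto simp: bounded_pos)
  have *: "supp P x - supp P y \<le> b * norm (x - y)" for x y
    using supp_add[OF assms, of "x - y" y] supp_le_norm[OF assms b(2), of "x - y"] by simp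
  have "dist (supp P x) (supp P y) \<le> b * dist x y" for x y
    using *[of x y] *[of y x] by (simp add: dist_norm norm_minus_commute)
  then have "b-lipschitz_on UNIV (supp P)" using b by (intro lipschitz_onI) auto
  then show ?thesis by (rule lipschitz_on_continuous_on)
qed

lemma measurable_supp [measurable]:
  assumes "compact P" "P \<noteq> {}"
  shows "supp P \<in> borel_measurable borel"
  by (rule borel_measurable_continuous_onI[OF continuous_supp[OF assms]])

section \<open>Sub-Gaussian increments of support functions\<close>

text \<open>This is \<open>ln (cosh x) \<le> x\<^sup>2 / 2\<close>, Hoeffding's estimate for a fair
  sign, taken with probability \<open>1 / 2\<close> and parameter \<open>2 * x\<close>. Evenness
  covers negative \<open>x\<close>.\<close>

lemma cosh_le_exp_square:
  fixes x :: real
  shows "exp x + exp (- x) \<le> 2 * exp (x\<^sup>2 / 2)"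
proof -
  have *: "exp x + exp (- x) \<le> 2 * exp (x\<^sup>2 / 2)" if "x \<ge> 0" for x :: real
  proof -
    have "- (2 * x) * (1 / 2) + ln (1 + 1 / 2 * (exp (2 * x) - 1)) \<le> (2 * x)\<^sup>2 / 8"
      using that by (intro Hoeffdings_lemma_aux) auto
    then have "ln ((1 + exp (2 * x)) / 2) \<le> x + x\<^sup>2 / 2"
      by (simp add: field_simps power2_eq_square)
    then have "exp (ln ((1 + exp (2 * x)) / 2)) \<le> exp (x + x\<^sup>2 / 2)" by simp
    then have "(1 + exp (2 * x)) / 2 \<le> exp (x + x\<^sup>2 / 2)" by (subst (asm) exp_ln) (auto simp: add_pos_pos)
    then have "exp (- x) * (1 + exp (2 * x)) \<le> exp (- x) * (2 * exp (x + x\<^sup>2 / 2))" by simp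
    moreover have "exp (- x) * (1 + exp (2 * x)) = exp x + exp (- x)"
      by (simp add: ring_distribs flip: exp_add)
    moreover have "exp (- x) * (2 * exp (x + x\<^sup>2 / 2)) = 2 * exp (x\<^sup>2 / 2)"
      by (simp add: mult.left_commute[of "exp (- x)"] flip: exp_add)
    ultimately show ?thesis by simp
  qed
  show ?thesis using *[of x] *[of "- x"] by (cases "x \<ge> 0") (auto simp: add.commute)
qed

lemma sum_signs_exp_le:
  fixes c :: "'a \<Rightarrow> real"
  assumes "finite I"
  shows "(\<Sum>s\<in>I \<rightarrow>\<^sub>E {-1, 1}. exp (\<Sum>i\<in>I. s i * c i)) \<le> 2 ^ card I * exp ((\<Sum>i\<in>I. (c i)\<^sup>2) / 2)"
proof -
  have "(\<Sum>s\<in>I \<rightarrow>\<^sub>E {-1, 1}. exp (\<Sum>i\<in>I. s i * c i)) = (\<Sum>s\<in>I \<rightarrow>\<^sub>E {-1, 1 :: real}. \<Prod>i\<in>I. exp (s i * c i))"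
    using assms by (simp add: exp_sum)
  also have "\<dots> = (\<Prod>i\<in>I. \<Sum>r\<in>{-1, 1 :: real}. exp (r * c i))"
    by (rule prod_sum_PiE[symmetric]) (use assms in auto)
  also have "\<dots> \<le> (\<Prod>i\<in>I. 2 * exp ((c i)\<^sup>2 / 2))"
    using cosh_le_exp_square by (intro prod_mono) (auto simp: add.commute)
  also have "\<dots> = 2 ^ card I * exp ((\<Sum>i\<in>I. (c i)\<^sup>2) / 2)"
    using assms by (simp add: prod.distrib exp_sum sum_divide_distrib)
  finally show ?thesis .
qed

text \<open>The vector \<open>z\<close> is the projection of \<open>v\<close> to
  \<open>Rn n\<close>: its squared norm and its inner product with \<open>v\<close> both equal the
  sum, and Cauchy-Schwarz finishes.\<close>

lemma orth_group_Bessel: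
  assumes "U \<in> orth_group n"
  shows "(\<Sum>i<n. (inner v (blinfun_apply U (unitvec i)))\<^sup>2) \<le> (norm v)\<^sup>2"
proof -
  define z where "z = blinfun_apply U (pullback n U v)"
  let ?B = "\<Sum>i<n. (inner v (blinfun_apply U (unitvec i)))\<^sup>2"
  have "coord (pullback n U v) i = (if i < n then inner v (blinfun_apply U (unitvec i)) else 0)" for i
  proof -
    have "(\<Sum>j<n. inner v (blinfun_apply U (unitvec j)) * (if i = j then 1 else 0))
      = (\<Sum>j<n. if j = i then inner v (blinfun_apply U (unitvec i)) else 0)"
      by (rule sum.cong) auto
    then show ?thesis by (simp add: pullback_def coord_sum coord_unitvec)
  qed
  moreover have "pullback n U v \<in> Rn n" unfolding pullback_def by (intro Rn_intros) auto
  ultimately have "(norm (pullback n U v))\<^sup>2 = ?B"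
    by (simp add: norm_Rn sum_nonneg)
  then have 1: "(norm z)\<^sup>2 = ?B" by (simp add: z_def orth_group_norm[OF assms])
  have "inner v z = ?B"
    by (simp add: z_def pullback_def blinfun.sum_right blinfun.scaleR_right inner_sum_right power2_eq_square)
  then have "(norm z)\<^sup>2 \<le> norm v * norm z" using 1 norm_cauchy_schwarz[of v z] by simp
  then have "norm z \<le> norm v" by (cases "norm z = 0") (auto simp: power2_eq_square)
  then show ?thesis unfolding 1[symmetric] by (intro power_mono) auto
qed

context haar_orthogonal
begin

text \<open>The sub-Gaussian bound for an infinitesimal step along a great circle. By right invariance
  the tangent vector \<open>y\<close> may be replaced by any unit vector orthogonal to \<open>x\<close>; averaging over the
  vectors \<open>\<Sum>i. \<plusminus>unitvec i / sqrt (n - 1)\<close> with random signs reduces the bound to \<open>cosh r \<le> exp (r\<^sup>2/2)\<close>,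
  since a vector of \<open>P\<close> at which the supremum in \<open>supp P (U x)\<close> is attained does not depend on the signs.\<close>

lemma increment_tangent:
  fixes P t b \<epsilon>
  assumes P: "compact P" "0 \<in> P" "\<And>v. v \<in> P \<Longrightarrow> norm v \<le> b" and n: "n \<ge> 2" and t: "t \<ge> 0"
    and xy: "x \<in> Rn n" "y \<in> Rn n" "norm x = 1" "norm y = 1" "inner x y = 0"
  shows "(\<integral>\<^sup>+U. ennreal (exp (t * (supp P (blinfun_apply U x)
        - supp P (cos \<epsilon> *\<^sub>R blinfun_apply U x - sin \<epsilon> *\<^sub>R blinfun_apply U y)))) \<partial>\<mu>)
    \<le> ennreal (exp (t * b * (1 - cos \<epsilon>) + t\<^sup>2 * (sin \<epsilon>)\<^sup>2 * b\<^sup>2 / (2 * (real n - 1))))"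
proof -
  note [measurable] = measurable_supp[OF P(1)] measurable_apply
  have Pne: "P \<noteq> {}" using P(2) by auto
  define D where "D a c = supp P a - supp P (cos \<epsilon> *\<^sub>R a - sin \<epsilon> *\<^sub>R c)" for a c
  define G where "G a c = ennreal (exp (t * D a c))" for a c
  have G: "case_prod G \<in> borel_measurable (borel \<Otimes>\<^sub>M borel)"
    unfolding G_def D_def case_prod_unfold using Pne by measurable
  have [measurable]: "(\<lambda>U. G (blinfun_apply U x) (blinfun_apply U y)) \<in> borel_measurable \<mu>" for x y
    unfolding G_def D_def using Pne by measurable
  \<comment> \<open>Index 0 is reserved for the base point, which leaves \<open>n - 1\<close>
    tangent directions; this is the origin of \<open>real n - 1\<close> in the bound.\<close>
  let ?I = "{1..<n}" and ?r = "1 / sqrt (real n - 1)"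
  let ?S = "?I \<rightarrow>\<^sub>E {-1, 1 :: real}"
  define ys where "ys s = (\<Sum>i\<in>?I. (?r * s i) *\<^sub>R unitvec i)" for s :: "nat \<Rightarrow> real"
  have coord_ys: "coord (ys s) i = (if i \<in> ?I then ?r * s i else 0)" for s i
  proof -
    have "(\<Sum>j\<in>?I. (?r * s j) * (if i = j then 1 else 0)) = (\<Sum>j\<in>?I. if j = i then ?r * s i else 0)"
      by (rule sum.cong) auto
    then show ?thesis by (simp add: ys_def coord_sum coord_unitvec)
  qed
  have e0: "unitvec 0 \<in> Rn n" "norm (unitvec 0) = 1"
    using n by (auto simp: norm_eq_sqrt_inner coord_unitvec)
  have ys: "ys s \<in> Rn n" "norm (ys s) = 1" "inner (unitvec 0) (ys s) = 0" if s: "s \<in> ?S" for s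
  proof -
    show Rn: "ys s \<in> Rn n" by (auto simp: Rn_def coord_ys)
    have "(\<Sum>i<n. (coord (ys s) i)\<^sup>2) = (\<Sum>i\<in>?I. (?r * s i)\<^sup>2)"
      by (intro sum.mono_neutral_cong_right) (auto simp: coord_ys)
    also have "\<dots> = (\<Sum>i\<in>?I. ?r\<^sup>2)"
    proof (rule sum.cong)
      fix i assume "i \<in> ?I"
      then have "s i \<in> {-1, 1}" using s by blast
      then show "(?r * s i)\<^sup>2 = ?r\<^sup>2" by auto
    qed simp
    also have "\<dots> = 1" using n by (simp add: power_divide of_nat_diff)
    finally show "norm (ys s) = 1" by (simp add: norm_Rn[OF Rn])
    show "inner (unitvec 0) (ys s) = 0" by (simp add: coord_ys)
  qed
  define \<Phi> where "\<Phi> = (\<integral>\<^sup>+U. G (blinfun_apply U x) (blinfun_apply U y) \<partial>\<mu>)"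
  have \<Phi>: "\<Phi> = (\<integral>\<^sup>+U. G (blinfun_apply U (unitvec 0)) (blinfun_apply U (ys s)) \<partial>\<mu>)" if s: "s \<in> ?S" for s
  proof -
    obtain V where V: "V \<in> orth_group n" "blinfun_apply V x = unitvec 0" "blinfun_apply V y = ys s"
      using orth_group_transitive_pairs[OF xy e0(1) ys(1)[OF s] e0(2) ys(2,3)[OF s]] .
    show ?thesis using nn_integral_right[OF G xy(1,2) V(1)] V(2,3) by (simp add: \<Phi>_def)
  qed
  let ?E = "exp (t * b * (1 - cos \<epsilon>) + t\<^sup>2 * (sin \<epsilon>)\<^sup>2 * b\<^sup>2 / (2 * (real n - 1)))"
  have pw: "(\<Sum>s\<in>?S. exp (t * D (blinfun_apply U (unitvec 0)) (blinfun_apply U (ys s)))) \<le> 2 ^ (n - 1) * ?E"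
    if U: "U \<in> orth_group n" for U
  proof -
    let ?a = "blinfun_apply U (unitvec 0)"
    obtain v where v: "v \<in> P" "supp P ?a = inner v ?a" using supp_attained[OF P(1) Pne] .
    define c where "c i = t * sin \<epsilon> * ?r * inner v (blinfun_apply U (unitvec i))" for i
    have D: "t * D ?a (blinfun_apply U (ys s)) \<le> t * b * (1 - cos \<epsilon>) + (\<Sum>i\<in>?I. s i * c i)" for s
    proof -
      let ?c = "blinfun_apply U (ys s)"
      \<comment> \<open>The maximiser \<open>v\<close> at the end point is merely feasible at the
        starting point, so the increment is bounded by an expression linear in the signs.\<close>
      have "D ?a ?c \<le> inner v ?a - inner v (cos \<epsilon> *\<^sub>R ?a - sin \<epsilon> *\<^sub>R ?c)"
        unfolding D_def using v supp_upper[OF P(1) v(1)] by simp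
      also have "\<dots> = (1 - cos \<epsilon>) * inner v ?a + sin \<epsilon> * inner v ?c"
        by (simp add: inner_diff_right algebra_simps)
      also have "\<dots> \<le> (1 - cos \<epsilon>) * b + sin \<epsilon> * inner v ?c"
      proof -
        have "inner v ?a \<le> norm v * norm ?a" by (rule norm_cauchy_schwarz)
        also have "\<dots> \<le> b" using P(3)[OF v(1)] e0 by (simp add: orth_group_norm[OF U])
        finally show ?thesis by (intro add_right_mono mult_left_mono) auto
      qed
      finally have "t * D ?a ?c \<le> t * ((1 - cos \<epsilon>) * b + sin \<epsilon> * inner v ?c)"
        using t by (rule mult_left_mono)
      also have "inner v ?c = (\<Sum>i\<in>?I. ?r * s i * inner v (blinfun_apply U (unitvec i)))"
        by (simp add: ys_def blinfun.sum_right blinfun.scaleR_right inner_sum_right)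
      also have "t * ((1 - cos \<epsilon>) * b + sin \<epsilon> * (\<Sum>i\<in>?I. ?r * s i * inner v (blinfun_apply U (unitvec i))))
          = t * b * (1 - cos \<epsilon>) + (\<Sum>i\<in>?I. s i * c i)"
        by (simp add: c_def sum_distrib_left algebra_simps)
      finally show ?thesis .
    qed
    have "(\<Sum>i\<in>?I. (c i)\<^sup>2) \<le> t\<^sup>2 * (sin \<epsilon>)\<^sup>2 * ?r\<^sup>2 * b\<^sup>2"
    proof -
      have "(\<Sum>i\<in>?I. (c i)\<^sup>2) = t\<^sup>2 * (sin \<epsilon>)\<^sup>2 * ?r\<^sup>2 * (\<Sum>i\<in>?I. (inner v (blinfun_apply U (unitvec i)))\<^sup>2)"
        unfolding c_def power_mult_distrib sum_distrib_left ..
      also have "(\<Sum>i\<in>?I. (inner v (blinfun_apply U (unitvec i)))\<^sup>2) \<le> (\<Sum>i<n. (inner v (blinfun_apply U (unitvec i)))\<^sup>2)"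
        by (intro sum_mono2) auto
      also have "\<dots> \<le> (norm v)\<^sup>2" by (rule orth_group_Bessel[OF U])
      also have "\<dots> \<le> b\<^sup>2" using P(3)[OF v(1)] by (intro power_mono) auto
      finally show ?thesis by (simp add: mult_left_mono)
    qed
    also have "\<dots> = t\<^sup>2 * (sin \<epsilon>)\<^sup>2 * b\<^sup>2 / (real n - 1)" using n by (simp add: power_divide)
    finally have c2: "(\<Sum>i\<in>?I. (c i)\<^sup>2) / 2 \<le> t\<^sup>2 * (sin \<epsilon>)\<^sup>2 * b\<^sup>2 / (2 * (real n - 1))"
      using n by (simp add: field_simps)
    have "(\<Sum>s\<in>?S. exp (t * D ?a (blinfun_apply U (ys s))))
        \<le> (\<Sum>s\<in>?S. exp (t * b * (1 - cos \<epsilon>)) * exp (\<Sum>i\<in>?I. s i * c i))"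
      using D by (intro sum_mono) (simp flip: exp_add)
    also have "\<dots> \<le> exp (t * b * (1 - cos \<epsilon>)) * (2 ^ card ?I * exp ((\<Sum>i\<in>?I. (c i)\<^sup>2) / 2))"
      unfolding sum_distrib_left[symmetric] by (intro mult_left_mono sum_signs_exp_le) auto
    also have "\<dots> \<le> exp (t * b * (1 - cos \<epsilon>)) * (2 ^ card ?I * exp (t\<^sup>2 * (sin \<epsilon>)\<^sup>2 * b\<^sup>2 / (2 * (real n - 1))))"
      using c2 by (intro mult_left_mono) auto
    finally show ?thesis by (simp add: exp_add mult_ac)
  qed
  have cardS: "card ?S = 2 ^ (n - 1)" by (simp add: card_PiE numeral_2_eq_2)
  have finS: "finite ?S" by (intro finite_PiE) auto
  \<comment> \<open>All sign patterns give the same integral \<open>\<Phi>\<close>; summing them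
    under one integral realises the average over random signs.\<close>
  have "ennreal (2 ^ (n - 1)) * \<Phi> = (\<Sum>s\<in>?S. \<Phi>)"
    by (simp only: sum_constant cardS ennreal_of_nat_eq_real_of_nat) simp
  also have "\<dots> = (\<Sum>s\<in>?S. \<integral>\<^sup>+U. G (blinfun_apply U (unitvec 0)) (blinfun_apply U (ys s)) \<partial>\<mu>)"
    using \<Phi> by (intro sum.cong) auto
  also have "\<dots> = (\<integral>\<^sup>+U. (\<Sum>s\<in>?S. G (blinfun_apply U (unitvec 0)) (blinfun_apply U (ys s))) \<partial>\<mu>)"
    by (rule nn_integral_sum[symmetric]) measurable
  also have "\<dots> \<le> (\<integral>\<^sup>+U. ennreal (2 ^ (n - 1) * ?E) \<partial>\<mu>)"
  proof (rule nn_integral_mono)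
    fix U assume "U \<in> space \<mu>"
    then have "(\<Sum>s\<in>?S. exp (t * D (blinfun_apply U (unitvec 0)) (blinfun_apply U (ys s)))) \<le> 2 ^ (n - 1) * ?E"
      by (intro pw) (simp add: space_haar)
    then show "(\<Sum>s\<in>?S. G (blinfun_apply U (unitvec 0)) (blinfun_apply U (ys s))) \<le> ennreal (2 ^ (n - 1) * ?E)"
      unfolding G_def by (subst sum_ennreal) (auto intro: ennreal_leI)
  qed
  also have "\<dots> = ennreal (2 ^ (n - 1)) * ennreal ?E"
    by (simp add: emeasure_space_1 ennreal_mult)
  finally have "\<Phi> \<le> ennreal ?E"
    by (subst (asm) ennreal_mult_le_mult_iff) auto
  then show ?thesis by (simp add: \<Phi>_def G_def D_def)
qed

text \<open>Jensen with weights \<open>1 / N\<close> raises the parameter of a single step to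
  \<open>s * N\<close>, and a step has angle \<open>\<epsilon> = \<alpha> / N\<close>. The variance
  term depends on \<open>s * N * sin \<epsilon>\<close>, which stays below \<open>s * pi\<close>,
  whereas the loss \<open>s * N * b * (1 - cos \<epsilon>)\<close> is of order
  \<open>1 / N\<close>.\<close>

lemma increment_sub_gaussian:
  assumes P: "compact P" "0 \<in> P" "\<And>v. v \<in> P \<Longrightarrow> norm v \<le> b" and n: "n \<ge> 2" and s: "s \<ge> 0"
    and x: "x \<in> unit_sphere n" and z: "z \<in> unit_sphere n"
  shows "(\<integral>\<^sup>+U. ennreal (exp (s * (supp P (blinfun_apply U z) - supp P (blinfun_apply U x)))) \<partial>\<mu>)
    \<le> ennreal (exp (s\<^sup>2 * pi\<^sup>2 * b\<^sup>2 / (2 * (real n - 1))))" (is "?I \<le> _")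
proof -
  note [measurable] = measurable_supp[OF P(1)] measurable_apply
  have Pne: "P \<noteq> {}" using P(2) by auto
  have b: "b \<ge> 0" using P(3)[OF P(2)] by simp
  have x: "x \<in> Rn n" "norm x = 1" and z: "z \<in> Rn n" "norm z = 1"
    using x z by (auto simp: unit_sphere_def)
  define c where "c = inner x z"
  have c: "-1 \<le> c" "c \<le> 1" using Cauchy_Schwarz_ineq2[of x z] x z by (auto simp: c_def abs_le_iff)
  define \<alpha> where "\<alpha> = arccos c"
  have \<alpha>: "0 \<le> \<alpha>" "\<alpha> \<le> pi" "cos \<alpha> = c"
    using c by (auto simp: \<alpha>_def arccos_lbound arccos_ubound)
  have nzc: "(norm (z - c *\<^sub>R x))\<^sup>2 = (sin \<alpha>)\<^sup>2"
  proof -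
    have "inner x x = 1" "inner z z = 1" using x z by (simp_all add: norm_eq_1)
    then have "(norm (z - c *\<^sub>R x))\<^sup>2 = 1 - c\<^sup>2"
      unfolding power2_norm_eq_inner inner_diff_left inner_diff_right
      by (simp add: inner_commute[of z x] c_def[symmetric] power2_eq_square)
    then show ?thesis using \<alpha>(3) by (simp add: sin_squared_eq)
  qed
  \<comment> \<open>\<open>y\<close> is the unit tangent at \<open>x\<close> towards
    \<open>z\<close>. If \<open>z\<close> is \<open>x\<close> or \<open>- x\<close>, any unit vector
    orthogonal to \<open>x\<close> serves, and one exists because \<open>n \<ge> 2\<close>.\<close>
  obtain y where y: "y \<in> Rn n" "norm y = 1" "inner x y = 0" "z = cos \<alpha> *\<^sub>R x + sin \<alpha> *\<^sub>R y"
  proof (cases "sin \<alpha> = 0")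
    case True
    have "unitvec 0 \<in> Rn n" "norm (unitvec 0) = 1"
      using n by (auto simp: norm_eq_sqrt_inner coord_unitvec)
    then obtain V where V: "V \<in> orth_group n" "blinfun_apply V (unitvec 0) = x"
      using orth_group_transitive[of "unitvec 0" n x thesis] x by auto
    have "inner x (blinfun_apply V (unitvec 1)) = 0"
      unfolding V(2)[symmetric] orth_group_inner[OF V(1)] by (simp add: coord_unitvec)
    moreover have "blinfun_apply V (unitvec 1) \<in> Rn n" "norm (blinfun_apply V (unitvec 1)) = 1"
      using n by (simp_all add: orth_group_maps[OF V(1)] orth_group_norm[OF V(1)])
         (simp add: norm_eq_sqrt_inner coord_unitvec)
    moreover have "z = cos \<alpha> *\<^sub>R x" using nzc True \<alpha>(3) by simp
    ultimately show ?thesis using that True by simp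
  next
    case False
    then have pos: "sin \<alpha> > 0" using sin_ge_zero[OF \<alpha>(1,2)] by simp
    have nz: "norm (z - c *\<^sub>R x) = sin \<alpha>"
      using nzc pos by (simp add: power2_eq_iff_nonneg)
    show ?thesis
    proof (rule that[of "(z - c *\<^sub>R x) /\<^sub>R sin \<alpha>"])
      show "(z - c *\<^sub>R x) /\<^sub>R sin \<alpha> \<in> Rn n" by (intro Rn_intros x z)
      show "norm ((z - c *\<^sub>R x) /\<^sub>R sin \<alpha>) = 1" using nz pos by simp
      have "inner x x = 1" using x by (simp add: norm_eq_1)
      then show "inner x ((z - c *\<^sub>R x) /\<^sub>R sin \<alpha>) = 0" by (simp add: inner_diff_right c_def)
      show "z = cos \<alpha> *\<^sub>R x + sin \<alpha> *\<^sub>R ((z - c *\<^sub>R x) /\<^sub>R sin \<alpha>)" using pos \<alpha>(3) by simp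
    qed
  qed
  have xy: "inner x x = 1" "inner y y = 1" using x y by (simp_all add: norm_eq_1)
  let ?B = "s\<^sup>2 * pi\<^sup>2 * b\<^sup>2 / (2 * (real n - 1))"
  have bound: "?I \<le> ennreal (exp (s * b * pi\<^sup>2 / 2 * inverse (real (Suc k)) + ?B))" for k
  proof -
    define N where "N = Suc k"
    define \<epsilon> where "\<epsilon> = \<alpha> / N"
    define X where "X i = cos (i * \<epsilon>) *\<^sub>R x + sin (i * \<epsilon>) *\<^sub>R y" for i :: nat
    define Y where "Y i = (- sin (i * \<epsilon>)) *\<^sub>R x + cos (i * \<epsilon>) *\<^sub>R y" for i :: nat
    have X0: "X 0 = x" and XN: "X N = z" using y(4) by (simp_all add: X_def \<epsilon>_def N_def)
    have XY: "X i \<in> Rn n" "Y i \<in> Rn n" "norm (X i) = 1" "norm (Y i) = 1" "inner (X i) (Y i) = 0" for i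
      using sin_cos_squared_add3[of "real i * \<epsilon>"] x y xy
      by (auto simp: X_def Y_def norm_eq_1 inner_add_left inner_add_right inner_commute[of y x] algebra_simps
          intro!: Rn_intros)
    \<comment> \<open>Each point is expressed in the orthonormal frame at the end of its step, the
      form in which \<open>increment_tangent\<close> applies.\<close>
    have step: "X i = cos \<epsilon> *\<^sub>R X (Suc i) - sin \<epsilon> *\<^sub>R Y (Suc i)" for i
    proof -
      have "real i * \<epsilon> = real (Suc i) * \<epsilon> - \<epsilon>" by (simp add: algebra_simps)
      then have "cos (real i * \<epsilon>) = cos \<epsilon> * cos (real (Suc i) * \<epsilon>) + sin \<epsilon> * sin (real (Suc i) * \<epsilon>)"
        "sin (real i * \<epsilon>) = cos \<epsilon> * sin (real (Suc i) * \<epsilon>) - sin \<epsilon> * cos (real (Suc i) * \<epsilon>)"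
        by (simp_all only: cos_diff sin_diff mult_ac)
      then show ?thesis unfolding X_def Y_def
        by (simp only: scaleR_add_right scaleR_diff_right scaleR_add_left scaleR_diff_left scaleR_scaleR
            mult_minus_right scaleR_minus_left) simp
    qed
    define D where "D i U = supp P (blinfun_apply U (X (Suc i)))
      - supp P (cos \<epsilon> *\<^sub>R blinfun_apply U (X (Suc i)) - sin \<epsilon> *\<^sub>R blinfun_apply U (Y (Suc i)))" for i U
    have [measurable]: "D i \<in> borel_measurable \<mu>" for i
      unfolding D_def using Pne by measurable
    have D: "D i U = supp P (blinfun_apply U (X (Suc i))) - supp P (blinfun_apply U (X i))" for i U
      by (subst (2) step) (simp add: D_def blinfun.diff_right blinfun.scaleR_right)
    have sumD: "supp P (blinfun_apply U z) - supp P (blinfun_apply U x) = (\<Sum>i<N. D i U)" for U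
      using sum_lessThan_telescope[of "\<lambda>i. supp P (blinfun_apply U (X i))" N] by (simp add: D X0 XN)
    let ?E = "exp (s * N * b * (1 - cos \<epsilon>) + (s * N)\<^sup>2 * (sin \<epsilon>)\<^sup>2 * b\<^sup>2 / (2 * (real n - 1)))"
    have "exp (s * (\<Sum>i<N. D i U)) \<le> (\<Sum>i<N. (1 / N) * exp (s * N * D i U))" for U
    proof -
      have "exp (\<Sum>i<N. (1 / N) *\<^sub>R (s * N * D i U)) \<le> (\<Sum>i<N. (1 / N) * exp (s * N * D i U))"
        by (rule convex_on_sum[OF _ _ exp_convex]) (auto simp: N_def lessThan_empty_iff)
      moreover have "(\<Sum>i<N. (1 / N) *\<^sub>R (s * N * D i U)) = s * (\<Sum>i<N. D i U)"
      proof -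
        have "(1 / N) *\<^sub>R (s * N * D i U) = s * D i U" for i by (simp add: N_def)
        then show ?thesis by (simp only: sum_distrib_left)
      qed
      ultimately show ?thesis by simp
    qed
    then have "?I \<le> (\<integral>\<^sup>+U. ennreal (\<Sum>i<N. (1 / N) * exp (s * N * D i U)) \<partial>\<mu>)"
      unfolding sumD by (intro nn_integral_mono ennreal_leI) auto
    also have "\<dots> = (\<integral>\<^sup>+U. (\<Sum>i<N. ennreal (1 / N) * ennreal (exp (s * N * D i U))) \<partial>\<mu>)"
      by (simp add: sum_ennreal ennreal_mult[symmetric])
    also have "\<dots> = (\<Sum>i<N. ennreal (1 / N) * (\<integral>\<^sup>+U. ennreal (exp (s * N * D i U)) \<partial>\<mu>))"
      by (simp add: nn_integral_sum nn_integral_cmult)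
    also have "\<dots> \<le> (\<Sum>i<N. ennreal (1 / N) * ennreal ?E)"
      unfolding D_def using s XY P n
      by (intro sum_mono mult_left_mono increment_tangent) auto
    also have "\<dots> = ennreal ?E"
      by (simp add: ennreal_mult[symmetric] ennreal_of_nat_eq_real_of_nat) (simp add: N_def)
    also have "\<dots> \<le> ennreal (exp (s * b * pi\<^sup>2 / 2 * inverse (real (Suc k)) + ?B))"
    proof -
      have \<alpha>2: "\<alpha>\<^sup>2 \<le> pi\<^sup>2" using \<alpha> by (intro power_mono) auto
      have "1 - cos \<epsilon> = 2 * (sin (\<epsilon> / 2))\<^sup>2" using cos_double_sin[of "\<epsilon> / 2"] by simp
      also have "(sin (\<epsilon> / 2))\<^sup>2 \<le> (\<epsilon> / 2)\<^sup>2" using abs_sin_x_le_abs_x[of "\<epsilon> / 2"] by (simp only: abs_le_square_iff)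
      also have "2 * (\<epsilon> / 2)\<^sup>2 = \<alpha>\<^sup>2 / (2 * N\<^sup>2)" by (simp add: \<epsilon>_def power_divide)
      also have "\<dots> \<le> pi\<^sup>2 / (2 * N\<^sup>2)" using \<alpha>2 by (intro divide_right_mono) auto
      finally have "s * N * b * (1 - cos \<epsilon>) \<le> s * N * b * (pi\<^sup>2 / (2 * N\<^sup>2))"
        using s b by (intro mult_left_mono) auto
      also have "\<dots> = s * b * pi\<^sup>2 / 2 * inverse (real (Suc k))"
      proof -
        have "real N > 0" by (simp add: N_def)
        then have "s * N * b * (pi\<^sup>2 / (2 * N\<^sup>2)) = s * b * pi\<^sup>2 / 2 * inverse (real N)"
          by (simp add: power2_eq_square field_simps)
        then show ?thesis by (simp only: N_def)
      qed
      finally have 1: "s * N * b * (1 - cos \<epsilon>) \<le> s * b * pi\<^sup>2 / 2 * inverse (real (Suc k))" .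
      have "(sin \<epsilon>)\<^sup>2 \<le> \<epsilon>\<^sup>2" using abs_sin_x_le_abs_x[of \<epsilon>] by (simp only: abs_le_square_iff)
      then have "(s * N)\<^sup>2 * (sin \<epsilon>)\<^sup>2 \<le> (s * N)\<^sup>2 * \<epsilon>\<^sup>2" by (intro mult_left_mono) auto
      also have "\<dots> = s\<^sup>2 * \<alpha>\<^sup>2" by (simp add: \<epsilon>_def N_def power_mult_distrib power_divide)
      also have "\<dots> \<le> s\<^sup>2 * pi\<^sup>2" using \<alpha>2 by (intro mult_left_mono) auto
      finally have "(s * N)\<^sup>2 * (sin \<epsilon>)\<^sup>2 * b\<^sup>2 / (2 * (real n - 1)) \<le> ?B"
        using n by (intro divide_right_mono mult_right_mono) auto
      with 1 show ?thesis by (intro ennreal_leI) (simp only: exp_le_cancel_iff add_mono)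
    qed
    finally show ?thesis .
  qed
  have "(\<lambda>k. ennreal (exp (s * b * pi\<^sup>2 / 2 * inverse (real (Suc k)) + ?B)))
      \<longlonglongrightarrow> ennreal (exp (s * b * pi\<^sup>2 / 2 * 0 + ?B))"
    by (intro tendsto_ennrealI tendsto_intros LIMSEQ_inverse_real_of_nat)
  then show ?thesis using LIMSEQ_le_const[of _ _ ?I] bound by fastforce
qed

text \<open>An orthogonal map exchanging \<open>x\<close> and \<open>z\<close> shows that the
  difference and its negative have the same exponential moment; the difference is at most
  \<open>b\<close> in size, so the sum of the two moments is controlled by \<open>cosh\<close>. This
  settles dimension 1, where there is no tangent direction.\<close>

lemma increment_two_sided:
  assumes P: "compact P" "0 \<in> P" "\<And>v. v \<in> P \<Longrightarrow> norm v \<le> b"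
    and x: "x \<in> unit_sphere n" and z: "z \<in> unit_sphere n"
  shows "(\<integral>\<^sup>+U. ennreal (exp (s * (supp P (blinfun_apply U z) - supp P (blinfun_apply U x)))) \<partial>\<mu>)
    \<le> ennreal (exp (s\<^sup>2 * b\<^sup>2 / 2))"
proof -
  note [measurable] = measurable_supp[OF P(1)] measurable_apply
  have Pne: "P \<noteq> {}" using P(2) by auto
  have x: "x \<in> Rn n" "norm x = 1" and z: "z \<in> Rn n" "norm z = 1"
    using x z by (auto simp: unit_sphere_def)
  define G where "G a c = ennreal (exp (s * (supp P a - supp P c)))" for a c
  have G: "case_prod G \<in> borel_measurable (borel \<Otimes>\<^sub>M borel)"
    unfolding G_def case_prod_unfold using Pne by measurable
  have [measurable]: "(\<lambda>U. G (blinfun_apply U x) (blinfun_apply U y)) \<in> borel_measurable \<mu>" for x y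
    unfolding G_def using Pne by measurable
  define \<Phi> where "\<Phi> = (\<integral>\<^sup>+U. G (blinfun_apply U z) (blinfun_apply U x) \<partial>\<mu>)"
  obtain V where V: "V \<in> orth_group n" "blinfun_apply V x = z" "blinfun_apply V z = x"
    using orth_group_transitive[of x n z] x z by auto
  have "\<Phi> = (\<integral>\<^sup>+U. G (blinfun_apply U x) (blinfun_apply U z) \<partial>\<mu>)"
    using nn_integral_right[OF G x(1) z(1) V(1)] V(2,3) by (simp add: \<Phi>_def)
  then have "2 * \<Phi> = (\<integral>\<^sup>+U. G (blinfun_apply U z) (blinfun_apply U x) + G (blinfun_apply U x) (blinfun_apply U z) \<partial>\<mu>)"
    by (subst nn_integral_add) (auto simp: \<Phi>_def mult_2)
  also have "\<dots> \<le> (\<integral>\<^sup>+U. ennreal (2 * exp (s\<^sup>2 * b\<^sup>2 / 2)) \<partial>\<mu>)"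
  proof (rule nn_integral_mono)
    fix U assume "U \<in> space \<mu>"
    then have U: "U \<in> orth_group n" by (simp add: space_haar)
    define d where "d = supp P (blinfun_apply U z) - supp P (blinfun_apply U x)"
    have nonneg: "0 \<le> supp P y" for y by (rule supp_nonneg[OF P(1,2)])
    have "supp P (blinfun_apply U y) \<le> b" if "norm y = 1" for y
      using supp_le_norm[OF P(1) Pne P(3), of "blinfun_apply U y"] that by (simp add: orth_group_norm[OF U])
    from this[OF x(2)] this[OF z(2)] have "\<bar>d\<bar> \<le> b"
      unfolding d_def using nonneg[of "blinfun_apply U x"] nonneg[of "blinfun_apply U z"] by linarith
    then have "d\<^sup>2 \<le> b\<^sup>2" using abs_le_square_iff[of d b] by linarith
    then have "(s * d)\<^sup>2 / 2 \<le> s\<^sup>2 * b\<^sup>2 / 2" by (simp add: power_mult_distrib mult_left_mono)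
    then have "exp (s * d) + exp (- (s * d)) \<le> 2 * exp (s\<^sup>2 * b\<^sup>2 / 2)"
      using cosh_le_exp_square[of "s * d"] order_trans exp_le_cancel_iff mult_le_cancel_left_pos zero_less_numeral
      by meson
    moreover have "s * (supp P (blinfun_apply U x) - supp P (blinfun_apply U z)) = - (s * d)"
      by (simp add: d_def algebra_simps)
    ultimately show "G (blinfun_apply U z) (blinfun_apply U x) + G (blinfun_apply U x) (blinfun_apply U z)
        \<le> ennreal (2 * exp (s\<^sup>2 * b\<^sup>2 / 2))"
      unfolding G_def d_def[symmetric] by (simp add: ennreal_plus[symmetric] ennreal_leI del: ennreal_plus)
  qed
  also have "\<dots> = 2 * ennreal (exp (s\<^sup>2 * b\<^sup>2 / 2))"
    by (simp add: emeasure_space_1 ennreal_mult)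
  finally have "\<Phi> \<le> ennreal (exp (s\<^sup>2 * b\<^sup>2 / 2))"
    by (subst (asm) ennreal_mult_le_mult_iff) auto
  then show ?thesis by (simp add: \<Phi>_def G_def)
qed

text \<open>The 16 absorbs \<open>pi\<^sup>2\<close>, and \<open>n \<le> 2 * (n - 1)\<close> for
  \<open>n \<ge> 2\<close>; in dimension 1 the two-sided bound is already stronger.\<close>

lemma increment_bound:
  assumes P: "compact P" "0 \<in> P" "\<And>v. v \<in> P \<Longrightarrow> norm v \<le> b" and n: "n \<ge> 1" and s: "s \<ge> 0"
    and x: "x \<in> unit_sphere n" and z: "z \<in> unit_sphere n"
  shows "(\<integral>\<^sup>+U. ennreal (exp (s * (supp P (blinfun_apply U z) - supp P (blinfun_apply U x)))) \<partial>\<mu>)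
    \<le> ennreal (exp (16 * s\<^sup>2 * b\<^sup>2 / n))"
proof (cases "n = 1")
  case True
  have "s\<^sup>2 * b\<^sup>2 / 2 \<le> 16 * s\<^sup>2 * b\<^sup>2 / n" using True by simp
  then show ?thesis
    using increment_two_sided[OF P x z, of s] by (meson ennreal_leI exp_le_cancel_iff order_trans)
next
  case False
  then have n2: "n \<ge> 2" using n by simp
  have "pi\<^sup>2 \<le> 4\<^sup>2" using pi_less_4 by (intro power_mono) auto
  then have "pi\<^sup>2 / (2 * (real n - 1)) \<le> 16 / (2 * (real n - 1))" using n2 by (intro divide_right_mono) auto
  also have "\<dots> \<le> 16 / n" using n2 by (intro divide_left_mono) auto
  finally have "pi\<^sup>2 / (2 * (real n - 1)) \<le> 16 / n" .
  then have "(s\<^sup>2 * b\<^sup>2) * (pi\<^sup>2 / (2 * (real n - 1))) \<le> (s\<^sup>2 * b\<^sup>2) * (16 / n)"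
    by (intro mult_left_mono) auto
  then have "s\<^sup>2 * pi\<^sup>2 * b\<^sup>2 / (2 * (real n - 1)) \<le> 16 * s\<^sup>2 * b\<^sup>2 / n" by (simp add: mult_ac)
  then show ?thesis
    using increment_sub_gaussian[OF P n2 s x z] by (meson ennreal_leI exp_le_cancel_iff order_trans)
qed

end

context haar_sphere
begin

text \<open>The mean \<open>M\<close> is traded for a second point: by Jensen
  \<open>exp (- (s * M))\<close> is at most the \<open>\<sigma>\<close>-average of
  \<open>exp (- (s * supp P y))\<close>, and rotation invariance replaces \<open>y\<close> by
  \<open>U y\<close>. Exchanging the integrals leaves increments between two fixed points under the
  same \<open>U\<close>.\<close>

lemma exp_moment:
  assumes P: "compact P" "0 \<in> P" "\<And>v. v \<in> P \<Longrightarrow> norm v \<le> b" and n: "n \<ge> 1" and s: "s \<ge> 0"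
    and z: "z \<in> unit_sphere n"
  shows "(\<integral>\<^sup>+U. ennreal (exp (s * supp P (blinfun_apply U z))) \<partial>\<mu>)
    \<le> ennreal (exp (s * (\<integral>y. supp P y \<partial>\<sigma>) + 16 * s\<^sup>2 * b\<^sup>2 / n))"
proof -
  have Pne: "P \<noteq> {}" using P(2) by auto
  note [measurable] = measurable_supp[OF P(1) Pne] measurable_apply measurable_sphere[OF measurable_supp[OF P(1) Pne]]
  let ?f = "\<lambda>y. exp (- (s * supp P y))"
  define M where "M = (\<integral>y. supp P y \<partial>\<sigma>)"
  define I where "I = (\<integral>\<^sup>+U. ennreal (exp (s * supp P (blinfun_apply U z))) \<partial>\<mu>)"
  have bd: "0 \<le> supp P y" "supp P y \<le> b * norm y" for y
    using supp_nonneg[OF P(1,2)] supp_le_norm[OF P(1) Pne P(3)] by auto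
  have int: "integrable \<sigma> (supp P)"
    by (rule \<sigma>.integrable_const_bound[where B = b])
       (use bd in \<open>auto simp: space_sphere unit_sphere_def intro!: AE_I2 split: if_splits\<close>, metis mult.right_neutral)
  have intf: "integrable \<sigma> ?f"
    by (rule \<sigma>.integrable_const_bound[where B = 1]) (use bd s in auto)
  \<comment> \<open>Jensen's inequality through the tangent of \<open>exp\<close> at
    \<open>- (s * M)\<close>; the linear term integrates to zero.\<close>
  have "exp (- (s * M)) = (\<integral>y. exp (- (s * M)) * (1 - s * (supp P y - M)) \<partial>\<sigma>)"
    using int by (simp add: M_def \<sigma>.prob_space)
  also have "\<dots> \<le> (\<integral>y. ?f y \<partial>\<sigma>)"
  proof (rule integral_mono)
    show "integrable \<sigma> (\<lambda>y. exp (- (s * M)) * (1 - s * (supp P y - M)))" using int by simp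
    fix y
    have "1 + - (s * (supp P y - M)) \<le> exp (- (s * (supp P y - M)))" by (rule exp_ge_add_one_self)
    then have "exp (- (s * M)) * (1 - s * (supp P y - M)) \<le> exp (- (s * M)) * exp (- (s * (supp P y - M)))"
      by (intro mult_left_mono) auto
    then show "exp (- (s * M)) * (1 - s * (supp P y - M)) \<le> ?f y"
      by (simp add: algebra_simps flip: exp_add)
  qed (rule intf)
  finally have "ennreal (exp (- (s * M))) \<le> ennreal (\<integral>y. ?f y \<partial>\<sigma>)" by (rule ennreal_leI)
  also have "\<dots> = (\<integral>\<^sup>+y. ennreal (?f y) \<partial>\<sigma>)"
    using intf by (intro nn_integral_eq_integral[symmetric]) auto
  finally have J: "ennreal (exp (- (s * M))) \<le> (\<integral>\<^sup>+y. ennreal (?f y) \<partial>\<sigma>)" .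
  have "ennreal (exp (- (s * M))) * I = (\<integral>\<^sup>+U. ennreal (exp (- (s * M))) * ennreal (exp (s * supp P (blinfun_apply U z))) \<partial>\<mu>)"
    unfolding I_def by (rule nn_integral_cmult[symmetric]) measurable
  also have "\<dots> \<le> (\<integral>\<^sup>+U. (\<integral>\<^sup>+y. ennreal (exp (s * (supp P (blinfun_apply U z) - supp P (blinfun_apply U y)))) \<partial>\<sigma>) \<partial>\<mu>)"
  proof (rule nn_integral_mono)
    fix U assume "U \<in> space \<mu>"
    then have U: "U \<in> orth_group n" by (simp add: space_haar)
    have [measurable]: "(\<lambda>y. ennreal (?f (blinfun_apply U y))) \<in> borel_measurable \<sigma>"
    proof (rule measurable_sphere)
      have [measurable]: "blinfun_apply U \<in> borel_measurable borel"
        by (intro borel_measurable_continuous_onI continuous_intros)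
      show "(\<lambda>y. ennreal (?f (blinfun_apply U y))) \<in> borel_measurable borel" by measurable
    qed
    have "ennreal (exp (- (s * M))) * ennreal (exp (s * supp P (blinfun_apply U z)))
        \<le> (\<integral>\<^sup>+y. ennreal (?f y) \<partial>\<sigma>) * ennreal (exp (s * supp P (blinfun_apply U z)))"
      using J by (rule mult_right_mono) simp
    also have "(\<integral>\<^sup>+y. ennreal (?f y) \<partial>\<sigma>) = (\<integral>\<^sup>+y. ennreal (?f (blinfun_apply U y)) \<partial>\<sigma>)"
      by (rule nn_integral_rotate[symmetric, OF _ U]) measurable
    also have "\<dots> * ennreal (exp (s * supp P (blinfun_apply U z)))
        = (\<integral>\<^sup>+y. ennreal (?f (blinfun_apply U y)) * ennreal (exp (s * supp P (blinfun_apply U z))) \<partial>\<sigma>)"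
      by (rule nn_integral_multc[symmetric]) measurable
    also have "\<dots> = (\<integral>\<^sup>+y. ennreal (exp (s * (supp P (blinfun_apply U z) - supp P (blinfun_apply U y)))) \<partial>\<sigma>)"
      by (intro nn_integral_cong) (simp add: ennreal_mult[symmetric] algebra_simps flip: exp_add)
    finally show "ennreal (exp (- (s * M))) * ennreal (exp (s * supp P (blinfun_apply U z))) \<le> \<dots>" .
  qed
  also have "\<dots> = (\<integral>\<^sup>+y. (\<integral>\<^sup>+U. ennreal (exp (s * (supp P (blinfun_apply U z) - supp P (blinfun_apply U y)))) \<partial>\<mu>) \<partial>\<sigma>)"
  proof (rule Fubini'[symmetric])
    have [measurable]: "(\<lambda>w. supp P (blinfun_apply (fst w) (snd w))) \<in> borel_measurable (\<mu> \<Otimes>\<^sub>M \<sigma>)"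
      using measurable_apply_sphere[OF measurable_supp[OF P(1) Pne]] by (simp add: case_prod_unfold)
    have [measurable]: "(\<lambda>w. supp P (blinfun_apply (fst w) z)) \<in> borel_measurable (\<mu> \<Otimes>\<^sub>M \<sigma>)"
      by (rule measurable_compose[OF measurable_fst]) measurable
    show "(\<lambda>(U, y). ennreal (exp (s * (supp P (blinfun_apply U z) - supp P (blinfun_apply U y)))))
        \<in> borel_measurable (\<mu> \<Otimes>\<^sub>M \<sigma>)"
      unfolding case_prod_unfold by measurable
  qed
  also have "\<dots> \<le> (\<integral>\<^sup>+y. ennreal (exp (16 * s\<^sup>2 * b\<^sup>2 / n)) \<partial>\<sigma>)"
    by (intro nn_integral_mono increment_bound P n s z) (simp_all add: space_sphere)
  also have "\<dots> = ennreal (exp (- (s * M))) * ennreal (exp (s * M + 16 * s\<^sup>2 * b\<^sup>2 / n))"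
    by (simp add: \<sigma>.emeasure_space_1 ennreal_mult[symmetric] flip: exp_add)
  finally show ?thesis unfolding I_def M_def by (subst (asm) ennreal_mult_le_mult_iff) auto
qed

end

section \<open>Polar bodies, Minkowski functionals and projections\<close>

text \<open>The separating functional is \<open>z - a\<close> with \<open>a\<close> a nearest point
  of \<open>S\<close>; compactness provides \<open>a\<close> where completeness is not at
  hand.\<close>

lemma separate_point_compact_convex:
  fixes S :: "'a::real_inner set"
  assumes "compact S" "convex S" "S \<noteq> {}" "z \<notin> S"
  obtains a where "a \<in> S" "\<And>y. y \<in> S \<Longrightarrow> inner (z - a) y \<le> inner (z - a) a" "inner (z - a) a < inner (z - a) z"
proof -
  obtain a where a: "a \<in> S" "\<forall>y\<in>S. dist z a \<le> dist z y"
    using continuous_attains_inf[OF assms(1,3), of "dist z"] continuous_on_dist[OF continuous_on_const continuous_on_id] by blast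
  show ?thesis
  proof
    show "a \<in> S" by fact
    show "inner (z - a) y \<le> inner (z - a) a" if "y \<in> S" for y
      using any_closest_point_dot[OF assms(2) compact_imp_closed[OF assms(1)] a(1) that a(2)]
      by (simp add: inner_diff_right)
    have "z - a \<noteq> 0" using a(1) assms(4) by auto
    then have "inner (z - a) (z - a) > 0" by simp
    then show "inner (z - a) a < inner (z - a) z" by (simp only: inner_diff_right)
  qed
qed

locale body =
  fixes n :: nat and K :: "rvec set"
  assumes body: "convex_body n K" and zero_interior: "0 \<in> interior_Rn n K"
begin

lemma body_Rn: "K \<subseteq> Rn n" and body_compact: "compact K" and body_convex: "convex K"
  using body by (auto simp: convex_body_def)

lemma contains_ball: obtains r where "r > 0" "\<And>x. x \<in> Rn n \<Longrightarrow> norm x \<le> r \<Longrightarrow> x \<in> K"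
proof -
  obtain T where T: "openin (top_of_set (Rn n)) T" "0 \<in> T" "T \<subseteq> K"
    using zero_interior by (auto simp: interior_Rn_def interior_of_def)
  obtain e where e: "e > 0" "ball 0 e \<inter> Rn n \<subseteq> T"
    using T(1,2) by (auto simp: openin_contains_ball)
  show ?thesis
  proof (rule that[of "e / 2"])
    fix x assume "x \<in> Rn n" "norm x \<le> e / 2"
    then have "x \<in> ball 0 e \<inter> Rn n" using e(1) by auto
    then show "x \<in> K" using e T by blast
  qed (use e in simp)
qed

lemma zero_in_body: "0 \<in> K"
  using contains_ball Rn_0 by (metis norm_zero less_imp_le)

lemma zero_in_polar: "0 \<in> polar n K"
  by (auto simp: polar_def Rn_0)

lemma polar_nonempty: "polar n K \<noteq> {}"
  using zero_in_polar by auto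

lemma polar_Rn: "polar n K \<subseteq> Rn n"
  by (auto simp: polar_def)

lemma convex_polar: "convex (polar n K)"
proof (rule convexI)
  fix x y and u v :: real
  assume xy: "x \<in> polar n K" "y \<in> polar n K" and uv: "0 \<le> u" "0 \<le> v" "u + v = 1"
  have "inner (u *\<^sub>R x + v *\<^sub>R y) z \<le> 1" if "z \<in> K" for z
  proof -
    have "u * inner x z + v * inner y z \<le> u * 1 + v * 1"
      using xy that uv by (intro add_mono mult_left_mono) (auto simp: polar_def)
    then show ?thesis using uv by (simp add: inner_add_left)
  qed
  then show "u *\<^sub>R x + v *\<^sub>R y \<in> polar n K"
    using xy by (auto simp: polar_def intro!: Rn_intros)
qed

text \<open>A ball of radius \<open>r\<close> inside \<open>K\<close> confines the polar to radius
  \<open>1 / r\<close>.\<close>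

lemma compact_polar: "compact (polar n K)"
proof (rule compact_bounded_Rn[OF _ polar_Rn])
  have "polar n K = Rn n \<inter> (\<Inter>y\<in>K. {x. inner x y \<le> 1})" by (auto simp: polar_def)
  moreover have "closed {x. inner x y \<le> 1}" for y :: rvec
    by (intro closed_Collect_le continuous_intros)
  ultimately show "closed (polar n K)" using closed_Rn by (simp only: closed_Int closed_INT) blast
  obtain r where r: "r > 0" "\<And>x. x \<in> Rn n \<Longrightarrow> norm x \<le> r \<Longrightarrow> x \<in> K" using contains_ball by metis
  have "norm v \<le> 1 / r" if v: "v \<in> polar n K" for v
  proof (cases "v = 0")
    case False
    have "(r / norm v) *\<^sub>R v \<in> K"
      using v r False by (intro r(2) Rn_intros) (auto simp: polar_def)
    then have "inner v ((r / norm v) *\<^sub>R v) \<le> 1" using v by (auto simp: polar_def)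
    then have "r * norm v \<le> 1" using False by (simp add: dot_square_norm power2_eq_square)
    then show ?thesis using r by (simp add: field_simps)
  qed (use r in simp)
  then show "bounded (polar n K)" by (auto simp: bounded_iff)
qed

text \<open>One inequality is immediate from the definition of the polar. For the other, if
  \<open>t\<close> exceeded the support function but \<open>x / t\<close> lay outside
  \<open>K\<close>, a separating vector, scaled to have maximum 1 on \<open>K\<close>, would be a
  polar vector whose inner product with \<open>x\<close> exceeds \<open>t\<close>.\<close>

lemma minkowski_eq_supp:
  assumes x: "x \<in> Rn n"
  shows "minkowski K x = supp (polar n K) x"
proof -
  define T where "T = {t. t > 0 \<and> x \<in> (\<lambda>y. t *\<^sub>R y) ` K}"
  let ?s = "supp (polar n K) x"
  have s: "0 \<le> ?s" by (rule supp_nonneg[OF compact_polar zero_in_polar])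
  have lower: "?s \<le> t" if "t \<in> T" for t
  proof -
    obtain y where y: "y \<in> K" "x = t *\<^sub>R y" "t > 0" using \<open>t \<in> T\<close> by (auto simp: T_def)
    show ?thesis
    proof (rule supp_least[OF compact_polar polar_nonempty])
      fix v assume "v \<in> polar n K"
      then have "t * inner v y \<le> t * 1" using y by (intro mult_left_mono) (auto simp: polar_def)
      then show "inner v x \<le> t" using y by simp
    qed
  qed
  have upper: "t \<in> T" if t: "t > ?s" for t
  proof (rule ccontr)
    assume nT: "t \<notin> T"
    have tpos: "t > 0" using t s by simp
    have notK: "x /\<^sub>R t \<notin> K"
    proof
      assume "x /\<^sub>R t \<in> K"
      moreover have "x = t *\<^sub>R (x /\<^sub>R t)" using tpos by simp
      ultimately show False using nT tpos unfolding T_def by blast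
    qed
    obtain a where a: "a \<in> K" "\<And>y. y \<in> K \<Longrightarrow> inner (x /\<^sub>R t - a) y \<le> inner (x /\<^sub>R t - a) a"
      "inner (x /\<^sub>R t - a) a < inner (x /\<^sub>R t - a) (x /\<^sub>R t)"
      using separate_point_compact_convex[OF body_compact body_convex _ notK] zero_in_body by blast
    define w where "w = x /\<^sub>R t - a"
    have wRn: "w \<in> Rn n" unfolding w_def using a(1) body_Rn by (intro Rn_intros x) auto
    have "w \<noteq> 0" using a(1) notK by (auto simp: w_def)
    \<comment> \<open>The ball around the origin makes the maximum of \<open>w\<close> over
      \<open>K\<close> strictly positive, so that \<open>w\<close> can be scaled into the
      polar.\<close>
    obtain r where r: "r > 0" "\<And>x. x \<in> Rn n \<Longrightarrow> norm x \<le> r \<Longrightarrow> x \<in> K" using contains_ball by metis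
    have "(r / norm w) *\<^sub>R w \<in> K" using \<open>w \<noteq> 0\<close> r wRn by (intro r(2) Rn_intros) auto
    then have "inner w ((r / norm w) *\<^sub>R w) \<le> inner w a" by (rule a(2)[folded w_def])
    moreover have "0 < inner w ((r / norm w) *\<^sub>R w)" using r \<open>w \<noteq> 0\<close> by simp
    ultimately have pos: "inner w a > 0" by simp
    define v where "v = w /\<^sub>R inner w a"
    have "v \<in> polar n K"
      using a(2)[folded w_def] wRn pos by (auto simp: polar_def v_def field_simps intro!: Rn_intros)
    then have "inner v x \<le> ?s" by (rule supp_upper[OF compact_polar])
    moreover have "inner w a < inner w x / t"
      using a(3) unfolding w_def[symmetric] by (simp add: divide_inverse mult.commute)
    then have "t < inner v x"
      using pos tpos by (simp add: v_def field_simps)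
    ultimately show False using t by simp
  qed
  have "Inf T = ?s"
  proof (rule antisym)
    have bdd: "bdd_below T" using lower by (auto simp: bdd_below_def)
    show "Inf T \<le> ?s"
    proof (rule field_le_epsilon)
      fix e :: real assume "e > 0"
      then have "?s + e \<in> T" by (intro upper) simp
      then show "Inf T \<le> ?s + e" using bdd by (rule cInf_lower)
    qed
    show "?s \<le> Inf T" using upper[of "?s + 1"] lower by (intro cInf_greatest) auto
  qed
  then show ?thesis by (simp add: minkowski_def T_def)
qed

text \<open>\<open>K\<close> lies in a ball of radius \<open>R\<close>, so the polar contains the
  ball of radius \<open>1 / R\<close> of \<open>Rn n\<close>. The positive lower bound on the sphere
  makes negative powers integrable.\<close>

lemma supp_polar_lower: obtains r where "r > 0" "\<And>x. x \<in> Rn n \<Longrightarrow> r * norm x \<le> supp (polar n K) x"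
proof -
  obtain R where R: "R > 0" "\<And>x. x \<in> K \<Longrightarrow> norm x \<le> R"
    using compact_imp_bounded[OF body_compact] by (auto simp: bounded_pos)
  show ?thesis
  proof (rule that[of "1 / R"])
    fix x assume x: "x \<in> Rn n"
    show "1 / R * norm x \<le> supp (polar n K) x"
    proof (cases "x = 0")
      case True then show ?thesis using supp_nonneg[OF compact_polar zero_in_polar] by simp
    next
      case False
      let ?v = "(1 / (R * norm x)) *\<^sub>R x"
      have "inner ?v y \<le> 1" if "y \<in> K" for y
      proof -
        have "inner x y \<le> norm x * norm y" by (rule norm_cauchy_schwarz)
        also have "\<dots> \<le> norm x * R" using R(2)[OF that] by (intro mult_left_mono) auto
        finally show ?thesis using R(1) False by (simp add: field_simps)
      qed
      then have "?v \<in> polar n K" using x by (auto simp: polar_def intro!: Rn_intros)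
      then have "inner ?v x \<le> supp (polar n K) x" by (rule supp_upper[OF compact_polar])
      then show ?thesis using R(1) False by (simp add: dot_square_norm power2_eq_square)
    qed
  qed (use R in simp)
qed

text \<open>A polar vector, tested in its own direction, bounds the support function there from
  below by its norm. In this way \<open>bK\<close> serves as the radius of the polar in the
  Lipschitz and increment estimates.\<close>

lemma norm_polar_le_bK:
  assumes "n \<ge> 1" and v: "v \<in> polar n K"
  shows "norm v \<le> bK n K"
proof -
  obtain b where b: "\<And>v. v \<in> polar n K \<Longrightarrow> norm v \<le> b"
    using compact_imp_bounded[OF compact_polar] by (auto simp: bounded_iff)
  \<comment> \<open>The supremum in \<open>bK\<close> is informative only for a set bounded
    above.\<close>
  have bdd: "bdd_above (minkowski K ` unit_sphere n)"
    using supp_le_norm[OF compact_polar polar_nonempty b]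
    by (auto simp: bdd_above_def unit_sphere_def minkowski_eq_supp intro!: exI[of _ b])
      (metis mult.right_neutral)
  have le: "supp (polar n K) x \<le> bK n K" if "x \<in> unit_sphere n" for x
    using cSUP_upper[OF that bdd] that by (simp add: bK_def minkowski_eq_supp unit_sphere_def)
  have e0: "unitvec 0 \<in> unit_sphere n"
    using assms(1) by (auto simp: unit_sphere_def norm_eq_sqrt_inner coord_unitvec)
  show ?thesis
  proof (cases "v = 0")
    case True
    then show ?thesis using le[OF e0] supp_nonneg[OF compact_polar zero_in_polar, of "unitvec 0"] by simp
  next
    case False
    have "v /\<^sub>R norm v \<in> unit_sphere n"
      using False polar_Rn v by (auto simp: unit_sphere_def intro!: Rn_intros)
    from le[OF this] supp_upper[OF compact_polar v, of "v /\<^sub>R norm v"] show ?thesis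
      using False by (simp add: dot_square_norm power2_eq_square mult.assoc[symmetric])
  qed
qed

lemma bK_pos:
  assumes "n \<ge> 1"
  shows "bK n K > 0"
proof -
  obtain r where r: "r > 0" "\<And>x. x \<in> Rn n \<Longrightarrow> r * norm x \<le> supp (polar n K) x" using supp_polar_lower by metis
  have "unitvec 0 \<in> Rn n" "norm (unitvec 0) = 1"
    using assms by (auto simp: norm_eq_sqrt_inner coord_unitvec)
  with r(2)[of "unitvec 0"] supp_le_norm[OF compact_polar polar_nonempty norm_polar_le_bK[OF assms], of "unitvec 0"]
  show ?thesis using r(1) by simp
qed

end

text \<open>\<open>adjoint\<close> merely selects a function with the adjoint identity, so an
  explicit one is exhibited: \<open>pullback\<close> on the \<open>Rn n\<close> part and the
  identity on the complement, which \<open>U\<close> fixes.\<close>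

lemma adjoint_orth_group_eq:
  assumes U: "U \<in> orth_group n"
  shows "adjoint (blinfun_apply U) = (\<lambda>y. y - truncate n y + pullback n U y)"
proof (rule adjoint_unique, intro allI)
  fix x y
  have "\<forall>z\<in>Rn n. orthogonal (x - truncate n x) z"
    using orthogonal_truncate[of _ n x] by (simp add: orthogonal_def inner_commute)
  then have fixed: "blinfun_apply U (x - truncate n x) = x - truncate n x"
    using U by (auto simp: orth_group_def)
  have trunc: "inner (blinfun_apply U (truncate n x)) y = inner x (pullback n U y)"
    by (simp add: truncate_def pullback_def blinfun.sum_right blinfun.scaleR_right inner_sum_left inner_sum_right
        inner_commute[of y] mult.commute)
  have comm: "inner (truncate n x) y = inner x (truncate n y)"
    by (simp add: truncate_def inner_sum_left inner_sum_right mult.commute)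
  have "blinfun_apply U x = blinfun_apply U (truncate n x) + (x - truncate n x)"
    using fixed by (simp add: blinfun.diff_right algebra_simps)
  then have "inner (blinfun_apply U x) y = inner x (pullback n U y) + inner x y - inner x (truncate n y)"
    using trunc comm by (simp add: inner_add_left inner_diff_left)
  then show "inner (blinfun_apply U x) y = inner x (y - truncate n y + pullback n U y)"
    by (simp add: inner_add_right inner_diff_right)
qed

lemma inner_pullback:
  assumes "x \<in> Rn n"
  shows "inner (pullback n U v) x = inner v (blinfun_apply U x)"
proof -
  have "inner v (blinfun_apply U (truncate n x)) = inner (pullback n U v) x"
    by (simp add: truncate_def pullback_def blinfun.sum_right blinfun.scaleR_right inner_sum_left inner_sum_right
        mult.commute)
  then show ?thesis using truncate_eq[OF assms] by simp
qed

lemma bounded_linear_pullback: "bounded_linear (pullback n U)"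
  unfolding pullback_def
  by (intro bounded_linear_sum bounded_linear_compose[OF bounded_linear_scaleR_left] bounded_linear_inner_left)

lemma compact_convex_set_sum:
  fixes S :: "'i \<Rightarrow> 'a::real_normed_vector set"
  assumes "\<And>i. i \<in> I \<Longrightarrow> compact (S i)" "\<And>i. i \<in> I \<Longrightarrow> convex (S i)"
  shows "compact (\<Sum>i\<in>I. S i) \<and> convex (\<Sum>i\<in>I. S i)"
  using assms
proof (induction I rule: infinite_finite_induct)
  case (insert i I)
  then show ?case
    using compact_sums[of "S i" "\<Sum>i\<in>I. S i"] convex_sums[of "S i" "\<Sum>i\<in>I. S i"]
    by (auto simp: set_plus_def) (auto simp: set_eq_iff elim!: back_subst[of compact] back_subst[of convex])
qed (auto simp: set_zero)

section \<open>The random Minkowski sum and its support function\<close>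

locale body_family =
  fixes n m :: nat and K :: "nat \<Rightarrow> rvec set" and lam :: "nat \<Rightarrow> real"
  assumes bodies: "\<And>j. j \<in> {1..m} \<Longrightarrow> body n (K j)"
    and lam_nonneg: "\<And>j. j \<in> {1..m} \<Longrightarrow> lam j \<ge> 0"
    and lam_sum: "(\<Sum>j\<in>{1..m}. lam j) = 1"
    and n_pos: "n \<ge> 1"
begin

definition height :: "(nat \<Rightarrow> rvec \<Rightarrow>\<^sub>L rvec) \<Rightarrow> rvec \<Rightarrow> real"
  where "height U x = (\<Sum>j\<in>{1..m}. lam j * supp (polar n (K j)) (blinfun_apply (U j) x))"

lemma A_lam_eq:
  assumes U: "\<forall>j\<in>{1..m}. U j \<in> orth_group n"
  shows "A_lam n m lam K U = {\<Sum>j\<in>{1..m}. lam j *\<^sub>R pullback n (U j) (v j) | v. \<forall>j\<in>{1..m}. v j \<in> polar n (K j)}"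
    and "compact (A_lam n m lam K U)" and "convex (A_lam n m lam K U)"
proof -
  let ?S = "\<lambda>j. (\<lambda>x. lam j *\<^sub>R x) ` pullback n (U j) ` polar n (K j)"
  have "adjoint (blinfun_apply (U j)) ` polar n (K j) = pullback n (U j) ` polar n (K j)" if "j \<in> {1..m}" for j
    by (rule image_cong)
       (use truncate_eq body.polar_Rn[OF bodies[OF that]] in \<open>auto simp: adjoint_orth_group_eq[OF bspec[OF U that]]\<close>)
  then have A: "A_lam n m lam K U = (\<Sum>j\<in>{1..m}. ?S j)"
    unfolding A_lam_def by (intro sum.cong) auto
  show "A_lam n m lam K U = {\<Sum>j\<in>{1..m}. lam j *\<^sub>R pullback n (U j) (v j) | v. \<forall>j\<in>{1..m}. v j \<in> polar n (K j)}"
  proof -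
    have "(\<Sum>j\<in>{1..m}. ?S j) = {\<Sum>j\<in>{1..m}. s j | s. \<forall>j\<in>{1..m}. s j \<in> ?S j}"
      by (rule set_sum_alt) simp
    also have "\<dots> = {\<Sum>j\<in>{1..m}. lam j *\<^sub>R pullback n (U j) (v j) | v. \<forall>j\<in>{1..m}. v j \<in> polar n (K j)}"
    proof (intro equalityI subsetI)
      fix a assume "a \<in> {\<Sum>j\<in>{1..m}. s j | s. \<forall>j\<in>{1..m}. s j \<in> ?S j}"
      then obtain s where s: "a = (\<Sum>j\<in>{1..m}. s j)" "\<forall>j\<in>{1..m}. \<exists>v. v \<in> polar n (K j) \<and> s j = lam j *\<^sub>R pullback n (U j) v"
        by blast
      then obtain v where "\<forall>j\<in>{1..m}. v j \<in> polar n (K j) \<and> s j = lam j *\<^sub>R pullback n (U j) (v j)" by metis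
      then show "a \<in> {\<Sum>j\<in>{1..m}. lam j *\<^sub>R pullback n (U j) (v j) | v. \<forall>j\<in>{1..m}. v j \<in> polar n (K j)}"
        using s(1) by (auto intro!: exI[of _ v] sum.cong)
    qed blast
    finally show ?thesis using A by simp
  qed
  have "compact (?S j)" "convex (?S j)" if "j \<in> {1..m}" for j
  proof -
    have lin: "bounded_linear (\<lambda>x. lam j *\<^sub>R pullback n (U j) x)"
      by (intro bounded_linear_compose[OF bounded_linear_scaleR_right] bounded_linear_pullback)
    show "compact (?S j)"
      unfolding image_image using body.compact_polar[OF bodies[OF that]]
      by (intro compact_continuous_image linear_continuous_on lin)
    show "convex (?S j)"
      unfolding image_image using body.convex_polar[OF bodies[OF that]]
      by (intro convex_linear_image bounded_linear.linear lin)
  qed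
  then show "compact (A_lam n m lam K U)" "convex (A_lam n m lam K U)"
    unfolding A using compact_convex_set_sum[of "{1..m}" ?S] by auto
qed

lemma zero_in_A_lam:
  assumes U: "\<forall>j\<in>{1..m}. U j \<in> orth_group n"
  shows "0 \<in> A_lam n m lam K U"
proof -
  have "(0::rvec) = (\<Sum>j\<in>{1..m}. lam j *\<^sub>R pullback n (U j) 0)" by (simp add: pullback_def)
  moreover have "\<forall>j\<in>{1..m}. (0::rvec) \<in> polar n (K j)" using body.zero_in_polar bodies by blast
  ultimately show ?thesis unfolding A_lam_eq(1)[OF U] by (intro CollectI exI[of _ "\<lambda>_. 0"] conjI)
qed

text \<open>The maximum over a Minkowski sum is taken separately in each summand, and
  \<open>inner_pullback\<close> moves each \<open>U j\<close> onto \<open>x\<close>.\<close>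

lemma supp_A_lam:
  assumes U: "\<forall>j\<in>{1..m}. U j \<in> orth_group n" and x: "x \<in> Rn n"
  shows "supp (A_lam n m lam K U) x = height U x"
proof (rule antisym)
  have inner: "inner (\<Sum>j\<in>{1..m}. lam j *\<^sub>R pullback n (U j) (v j)) x
      = (\<Sum>j\<in>{1..m}. lam j * inner (v j) (blinfun_apply (U j) x))" for v
    by (simp add: inner_sum_left inner_pullback[OF x])
  have ne: "A_lam n m lam K U \<noteq> {}" using zero_in_A_lam[OF U] by auto
  show "supp (A_lam n m lam K U) x \<le> height U x"
  proof (rule supp_least[OF A_lam_eq(2)[OF U] ne])
    fix a assume "a \<in> A_lam n m lam K U"
    then obtain v where v: "\<forall>j\<in>{1..m}. v j \<in> polar n (K j)" "a = (\<Sum>j\<in>{1..m}. lam j *\<^sub>R pullback n (U j) (v j))"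
      unfolding A_lam_eq(1)[OF U] by blast
    show "inner a x \<le> height U x"
      unfolding v(2) inner height_def using v(1) lam_nonneg body.compact_polar[OF bodies]
      by (intro sum_mono mult_left_mono supp_upper) auto
  qed
  have "\<forall>j\<in>{1..m}. \<exists>v. v \<in> polar n (K j) \<and> supp (polar n (K j)) (blinfun_apply (U j) x) = inner v (blinfun_apply (U j) x)"
    using supp_attained[OF body.compact_polar body.polar_nonempty, OF bodies bodies] by metis
  then obtain v where v: "\<forall>j\<in>{1..m}. v j \<in> polar n (K j) \<and>
      supp (polar n (K j)) (blinfun_apply (U j) x) = inner (v j) (blinfun_apply (U j) x)" by metis
  have "(\<Sum>j\<in>{1..m}. lam j *\<^sub>R pullback n (U j) (v j)) \<in> A_lam n m lam K U"
    unfolding A_lam_eq(1)[OF U] using v by blast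
  from supp_upper[OF A_lam_eq(2)[OF U] this, of x] show "height U x \<le> supp (A_lam n m lam K U) x"
    unfolding inner height_def using v by simp
qed

end

text \<open>The orthonormal expansion supplies a point with the defining property, and two such
  points differ by a vector of \<open>F\<close> orthogonal to itself; this gives the
  \<open>THE\<close> its meaning.\<close>

lemma orth_proj_props:
  assumes F: "F \<in> grassmannian n k"
  shows "orth_proj F x \<in> F" and "z \<in> F \<Longrightarrow> inner (orth_proj F x) z = inner x z"
    and "x \<in> F \<Longrightarrow> orth_proj F x = x" and "bounded_linear (orth_proj F)"
proof -
  obtain e where e: "\<And>i. i < k \<Longrightarrow> e i \<in> F"
    "\<And>i j. i < k \<Longrightarrow> j < k \<Longrightarrow> inner (e i) (e j) = (if i = j then 1 else 0)"
    and expand: "\<And>x. x \<in> F \<Longrightarrow> x = (\<Sum>i<k. inner x (e i) *\<^sub>R e i)"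
    using grassmannian_orthonormal_basis[OF F] by metis
  have subF: "subspace F" using F by (simp add: grassmannian_def)
  define p where "p x = (\<Sum>i<k. inner x (e i) *\<^sub>R e i)" for x
  have pF: "p x \<in> F" for x
    unfolding p_def using e(1) by (intro subspace_sum[OF subF] subspace_scale[OF subF]) auto
  have p_inner: "inner (p x) z = inner x z" if z: "z \<in> F" for x z
  proof -
    have "inner (p x) z = (\<Sum>i<k. inner x (e i) * inner z (e i))"
      by (simp add: p_def inner_sum_left inner_commute[of z])
    also have "\<dots> = inner x (\<Sum>i<k. inner z (e i) *\<^sub>R e i)"
      by (simp add: inner_sum_right mult.commute)
    finally show ?thesis using expand[OF z] by simp
  qed
  have eq: "orth_proj F x = p x" for x
    unfolding orth_proj_def
  proof (rule the_equality)
    show "p x \<in> F \<and> (\<forall>z\<in>F. orthogonal (x - p x) z)"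
      using pF p_inner by (simp add: orthogonal_def inner_diff_left)
    fix y assume y: "y \<in> F \<and> (\<forall>z\<in>F. orthogonal (x - y) z)"
    then have "p x - y \<in> F" using pF subF by (simp add: subspace_diff)
    then have "inner (p x - y) (p x - y) = 0"
      using y p_inner[of "p x - y" x] by (simp add: orthogonal_def inner_diff_left)
    then show "y = p x" by simp
  qed
  show "orth_proj F x \<in> F" using pF eq by simp
  show "inner (orth_proj F x) z = inner x z" if "z \<in> F" using p_inner[OF that] eq by simp
  show "orth_proj F x = x" if "x \<in> F" using expand[OF that] eq by (simp add: p_def)
  have "bounded_linear p" unfolding p_def
    by (intro bounded_linear_sum bounded_linear_compose[OF bounded_linear_scaleR_left] bounded_linear_inner_left)
  then show "bounded_linear (orth_proj F)" using eq by (metis ext)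
qed

text \<open>On \<open>F\<close> the support functions of \<open>A\<close> and of its projection
  agree. If the ball left the projection, which is compact and convex, a separating direction lying
  in \<open>F\<close> would violate the bound on the support function.\<close>

lemma ball_subset_projection_iff:
  assumes F: "F \<in> grassmannian n k" and A: "compact A" "convex A" "A \<noteq> {}" and r: "r \<ge> 0"
  shows "scaled_ball r F \<subseteq> orth_proj F ` A \<longleftrightarrow> (\<forall>x\<in>F. r * norm x \<le> supp A x)"
proof
  have subF: "subspace F" using F by (simp add: grassmannian_def)
  note P = orth_proj_props[OF F]
  {
    assume sub: "scaled_ball r F \<subseteq> orth_proj F ` A"
    show "\<forall>x\<in>F. r * norm x \<le> supp A x"
    proof
      fix x assume x: "x \<in> F"
      show "r * norm x \<le> supp A x"
      proof (cases "x = 0")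
        case True
        obtain a where "a \<in> A" using A by blast
        from supp_upper[OF A(1) this, of x] show ?thesis using True by simp
      next
        case False
        have "r *\<^sub>R (x /\<^sub>R norm x) \<in> scaled_ball r F"
          unfolding scaled_ball_def using x False subspace_scale[OF subF] by (intro imageI) auto
        then obtain a where a: "a \<in> A" "orth_proj F a = r *\<^sub>R (x /\<^sub>R norm x)" using sub by (metis (full_types) imageE subsetD)
        have "inner a x = inner (r *\<^sub>R (x /\<^sub>R norm x)) x" using P(2)[OF x, of a] a(2) by simp
        also have "\<dots> = r * norm x" using False by (simp add: dot_square_norm power2_eq_square)
        finally show ?thesis using supp_upper[OF A(1) a(1), of x] by simp
      qed
    qed
  next
    assume *: "\<forall>x\<in>F. r * norm x \<le> supp A x"
    show "scaled_ball r F \<subseteq> orth_proj F ` A"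
    proof (rule ccontr)
      assume "\<not> ?thesis"
      then obtain y where y: "y \<in> scaled_ball r F" "y \<notin> orth_proj F ` A" by blast
      then obtain x where x: "x \<in> F" "norm x \<le> 1" "r *\<^sub>R x \<notin> orth_proj F ` A"
        unfolding scaled_ball_def by auto
      have "compact (orth_proj F ` A)" "convex (orth_proj F ` A)" "orth_proj F ` A \<noteq> {}"
        using A P(4) by (auto intro!: compact_continuous_image linear_continuous_on convex_linear_image bounded_linear.linear)
      from separate_point_compact_convex[OF this x(3)] obtain b where b: "b \<in> orth_proj F ` A"
        "\<And>y. y \<in> orth_proj F ` A \<Longrightarrow> inner (r *\<^sub>R x - b) y \<le> inner (r *\<^sub>R x - b) b"
        "inner (r *\<^sub>R x - b) b < inner (r *\<^sub>R x - b) (r *\<^sub>R x)" by blast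
      define w where "w = r *\<^sub>R x - b"
      have wF: "w \<in> F" unfolding w_def using b(1) P(1) x(1) subF by (auto intro!: subspace_diff subspace_scale)
      have "supp A w \<le> inner w b"
      proof (rule supp_least[OF A(1,3)])
        fix a assume "a \<in> A"
        then have "inner w (orth_proj F a) \<le> inner w b" using b(2) by (simp add: w_def)
        then show "inner a w \<le> inner w b" using P(2)[OF wF, of a] by (simp add: inner_commute)
      qed
      also have "\<dots> < inner w (r *\<^sub>R x)" using b(3) by (simp add: w_def)
      also have "\<dots> \<le> r * norm w"
      proof -
        have "inner w x \<le> norm w * norm x" by (rule norm_cauchy_schwarz)
        also have "\<dots> \<le> norm w * 1" using x(2) by (intro mult_left_mono) auto
        finally show ?thesis using r by (simp add: mult_left_mono)
      qed
      finally show False using * wF by force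
    qed
  }
qed

text \<open>For the converse direction a projected point \<open>z\<close> is tested against the
  direction \<open>z\<close> itself.\<close>

lemma projection_subset_ball_iff:
  assumes F: "F \<in> grassmannian n k" and A: "compact A" "A \<noteq> {}" and r: "r \<ge> 0"
  shows "orth_proj F ` A \<subseteq> scaled_ball r F \<longleftrightarrow> (\<forall>x\<in>F. supp A x \<le> r * norm x)"
proof
  have subF: "subspace F" using F by (simp add: grassmannian_def)
  note P = orth_proj_props[OF F]
  {
    assume sub: "orth_proj F ` A \<subseteq> scaled_ball r F"
    show "\<forall>x\<in>F. supp A x \<le> r * norm x"
    proof
      fix x assume x: "x \<in> F"
      show "supp A x \<le> r * norm x"
      proof (rule supp_least[OF A])
        fix a assume "a \<in> A"
        then obtain y where y: "norm y \<le> 1" "orth_proj F a = r *\<^sub>R y" using sub by (auto simp: scaled_ball_def)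
        have "inner a x = r * inner y x" using P(2)[OF x, of a] y(2) by simp
        also have "inner y x \<le> norm y * norm x" by (rule norm_cauchy_schwarz)
        also have "norm y * norm x \<le> 1 * norm x" using y(1) by (intro mult_right_mono) auto
        finally show "inner a x \<le> r * norm x" using r by (simp add: mult_left_mono)
      qed
    qed
  next
    assume *: "\<forall>x\<in>F. supp A x \<le> r * norm x"
    show "orth_proj F ` A \<subseteq> scaled_ball r F"
    proof
      fix z assume "z \<in> orth_proj F ` A"
      then obtain a where a: "a \<in> A" "z = orth_proj F a" by blast
      have zF: "z \<in> F" using a P(1) by simp
      have "norm z * norm z = inner a z" using P(2)[OF zF, of a] a(2) by (simp add: dot_square_norm power2_eq_square)
      also have "\<dots> \<le> r * norm z" using supp_upper[OF A(1) a(1), of z] * zF by force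
      finally have le: "norm z \<le> r" using r by (cases "z = 0") auto
      show "z \<in> scaled_ball r F"
      proof (cases "r = 0")
        case True
        then show ?thesis using le zF by (auto simp: scaled_ball_def intro!: image_eqI[of _ _ 0] subspace_0[OF subF])
      next
        case False
        then show ?thesis using le r zF subspace_scale[OF subF]
          by (auto simp: scaled_ball_def divide_simps intro!: image_eqI[of _ _ "z /\<^sub>R r"])
      qed
    qed
  }
qed

section \<open>Tail bounds for the random support function\<close>

lemma markov_emeasure:
  assumes "f \<in> borel_measurable M" "A \<in> sets M" "\<And>x. x \<in> A \<Longrightarrow> c \<le> f x"
  shows "c * emeasure M A \<le> (\<integral>\<^sup>+x. f x \<partial>M)"
proof -
  have "c * emeasure M A = (\<integral>\<^sup>+x. c * indicator A x \<partial>M)"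
    using assms(2) by (simp add: nn_integral_cmult_indicator)
  also have "\<dots> \<le> (\<integral>\<^sup>+x. f x \<partial>M)"
    using assms(3) by (intro nn_integral_mono) (auto split: split_indicator)
  finally show ?thesis .
qed

lemma weighted_arith_geom_mean:
  fixes w x :: "'a \<Rightarrow> real"
  assumes "finite S" "\<And>i. i \<in> S \<Longrightarrow> w i \<ge> 0" "sum w S = 1" "\<And>i. i \<in> S \<Longrightarrow> x i > 0"
  shows "exp (\<Sum>i\<in>S. w i * ln (x i)) \<le> (\<Sum>i\<in>S. w i * x i)"
proof -
  have "S \<noteq> {}" using assms(3) by auto
  then have "exp (\<Sum>i\<in>S. w i *\<^sub>R ln (x i)) \<le> (\<Sum>i\<in>S. w i * exp (ln (x i)))"
    using assms by (intro convex_on_sum[OF _ _ exp_convex]) auto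
  also have "\<dots> = (\<Sum>i\<in>S. w i * x i)" using assms(4) by (intro sum.cong) auto
  finally show ?thesis by simp
qed

locale random_bodies = haar_sphere n \<mu> \<sigma> + body_family n m K lam for n \<mu> \<sigma> m K lam
begin

definition \<Gamma> :: "(nat \<Rightarrow> rvec \<Rightarrow>\<^sub>L rvec) measure"
  where "\<Gamma> = (\<Pi>\<^sub>M j\<in>{1..m}. \<mu>)"

sublocale \<Gamma>: prob_space \<Gamma>
  unfolding \<Gamma>_def by (rule prob_space_PiM) unfold_locales

lemma space_\<Gamma>: "U \<in> space \<Gamma> \<Longrightarrow> j \<in> {1..m} \<Longrightarrow> U j \<in> orth_group n"
  by (auto simp: \<Gamma>_def space_PiM space_haar)

lemma compact_P: "j \<in> {1..m} \<Longrightarrow> compact (polar n (K j))"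
  and zero_P: "j \<in> {1..m} \<Longrightarrow> 0 \<in> polar n (K j)"
  and P_nonempty: "j \<in> {1..m} \<Longrightarrow> polar n (K j) \<noteq> {}"
  and norm_P: "j \<in> {1..m} \<Longrightarrow> v \<in> polar n (K j) \<Longrightarrow> norm v \<le> bK n (K j)"
  and bK_gt_0: "j \<in> {1..m} \<Longrightarrow> bK n (K j) > 0"
  using body.compact_polar[OF bodies] body.zero_in_polar[OF bodies] body.polar_nonempty[OF bodies]
    body.norm_polar_le_bK[OF bodies n_pos] body.bK_pos[OF bodies n_pos] by auto

lemma measurable_supp_P: "j \<in> {1..m} \<Longrightarrow> supp (polar n (K j)) \<in> borel_measurable borel"
  by (intro measurable_supp compact_P P_nonempty)

lemma measurable_component: "j \<in> {1..m} \<Longrightarrow> (\<lambda>U. U j) \<in> measurable \<Gamma> \<mu>"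
  unfolding \<Gamma>_def by (rule measurable_component_singleton)

lemma measurable_component_apply:
  assumes j: "j \<in> {1..m}" and f: "f \<in> measurable borel N"
  shows "(\<lambda>U. f (blinfun_apply (U j) x)) \<in> measurable \<Gamma> N"
  by (rule measurable_compose[OF measurable_compose[OF measurable_component[OF j] measurable_apply] f])

lemma measurable_height [measurable]: "(\<lambda>U. height U x) \<in> borel_measurable \<Gamma>"
  unfolding height_def by (intro borel_measurable_sum borel_measurable_times measurable_component_apply measurable_supp_P) auto

lemma height_scale: "r \<ge> 0 \<Longrightarrow> height U (r *\<^sub>R x) = r * height U x"
  unfolding height_def sum_distrib_left blinfun.scaleR_right
  using compact_P P_nonempty by (intro sum.cong) (auto simp: supp_scale)

lemma height_add: "height U (x + y) \<le> height U x + height U y"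
  unfolding height_def sum.distrib[symmetric] ring_distribs(1)[symmetric] blinfun.add_right
  using compact_P P_nonempty lam_nonneg by (intro sum_mono mult_left_mono supp_add) auto

lemma height_le_norm:
  assumes "U \<in> space \<Gamma>"
  shows "height U x \<le> b_lam n m lam K * norm x"
  unfolding height_def b_lam_def sum_distrib_right
proof (rule sum_mono)
  fix j assume j: "j \<in> {1..m}"
  have "supp (polar n (K j)) (blinfun_apply (U j) x) \<le> bK n (K j) * norm (blinfun_apply (U j) x)"
    by (rule supp_le_norm[OF compact_P[OF j] P_nonempty[OF j] norm_P[OF j]])
  also have "norm (blinfun_apply (U j) x) = norm x"
    by (rule orth_group_norm[OF space_\<Gamma>[OF assms j]])
  finally show "lam j * supp (polar n (K j)) (blinfun_apply (U j) x) \<le> lam j * bK n (K j) * norm x"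
    using lam_nonneg[OF j] by (simp add: mult_left_mono mult.assoc)
qed

lemma ex_lam_pos: "\<exists>j\<in>{1..m}. lam j > 0"
proof (rule ccontr)
  assume "\<not> ?thesis"
  then have "(\<Sum>j\<in>{1..m}. lam j) = 0" using lam_nonneg by (intro sum.neutral) force
  then show False using lam_sum by simp
qed

lemma b_lam_pos: "b_lam n m lam K > 0"
proof -
  obtain j where "j \<in> {1..m}" "lam j > 0" using ex_lam_pos by blast
  then show ?thesis unfolding b_lam_def
    using lam_nonneg bK_gt_0 by (intro sum_pos2[of _ j]) (simp_all add: less_imp_le)
qed

lemma B_lam_pos: "B_lam n m lam K > 0"
proof -
  obtain j where j: "j \<in> {1..m}" "lam j > 0" using ex_lam_pos by blast
  have "(\<Sum>j\<in>{1..m}. (lam j)\<^sup>2 * (bK n (K j))\<^sup>2) > 0"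
    using j bK_gt_0[OF j(1)] by (intro sum_pos2[of _ j]) auto
  then show ?thesis by (simp add: B_lam_def)
qed

section \<open>Negative moments and the lower inclusion\<close>

lemma nn_integral_components:
  assumes "\<And>j. j \<in> {1..m} \<Longrightarrow> f j \<in> borel_measurable borel" and \<theta>: "\<theta> \<in> unit_sphere n"
  shows "(\<integral>\<^sup>+U. (\<Prod>j\<in>{1..m}. f j (blinfun_apply (U j) \<theta>)) \<partial>\<Gamma>) = (\<Prod>j\<in>{1..m}. \<integral>\<^sup>+y. f j y \<partial>\<sigma>)"
proof -
  interpret product_sigma_finite "\<lambda>_. \<mu>" ..
  have "(\<integral>\<^sup>+U. (\<Prod>j\<in>{1..m}. f j (blinfun_apply (U j) \<theta>)) \<partial>\<Gamma>)
      = (\<Prod>j\<in>{1..m}. \<integral>\<^sup>+V. f j (blinfun_apply V \<theta>) \<partial>\<mu>)"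
    unfolding \<Gamma>_def using assms(1) by (intro product_nn_integral_prod measurable_compose[OF measurable_apply]) auto
  also have "\<dots> = (\<Prod>j\<in>{1..m}. \<integral>\<^sup>+y. f j y \<partial>\<sigma>)"
    using assms by (intro prod.cong nn_integral_sphere) auto
  finally show ?thesis .
qed

text \<open>Support functions of the polars lie between positive constants on the sphere, so these
  powers are integrable; otherwise the Bochner integral in \<open>Mq\<close> would default to
  0.\<close>

lemma integral_powr_neg:
  assumes j: "j \<in> {1..m}" and r: "r \<le> 0"
  shows "(\<integral>\<^sup>+y. ennreal (supp (polar n (K j)) y powr r) \<partial>\<sigma>) = ennreal (\<integral>y. minkowski (K j) y powr r \<partial>\<sigma>)"
    and "(\<integral>y. minkowski (K j) y powr r \<partial>\<sigma>) > 0"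
proof -
  obtain \<beta> where \<beta>: "\<beta> > 0" "\<And>x. x \<in> Rn n \<Longrightarrow> \<beta> * norm x \<le> supp (polar n (K j)) x"
    using body.supp_polar_lower[OF bodies[OF j]] by metis
  have bounds: "\<beta> \<le> supp (polar n (K j)) y" "supp (polar n (K j)) y \<le> bK n (K j)" if "y \<in> space \<sigma>" for y
    using that \<beta>(2)[of y] supp_le_norm[OF compact_P[OF j] P_nonempty[OF j] norm_P[OF j], of y]
    by (auto simp: space_sphere unit_sphere_def)
  have [measurable]: "supp (polar n (K j)) \<in> borel_measurable \<sigma>"
    by (rule measurable_sphere[OF measurable_supp_P[OF j]])
  have up: "supp (polar n (K j)) y powr r \<le> \<beta> powr r" if "y \<in> space \<sigma>" for y
    using bounds[OF that] \<beta>(1) r by (intro powr_mono2') auto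
  have lo: "bK n (K j) powr r \<le> supp (polar n (K j)) y powr r" if "y \<in> space \<sigma>" for y
    using bounds[OF that] \<beta>(1) r by (intro powr_mono2') auto
  have int: "integrable \<sigma> (\<lambda>y. supp (polar n (K j)) y powr r)"
    by (rule \<sigma>.integrable_const_bound[where B = "\<beta> powr r"]) (use up in auto)
  have eq: "(\<integral>y. minkowski (K j) y powr r \<partial>\<sigma>) = (\<integral>y. supp (polar n (K j)) y powr r \<partial>\<sigma>)"
    by (rule Bochner_Integration.integral_cong)
       (auto simp: space_sphere unit_sphere_def body.minkowski_eq_supp[OF bodies[OF j]])
  show "(\<integral>\<^sup>+y. ennreal (supp (polar n (K j)) y powr r) \<partial>\<sigma>) = ennreal (\<integral>y. minkowski (K j) y powr r \<partial>\<sigma>)"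
    unfolding eq by (rule nn_integral_eq_integral[OF int]) simp
  have "0 < bK n (K j) powr r" using bK_gt_0[OF j] by simp
  also have "\<dots> = (\<integral>y. bK n (K j) powr r \<partial>\<sigma>)" by (simp add: \<sigma>.prob_space)
  also have "\<dots> \<le> (\<integral>y. supp (polar n (K j)) y powr r \<partial>\<sigma>)"
    using lo by (intro integral_mono int) auto
  finally show "(\<integral>y. minkowski (K j) y powr r \<partial>\<sigma>) > 0" unfolding eq .
qed

text \<open>The exponents in \<open>a_lam\<close> are chosen to cancel: raising \<open>Mq\<close> of
  order \<open>- q * lam j\<close> to \<open>lam j\<close> and then to \<open>- q\<close> leaves the
  bare integral, the very factor that independence produces.\<close>

lemma a_lam_powr:
  assumes q: "q > 0"
  shows "a_lam \<sigma> m q lam K > 0"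
    and "a_lam \<sigma> m q lam K powr (- q)
      = (\<Prod>j\<in>{1..m}. if lam j = 0 then 1 else \<integral>y. minkowski (K j) y powr (- q * lam j) \<partial>\<sigma>)"
proof -
  have Mq: "Mq \<sigma> (- q * lam j) (K j) > 0" if "j \<in> {1..m}" for j
    using integral_powr_neg(2)[OF that, of "- q * lam j"] lam_nonneg[OF that] q by (simp add: Mq_def)
  show "a_lam \<sigma> m q lam K > 0"
    unfolding a_lam_def using Mq by (intro prod_pos) force
  have "a_lam \<sigma> m q lam K powr (- q)
      = (\<Prod>j\<in>{1..m}. (if lam j = 0 then 1 else Mq \<sigma> (- q * lam j) (K j) powr lam j) powr (- q))"
    unfolding a_lam_def by (rule prod_powr_distrib)
  also have "\<dots> = (\<Prod>j\<in>{1..m}. if lam j = 0 then 1 else \<integral>y. minkowski (K j) y powr (- q * lam j) \<partial>\<sigma>)"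
  proof (rule prod.cong)
    fix j assume j: "j \<in> {1..m}"
    show "(if lam j = 0 then 1 else Mq \<sigma> (- q * lam j) (K j) powr lam j) powr (- q)
      = (if lam j = 0 then 1 else \<integral>y. minkowski (K j) y powr (- q * lam j) \<partial>\<sigma>)"
      using integral_powr_neg(2)[OF j, of "- q * lam j"] lam_nonneg[OF j] q
      by (auto simp: Mq_def powr_powr)
  qed simp
  finally show "a_lam \<sigma> m q lam K powr (- q)
      = (\<Prod>j\<in>{1..m}. if lam j = 0 then 1 else \<integral>y. minkowski (K j) y powr (- q * lam j) \<partial>\<sigma>)" .
qed

lemma height_lower_tail:
  assumes q: "q > 0" and \<theta>: "\<theta> \<in> unit_sphere n" and t: "t > 0"
  shows "emeasure \<Gamma> {U \<in> space \<Gamma>. height U \<theta> \<le> t} \<le> ennreal ((t / a_lam \<sigma> m q lam K) powr q)"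
proof -
  let ?a = "a_lam \<sigma> m q lam K"
  note a = a_lam_powr[OF q]
  define f where "f j y = (if lam j = 0 then 1 else ennreal (supp (polar n (K j)) y powr (- q * lam j)))" for j y
  have f: "f j \<in> borel_measurable borel" if "j \<in> {1..m}" for j
    unfolding f_def using measurable_supp_P[OF that] by (cases "lam j = 0") simp_all
  have "(\<integral>\<^sup>+U. (\<Prod>j\<in>{1..m}. f j (blinfun_apply (U j) \<theta>)) \<partial>\<Gamma>) = (\<Prod>j\<in>{1..m}. \<integral>\<^sup>+y. f j y \<partial>\<sigma>)"
    by (rule nn_integral_components[OF f \<theta>])
  also have "\<dots> = (\<Prod>j\<in>{1..m}. ennreal (if lam j = 0 then 1 else \<integral>y. minkowski (K j) y powr (- q * lam j) \<partial>\<sigma>))"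
    using integral_powr_neg(1) lam_nonneg q
    by (intro prod.cong) (auto simp: f_def \<sigma>.emeasure_space_1)
  also have "\<dots> = ennreal (?a powr (- q))"
    unfolding a(2)
  proof (rule prod_ennreal)
    fix j assume j: "j \<in> {1..m}"
    show "0 \<le> (if lam j = 0 then 1 else \<integral>y. minkowski (K j) y powr (- q * lam j) \<partial>\<sigma>)"
      using integral_powr_neg(2)[OF j, of "- q * lam j"] lam_nonneg[OF j] q by auto
  qed
  finally have moment: "(\<integral>\<^sup>+U. (\<Prod>j\<in>{1..m}. f j (blinfun_apply (U j) \<theta>)) \<partial>\<Gamma>) = ennreal (?a powr (- q))" .
  have pointwise: "ennreal (t powr (- q)) \<le> (\<Prod>j\<in>{1..m}. f j (blinfun_apply (U j) \<theta>))"
    if U: "U \<in> {U \<in> space \<Gamma>. height U \<theta> \<le> t}" for U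
  proof -
    define x where "x j = supp (polar n (K j)) (blinfun_apply (U j) \<theta>)" for j
    have x: "x j > 0" if j: "j \<in> {1..m}" for j
    proof -
      obtain \<beta> where \<beta>: "\<beta> > 0" "\<And>x. x \<in> Rn n \<Longrightarrow> \<beta> * norm x \<le> supp (polar n (K j)) x"
        using body.supp_polar_lower[OF bodies[OF j]] by metis
      have Uj: "U j \<in> orth_group n" using space_\<Gamma> U j by blast
      have "\<beta> * norm (blinfun_apply (U j) \<theta>) \<le> x j"
        unfolding x_def using \<theta> orth_group_maps[OF Uj] by (intro \<beta>(2)) (auto simp: unit_sphere_def)
      then show ?thesis using \<beta>(1) \<theta> by (simp add: orth_group_norm[OF Uj] unit_sphere_def)
    qed
    \<comment> \<open>Weighted AM-GM in logarithmic form: the height dominates the geometric mean of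
      the \<open>x j\<close>, and multiplication by \<open>- q\<close> reverses the
      inequality.\<close>
    have "exp (\<Sum>j\<in>{1..m}. lam j * ln (x j)) \<le> (\<Sum>j\<in>{1..m}. lam j * x j)"
      by (rule weighted_arith_geom_mean) (use lam_nonneg lam_sum x in auto)
    also have "\<dots> \<le> t" using U by (simp add: height_def x_def)
    finally have "(\<Sum>j\<in>{1..m}. lam j * ln (x j)) \<le> ln t" using t by (simp add: ln_ge_iff)
    then have "- q * ln t \<le> - q * (\<Sum>j\<in>{1..m}. lam j * ln (x j))" using q by simp
    then have "t powr (- q) \<le> exp (- q * (\<Sum>j\<in>{1..m}. lam j * ln (x j)))" using t by (simp add: powr_def)
    also have "\<dots> = (\<Prod>j\<in>{1..m}. if lam j = 0 then 1 else x j powr (- q * lam j))"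
      unfolding sum_distrib_left exp_sum[OF finite_atLeastAtMost]
      using x by (intro prod.cong) (auto simp: powr_def less_le)
    finally have "ennreal (t powr (- q)) \<le> ennreal (\<Prod>j\<in>{1..m}. if lam j = 0 then 1 else x j powr (- q * lam j))"
      by (rule ennreal_leI)
    also have "\<dots> = (\<Prod>j\<in>{1..m}. f j (blinfun_apply (U j) \<theta>))"
      by (subst prod_ennreal[symmetric]) (auto simp: f_def x_def intro!: prod.cong)
    finally show ?thesis .
  qed
  have "ennreal (t powr (- q)) * emeasure \<Gamma> {U \<in> space \<Gamma>. height U \<theta> \<le> t} \<le> ennreal (?a powr (- q))"
    unfolding moment[symmetric]
  proof (rule markov_emeasure[OF _ _ pointwise])
    show "(\<lambda>U. \<Prod>j\<in>{1..m}. f j (blinfun_apply (U j) \<theta>)) \<in> borel_measurable \<Gamma>"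
      by (intro borel_measurable_prod_ennreal measurable_component_apply f)
    show "{U \<in> space \<Gamma>. height U \<theta> \<le> t} \<in> sets \<Gamma>" by measurable
  qed
  also have "\<dots> = ennreal (t powr (- q)) * ennreal ((t / ?a) powr q)"
    using t a(1) by (simp add: ennreal_mult[symmetric] powr_divide powr_minus field_simps)
  finally show ?thesis using t by (subst (asm) ennreal_mult_le_mult_iff) auto
qed

text \<open>For \<open>t = b_lam n m lam K\<close> the event in the lower tail bound is the whole
  space, so the bound must be at least 1.\<close>

lemma a_lam_le_b_lam:
  assumes q: "q > 0"
  shows "a_lam \<sigma> m q lam K \<le> b_lam n m lam K"
proof -
  let ?a = "a_lam \<sigma> m q lam K" and ?b = "b_lam n m lam K"
  have \<theta>: "unitvec 0 \<in> unit_sphere n"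
    using n_pos by (auto simp: unit_sphere_def norm_eq_sqrt_inner coord_unitvec)
  have "{U \<in> space \<Gamma>. height U (unitvec 0) \<le> ?b} = space \<Gamma>"
    using height_le_norm[of _ "unitvec 0"] \<theta> by (auto simp: unit_sphere_def)
  then have "1 \<le> ennreal ((?b / ?a) powr q)"
    using height_lower_tail[OF q \<theta> b_lam_pos] by (simp add: \<Gamma>.emeasure_space_1)
  then have "1 \<le> (?b / ?a) powr q" by simp
  then have "0 \<le> q * ln (?b / ?a)" using b_lam_pos a_lam_powr(1)[OF q] by (simp add: powr_def)
  then have "0 \<le> ln (?b / ?a)" using q by (simp add: zero_le_mult_iff)
  then have "1 \<le> ?b / ?a" using b_lam_pos a_lam_powr(1)[OF q] by (subst (asm) ln_ge_zero_iff) auto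
  then show ?thesis using a_lam_powr(1)[OF q] by (simp add: field_simps)
qed

text \<open>The radius is found by solving \<open>108 ^ k * (b / r) ^ (k - 1) * (2 * r / a) powr q
  \<le> exp (- u)\<close>, where \<open>r\<close> has total power
  \<open>q - (k - 1) = \<Delta>\<close>. With \<open>c = 1 / (2 * 108)\<close> the constants
  collapse to \<open>108 powr (k - q) \<le> 1\<close>.\<close>

lemma lower_inclusion:
  fixes q u :: real and k :: nat
  assumes F: "F \<in> grassmannian n k" and k: "k \<ge> 1" and q: "q \<ge> 2 * real k" and u: "u \<ge> 0"
  defines "a \<equiv> a_lam \<sigma> m q lam K" and "b \<equiv> b_lam n m lam K" and "\<Delta> \<equiv> q - real k + 1" and "c \<equiv> 1 / 216"
  defines "r \<equiv> c * a * (c * a / b) powr ((real k - 1) / \<Delta>) * exp (- u / \<Delta>)"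
  shows "\<exists>B\<in>sets \<Gamma>. emeasure \<Gamma> B \<le> ennreal (exp (- u)) \<and>
    (\<forall>U\<in>space \<Gamma> - B. \<forall>x\<in>F. r * norm x \<le> height U x)"
proof -
  have q0: "q > 0" and \<Delta>: "\<Delta> > 0" using q k by (auto simp: \<Delta>_def)
  have a: "a > 0" and b: "b > 0" and ab: "a \<le> b" and c: "c > 0"
    using a_lam_powr(1)[OF q0] b_lam_pos a_lam_le_b_lam[OF q0] by (auto simp: a_def b_def c_def)
  have r: "r > 0" using a b c by (simp add: r_def)
  \<comment> \<open>All factors besides \<open>a\<close> are at most 1, so
    \<open>r \<le> a \<le> b\<close> and the mesh \<open>r / b\<close> is admissible in
    \<open>sphere_net\<close>.\<close>
  have "r \<le> 1 * a * 1 * 1"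
    unfolding r_def using a b ab c \<Delta> u k
    by (intro mult_mono powr_le1) (auto simp: c_def divide_nonneg_pos)
  then have rb: "r \<le> b" using ab by simp
  obtain N where N: "finite N" "N \<subseteq> F" "\<And>x. x \<in> N \<Longrightarrow> norm x = 1"
    "real (card N) \<le> 108 ^ k * (1 / (r / b)) ^ (k - 1)"
    "\<And>\<theta>. \<theta> \<in> F \<Longrightarrow> norm \<theta> = 1 \<Longrightarrow> \<exists>x\<in>N. norm (\<theta> - x) \<le> r / b"
    using sphere_net[OF F k, of "r / b"] r rb b by auto
  have FRn: "F \<subseteq> Rn n" and subF: "subspace F" using F by (auto simp: grassmannian_def)
  define B where "B = (\<Union>x\<in>N. {U \<in> space \<Gamma>. height U x \<le> 2 * r})"
  show ?thesis
  proof (intro bexI conjI ballI)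
    show Bsets: "B \<in> sets \<Gamma>" unfolding B_def using N(1) by (intro sets.finite_UN) auto
    have "emeasure \<Gamma> B \<le> (\<Sum>x\<in>N. emeasure \<Gamma> {U \<in> space \<Gamma>. height U x \<le> 2 * r})"
      unfolding B_def using N(1) by (intro emeasure_subadditive_finite) auto
    also have "\<dots> \<le> (\<Sum>x\<in>N. ennreal ((2 * r / a) powr q))"
      unfolding a_def using N(2,3) FRn r q0 by (intro sum_mono height_lower_tail) (auto simp: unit_sphere_def)
    also have "\<dots> = ennreal (real (card N) * (2 * r / a) powr q)"
      by (simp add: ennreal_mult ennreal_of_nat_eq_real_of_nat)
    also have "\<dots> \<le> ennreal (108 ^ k * (b / r) ^ (k - 1) * (2 * r / a) powr q)"
      using N(4) by (intro ennreal_leI mult_right_mono) auto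
    also have "108 ^ k * (b / r) ^ (k - 1) * (2 * r / a) powr q \<le> exp (- u)"
    proof -
      have lnr: "\<Delta> * ln r = q * (ln c + ln a) - (real k - 1) * ln b - u"
      proof -
        have "ln r = ln c + ln a + (real k - 1) / \<Delta> * (ln c + ln a - ln b) - u / \<Delta>"
          using a b c unfolding r_def by (simp add: ln_mult ln_div ln_powr)
        moreover have "\<Delta> * ((real k - 1) / \<Delta> * y) = (real k - 1) * y" "\<Delta> * (y / \<Delta>) = y" for y
          using \<Delta> by simp_all
        ultimately have "\<Delta> * ln r = \<Delta> * (ln c + ln a) + (real k - 1) * (ln c + ln a - ln b) - u"
          by (simp only: distrib_left right_diff_distrib)
        then show ?thesis by (simp add: \<Delta>_def algebra_simps)
      qed
      have lnc: "ln c = - (ln 108 + ln 2)" using ln_mult[of 108 2] by (simp add: c_def ln_div)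
      have "108 ^ k * (b / r) ^ (k - 1) * (2 * r / a) powr q
          = exp (k * ln 108 + (real k - 1) * (ln b - ln r) + q * (ln 2 + ln r - ln a))"
      proof -
        have "(108 :: real) ^ k = exp (k * ln 108)" by (simp add: exp_of_nat_mult)
        moreover have "(b / r) ^ (k - 1) = exp ((real k - 1) * (ln b - ln r))"
        proof -
          have "(b / r) ^ (k - 1) = exp (ln (b / r)) ^ (k - 1)" using b r by simp
          also have "\<dots> = exp (real (k - 1) * ln (b / r))" by (rule exp_of_nat_mult[symmetric])
          finally show ?thesis using b r k by (simp add: ln_div of_nat_diff)
        qed
        moreover have "(2 * r / a) powr q = exp (q * (ln 2 + ln r - ln a))"
          using a r by (simp add: powr_def ln_div ln_mult)
        ultimately show ?thesis by (simp add: exp_add)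
      qed
      also have "k * ln 108 + (real k - 1) * (ln b - ln r) + q * (ln 2 + ln r - ln a)
          = k * ln 108 + (real k - 1) * ln b + q * ln 2 - q * ln a + \<Delta> * ln r"
        by (simp add: \<Delta>_def algebra_simps)
      also have "\<dots> = (real k - q) * ln 108 - u"
        unfolding lnr lnc by (simp add: algebra_simps)
      also have "\<dots> \<le> - u" using q k by (simp add: mult_nonpos_nonneg)
      finally show ?thesis by simp
    qed
    finally show "emeasure \<Gamma> B \<le> ennreal (exp (- u))" by (simp add: ennreal_leI)
    fix U x assume U: "U \<in> space \<Gamma> - B" and x: "x \<in> F"
    show "r * norm x \<le> height U x"
    proof (cases "x = 0")
      case True
      then show ?thesis using height_scale[of 0 U 0] by simp
    next
      case False
      define \<theta> where "\<theta> = x /\<^sub>R norm x"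
      have \<theta>: "\<theta> \<in> F" "norm \<theta> = 1" using x False subspace_scale[OF subF] by (auto simp: \<theta>_def)
      obtain y where y: "y \<in> N" "norm (\<theta> - y) \<le> r / b" using N(5)[OF \<theta>] by blast
      \<comment> \<open>Passing from the net point to \<open>\<theta>\<close> costs at most
        \<open>b * (r / b) = r\<close> of the \<open>2 * r\<close>.\<close>
      have "2 * r \<le> height U y" using U y(1) by (auto simp: B_def)
      also have "\<dots> \<le> height U \<theta> + height U (y - \<theta>)" using height_add[of U \<theta> "y - \<theta>"] by simp
      also have "height U (y - \<theta>) \<le> b * norm (y - \<theta>)"
        unfolding b_def by (rule height_le_norm) (use U in simp)
      also have "\<dots> \<le> b * (r / b)" using y(2) b by (intro mult_left_mono) (auto simp: norm_minus_commute)
      finally have "r \<le> height U \<theta>" using b by simp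
      then have "norm x * r \<le> norm x * height U \<theta>" by (rule mult_left_mono) simp
      then have "r * norm x \<le> norm x * height U \<theta>" by (simp only: mult.commute)
      also have "\<dots> = height U x" unfolding \<theta>_def using False by (subst height_scale[symmetric]) auto
      finally show ?thesis .
    qed
  qed
qed

text \<open>Independence factors the moment, and the variance proxies add up to the square of
  \<open>B_lam\<close>. Hence the fluctuations see the quadratic sum of the
  \<open>lam j * bK n (K j)\<close>, whereas the Lipschitz constant \<open>b_lam\<close> is their
  plain sum.\<close>

lemma height_exp_moment:
  assumes \<theta>: "\<theta> \<in> unit_sphere n" and s: "s \<ge> 0"
  shows "(\<integral>\<^sup>+U. ennreal (exp (s * height U \<theta>)) \<partial>\<Gamma>)
    \<le> ennreal (exp (s * M_bar \<sigma> m lam K + 16 * s\<^sup>2 * (B_lam n m lam K)\<^sup>2 / n))"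
proof -
  let ?P = "\<lambda>j. polar n (K j)"
  let ?f = "\<lambda>j y. ennreal (exp (s * lam j * supp (?P j) y))"
  have f: "?f j \<in> borel_measurable borel" if "j \<in> {1..m}" for j
    using measurable_supp_P[OF that] by simp
  have "(\<integral>\<^sup>+U. ennreal (exp (s * height U \<theta>)) \<partial>\<Gamma>) = (\<integral>\<^sup>+U. (\<Prod>j\<in>{1..m}. ?f j (blinfun_apply (U j) \<theta>)) \<partial>\<Gamma>)"
    by (simp add: height_def sum_distrib_left exp_sum prod_ennreal mult.assoc)
  also have "\<dots> = (\<Prod>j\<in>{1..m}. \<integral>\<^sup>+y. ?f j y \<partial>\<sigma>)" by (rule nn_integral_components[OF f \<theta>])
  also have "\<dots> \<le> (\<Prod>j\<in>{1..m}. ennreal (exp (s * (lam j * Mq \<sigma> 1 (K j)) + 16 * s\<^sup>2 * ((lam j)\<^sup>2 * (bK n (K j))\<^sup>2) / n)))"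
  proof (rule prod_mono_ennreal)
    fix j assume j: "j \<in> {1..m}"
    have "(\<integral>y. minkowski (K j) y powr 1 \<partial>\<sigma>) = (\<integral>y. supp (?P j) y \<partial>\<sigma>)"
      by (rule Bochner_Integration.integral_cong)
         (auto simp: space_sphere unit_sphere_def body.minkowski_eq_supp[OF bodies[OF j]]
           supp_nonneg[OF compact_P[OF j] zero_P[OF j]])
    moreover have "0 \<le> (\<integral>y. supp (?P j) y \<partial>\<sigma>)"
      using supp_nonneg[OF compact_P[OF j] zero_P[OF j]] by (intro Bochner_Integration.integral_nonneg) auto
    ultimately have M: "Mq \<sigma> 1 (K j) = (\<integral>y. supp (?P j) y \<partial>\<sigma>)" by (simp add: Mq_def)
    have "(\<integral>\<^sup>+y. ?f j y \<partial>\<sigma>) = (\<integral>\<^sup>+U. ?f j (blinfun_apply U \<theta>) \<partial>\<mu>)"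
      by (rule nn_integral_sphere[OF f[OF j] \<theta>, symmetric])
    also have "\<dots> \<le> ennreal (exp (s * lam j * (\<integral>y. supp (?P j) y \<partial>\<sigma>) + 16 * (s * lam j)\<^sup>2 * (bK n (K j))\<^sup>2 / n))"
      using s lam_nonneg[OF j] norm_P[OF j]
      by (intro exp_moment compact_P[OF j] zero_P[OF j] n_pos \<theta>) auto
    finally show "(\<integral>\<^sup>+y. ?f j y \<partial>\<sigma>) \<le> ennreal (exp (s * (lam j * Mq \<sigma> 1 (K j)) + 16 * s\<^sup>2 * ((lam j)\<^sup>2 * (bK n (K j))\<^sup>2) / n))"
      by (simp add: M power_mult_distrib mult.assoc)
  qed
  also have "\<dots> = ennreal (exp (\<Sum>j\<in>{1..m}. s * (lam j * Mq \<sigma> 1 (K j)) + 16 * s\<^sup>2 * ((lam j)\<^sup>2 * (bK n (K j))\<^sup>2) / n))"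
    by (simp add: prod_ennreal exp_sum)
  also have "(\<Sum>j\<in>{1..m}. s * (lam j * Mq \<sigma> 1 (K j)) + 16 * s\<^sup>2 * ((lam j)\<^sup>2 * (bK n (K j))\<^sup>2) / n)
      = s * M_bar \<sigma> m lam K + 16 * s\<^sup>2 * (B_lam n m lam K)\<^sup>2 / n"
    by (simp add: M_bar_def B_lam_def sum_nonneg sum.distrib sum_distrib_left sum_divide_distrib)
  finally show ?thesis .
qed

text \<open>The parameter \<open>s\<close> makes the variance term \<open>16 * k\<close> and the
  deviation term \<open>24 * k\<close>, so one direction fails with probability at most
  \<open>exp (- 8 * k)\<close>. The net has at most \<open>216 ^ k \<le> exp (7 * k)\<close> points,
  which leaves \<open>exp (- k)\<close>. The factor 2 is the price of passing from the net to the
  sphere.\<close>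

lemma upper_inclusion:
  fixes k :: nat
  assumes F: "F \<in> grassmannian n k" and k: "k \<ge> 1"
  defines "W \<equiv> M_bar \<sigma> m lam K + 24 * (sqrt (real k / real n) * B_lam n m lam K)"
  shows "\<exists>B\<in>sets \<Gamma>. emeasure \<Gamma> B \<le> ennreal (exp (- real k)) \<and>
    (\<forall>U\<in>space \<Gamma> - B. \<forall>x\<in>F. height U x \<le> 2 * W * norm x)"
proof -
  let ?B = "B_lam n m lam K"
  have Bpos: "?B > 0" by (rule B_lam_pos)
  define s where "s = sqrt (real k * real n) / ?B"
  have s: "s > 0" using k n_pos Bpos by (simp add: s_def)
  obtain N where N: "finite N" "N \<subseteq> F" "\<And>x. x \<in> N \<Longrightarrow> norm x = 1"
    "real (card N) \<le> 108 ^ k * (1 / (1 / 2)) ^ (k - 1)"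
    "\<And>\<theta>. \<theta> \<in> F \<Longrightarrow> norm \<theta> = 1 \<Longrightarrow> \<exists>x\<in>N. norm (\<theta> - x) \<le> 1 / 2"
    using sphere_net[OF F k, of "1 / 2"] by auto
  have FRn: "F \<subseteq> Rn n" and subF: "subspace F" using F by (auto simp: grassmannian_def)
  define B where "B = (\<Union>x\<in>N. {U \<in> space \<Gamma>. W \<le> height U x})"
  have tail: "emeasure \<Gamma> {U \<in> space \<Gamma>. W \<le> height U x} \<le> ennreal (exp (- 8 * real k))" if x: "x \<in> N" for x
  proof -
    have "ennreal (exp (s * W)) * emeasure \<Gamma> {U \<in> space \<Gamma>. W \<le> height U x} \<le> (\<integral>\<^sup>+U. ennreal (exp (s * height U x)) \<partial>\<Gamma>)"
      using s by (intro markov_emeasure) (auto intro!: ennreal_leI)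
    also have "\<dots> \<le> ennreal (exp (s * M_bar \<sigma> m lam K + 16 * s\<^sup>2 * ?B\<^sup>2 / n))"
      using N(2,3) FRn x s by (intro height_exp_moment) (auto simp: unit_sphere_def)
    also have "s * M_bar \<sigma> m lam K + 16 * s\<^sup>2 * ?B\<^sup>2 / n = s * W + (- 8 * real k)"
    proof -
      have "s\<^sup>2 * ?B\<^sup>2 / n = real k" using Bpos n_pos by (simp add: s_def power_divide)
      moreover have "s * (sqrt (real k / real n) * ?B) = real k"
        using Bpos n_pos by (simp add: s_def real_sqrt_mult real_sqrt_divide)
      ultimately show ?thesis by (simp add: W_def ring_distribs)
    qed
    also have "ennreal (exp (s * W + (- 8 * real k))) = ennreal (exp (s * W)) * ennreal (exp (- 8 * real k))"
      by (simp only: exp_add ennreal_mult[OF exp_ge_zero exp_ge_zero])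
    finally show ?thesis by (subst (asm) ennreal_mult_le_mult_iff) auto
  qed
  show ?thesis
  proof (intro bexI conjI ballI)
    show "B \<in> sets \<Gamma>" unfolding B_def using N(1) by (intro sets.finite_UN) auto
    have "emeasure \<Gamma> B \<le> (\<Sum>x\<in>N. emeasure \<Gamma> {U \<in> space \<Gamma>. W \<le> height U x})"
      unfolding B_def using N(1) by (intro emeasure_subadditive_finite) auto
    also have "\<dots> \<le> (\<Sum>x\<in>N. ennreal (exp (- 8 * real k)))" by (intro sum_mono tail)
    also have "\<dots> = ennreal (real (card N) * exp (- 8 * real k))"
      by (simp add: ennreal_mult ennreal_of_nat_eq_real_of_nat)
    also have "\<dots> \<le> ennreal (exp (7 * real k) * exp (- 8 * real k))"
    proof (intro ennreal_leI mult_right_mono)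
      have "real (card N) \<le> 108 ^ k * 2 ^ (k - 1)" using N(4) by simp
      also have "\<dots> \<le> 108 ^ k * 2 ^ k" by (intro mult_left_mono power_increasing) auto
      also have "\<dots> = (216 :: real) ^ k" by (simp flip: power_mult_distrib)
      also have "\<dots> \<le> (exp 7) ^ k"
      proof (rule power_mono)
        have "(5 / 2 :: real) ^ 7 \<le> exp 1 ^ 7"
          using exp_lower_Taylor_quadratic[of "1 :: real"] by (intro power_mono) auto
        then have "(5 / 2 :: real) ^ 7 \<le> exp 7" by (simp add: exp_of_nat_mult[of 7 "1 :: real", simplified])
        then show "(216 :: real) \<le> exp 7" by (simp add: power_divide)
      qed simp
      also have "\<dots> = exp (7 * real k)" by (simp add: exp_of_nat_mult[symmetric] mult.commute)
      finally show "real (card N) \<le> exp (7 * real k)" .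
    qed simp
    also have "exp (7 * real k) * exp (- 8 * real k) = exp (- real k)" by (simp flip: exp_add)
    finally show "emeasure \<Gamma> B \<le> ennreal (exp (- real k))" .
    fix U x assume U: "U \<in> space \<Gamma> - B" and x: "x \<in> F"
    let ?S = "{\<theta> \<in> F. norm \<theta> = 1}"
    \<comment> \<open>\<open>H\<close> must be finite before \<open>H / 2\<close> can be absorbed
      below.\<close>
    have bdd: "bdd_above (height U ` ?S)"
      using height_le_norm[of U] U by (auto simp: bdd_above_def intro!: exI[of _ "b_lam n m lam K"]) (metis mult.right_neutral)
    define H where "H = (SUP \<theta>\<in>?S. height U \<theta>)"
    have H: "height U \<theta> \<le> H" if "\<theta> \<in> ?S" for \<theta>
      unfolding H_def using that bdd by (rule cSUP_upper)
    have scaled: "height U y \<le> norm y * H" if y: "y \<in> F" for y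
    proof (cases "y = 0")
      case True then show ?thesis using height_scale[of 0 U 0] by simp
    next
      case False
      have "height U y = norm y * height U (y /\<^sub>R norm y)" using False by (subst height_scale[symmetric]) auto
      also have "\<dots> \<le> norm y * H"
        using False y subspace_scale[OF subF] by (intro mult_left_mono H) auto
      finally show ?thesis .
    qed
    show "height U x \<le> 2 * W * norm x"
    proof (cases "x = 0")
      case True then show ?thesis using height_scale[of 0 U 0] by simp
    next
      case False
      have "x /\<^sub>R norm x \<in> ?S" using x False subspace_scale[OF subF] by auto
      then have ne: "?S \<noteq> {}" by blast
      have "0 \<le> H"
      proof -
        obtain \<theta> where \<theta>: "\<theta> \<in> ?S" using ne by blast
        have "0 \<le> height U \<theta>" unfolding height_def
          using lam_nonneg supp_nonneg[OF compact_P zero_P] by (intro sum_nonneg mult_nonneg_nonneg) auto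
        then show ?thesis using H[OF \<theta>] by linarith
      qed
      \<comment> \<open>A direction is a net point plus a remainder in \<open>F\<close> of norm at
        most \<open>1 / 2\<close>, whose height is at most \<open>H / 2\<close> by
        homogeneity.\<close>
      have "H \<le> W + H / 2"
        unfolding H_def
      proof (rule cSUP_least[OF ne])
        fix \<theta> assume \<theta>: "\<theta> \<in> ?S"
        then obtain y where y: "y \<in> N" "norm (\<theta> - y) \<le> 1 / 2" using N(5)[of \<theta>] by blast
        have "height U \<theta> \<le> height U y + height U (\<theta> - y)" using height_add[of U y "\<theta> - y"] by simp
        also have "height U y \<le> W" using U y(1) by (auto simp: B_def)
        also have "height U (\<theta> - y) \<le> norm (\<theta> - y) * H"
          using \<theta> y(1) N(2) by (intro scaled subspace_diff[OF subF]) auto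
        also have "\<dots> \<le> 1 / 2 * H" using y(2) \<open>0 \<le> H\<close> by (rule mult_right_mono)
        finally show "height U \<theta> \<le> W + (SUP \<theta>\<in>?S. height U \<theta>) / 2" by (simp add: H_def)
      qed
      then have "H \<le> 2 * W" by simp
      then have "norm x * H \<le> norm x * (2 * W)" by (intro mult_left_mono) auto
      with scaled[OF x] show ?thesis by (simp add: mult.commute)
    qed
  qed
qed

end

section \<open>Random subspaces\<close>

locale random_projection = random_bodies n \<mu> \<sigma> m K lam for n \<mu> \<sigma> m K lam +
  fixes k :: nat and \<nu> :: "rvec set measure"
  assumes haar_\<nu>: "haar_grassmann n k \<nu>"
begin

sublocale \<nu>: prob_space \<nu>
  using haar_\<nu> by (simp add: haar_grassmann_def)

lemma sets_\<nu>: "sets \<nu> = sets (grassmann_borel n k)"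
  using haar_\<nu> by (simp add: haar_grassmann_def)

lemma space_\<nu>: "space \<nu> = grassmannian n k"
  using sets_eq_imp_space_eq[OF sets_\<nu>] by (simp add: grassmann_borel_def)

sublocale \<Omega>: pair_prob_space \<Gamma> \<nu> ..

lemma measurable_orth_proj: "(\<lambda>F. orth_proj F x) \<in> borel_measurable \<nu>"
proof -
  have "(\<lambda>F. Blinfun (orth_proj F)) \<in> borel_measurable (grassmann_borel n k)"
    unfolding grassmann_borel_def by (rule measurable_vimage_algebra1) auto
  then have "(\<lambda>F. Blinfun (orth_proj F)) \<in> borel_measurable \<nu>"
    by (simp cong: measurable_cong_sets add: sets_\<nu>)
  then have "(\<lambda>F. blinfun_apply (Blinfun (orth_proj F)) x) \<in> borel_measurable \<nu>"
    by (rule measurable_compose) (intro borel_measurable_continuous_onI continuous_intros)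
  moreover have "blinfun_apply (Blinfun (orth_proj F)) x = orth_proj F x" if "F \<in> space \<nu>" for F
    using that orth_proj_props(4)[of F n k] by (simp add: space_\<nu> bounded_linear_Blinfun_apply)
  ultimately show ?thesis by (simp cong: measurable_cong)
qed

lemma measurable_height_proj [measurable]:
  "(\<lambda>w. height (fst w) (orth_proj (snd w) x)) \<in> borel_measurable (\<Gamma> \<Otimes>\<^sub>M \<nu>)"
  unfolding height_def
proof (intro borel_measurable_sum borel_measurable_times borel_measurable_const)
  fix j assume j: "j \<in> {1..m}"
  show "(\<lambda>w. supp (polar n (K j)) (blinfun_apply (fst w j) (orth_proj (snd w) x))) \<in> borel_measurable (\<Gamma> \<Otimes>\<^sub>M \<nu>)"
  proof (rule measurable_compose[OF measurable_apply_Rn measurable_supp_P[OF j]])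
    show "(\<lambda>w. orth_proj (snd w) x) \<in> borel_measurable (\<Gamma> \<Otimes>\<^sub>M \<nu>)"
      by (rule measurable_compose[OF measurable_snd measurable_orth_proj])
    show "(\<lambda>w. fst w j) \<in> measurable (\<Gamma> \<Otimes>\<^sub>M \<nu>) \<mu>"
      by (rule measurable_compose[OF measurable_fst measurable_component[OF j]])
    fix w assume "w \<in> space (\<Gamma> \<Otimes>\<^sub>M \<nu>)"
    then have F: "snd w \<in> grassmannian n k" by (auto simp: space_pair_measure space_\<nu>)
    then show "orth_proj (snd w) x \<in> Rn n"
      using orth_proj_props(1)[OF F] by (auto simp: grassmannian_def)
  qed
qed

lemma measurable_norm_proj [measurable]:
  "(\<lambda>w. norm (orth_proj (snd w) x)) \<in> borel_measurable (\<Gamma> \<Otimes>\<^sub>M \<nu>)"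
  by (rule measurable_compose[OF measurable_compose[OF measurable_snd measurable_orth_proj] borel_measurable_norm])

text \<open>The quantifier over \<open>F\<close> is uncountable and its range is random. Since
  \<open>orth_proj F\<close> maps the ambient space continuously onto \<open>F\<close>, a fixed
  dense set of test vectors, later chosen countable, suffices for a closed condition.\<close>

lemma all_subspace_iff_dense:
  assumes F: "F \<in> grassmannian n k" and D: "closure D = (UNIV :: rvec set)" and S: "closed S"
  shows "(\<forall>x\<in>F. (height U x, norm x) \<in> S) \<longleftrightarrow> (\<forall>x\<in>D. (height U (orth_proj F x), norm (orth_proj F x)) \<in> S)"
proof
  note P = orth_proj_props[OF F]
  {
    assume "\<forall>x\<in>F. (height U x, norm x) \<in> S"
    then show "\<forall>x\<in>D. (height U (orth_proj F x), norm (orth_proj F x)) \<in> S" using P(1) by blast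
  next
    assume D': "\<forall>x\<in>D. (height U (orth_proj F x), norm (orth_proj F x)) \<in> S"
    have "continuous_on UNIV (\<lambda>x. height U (orth_proj F x))"
      unfolding height_def
    proof (intro continuous_on_sum continuous_on_mult continuous_on_const)
      fix j assume j: "j \<in> {1..m}"
      have "continuous_on UNIV (\<lambda>x. blinfun_apply (U j) (orth_proj F x))"
        by (intro continuous_intros linear_continuous_on P(4))
      then show "continuous_on UNIV (\<lambda>x. supp (polar n (K j)) (blinfun_apply (U j) (orth_proj F x)))"
        by (rule continuous_on_compose2[OF continuous_supp[OF compact_P[OF j] P_nonempty[OF j]]]) simp
    qed
    then have "continuous_on UNIV (\<lambda>x. (height U (orth_proj F x), norm (orth_proj F x)))"
      by (intro continuous_on_Pair continuous_on_norm) (auto intro: linear_continuous_on P(4))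
    then have "closed ((\<lambda>x. (height U (orth_proj F x), norm (orth_proj F x))) -` S)"
      by (rule closed_vimage[OF S])
    then have "closure D \<subseteq> (\<lambda>x. (height U (orth_proj F x), norm (orth_proj F x))) -` S"
      using D' by (intro closure_minimal) auto
    then have "(height U (orth_proj F x), norm (orth_proj F x)) \<in> S" for x using D by auto
    then show "\<forall>x\<in>F. (height U x, norm x) \<in> S" using P(3) by metis
  }
qed

text \<open>Fubini with \<open>F\<close> fixed first: each section of the complement is contained in
  the exceptional set \<open>B\<close> belonging to that \<open>F\<close>.\<close>

lemma prob_pair_ge:
  assumes meas: "{w \<in> space (\<Gamma> \<Otimes>\<^sub>M \<nu>). Q w} \<in> sets (\<Gamma> \<Otimes>\<^sub>M \<nu>)" and p: "p \<ge> 0"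
    and fixed: "\<And>F. F \<in> grassmannian n k \<Longrightarrow>
      \<exists>B\<in>sets \<Gamma>. emeasure \<Gamma> B \<le> ennreal p \<and> (\<forall>U\<in>space \<Gamma> - B. Q (U, F))"
  shows "measure (\<Gamma> \<Otimes>\<^sub>M \<nu>) {w \<in> space (\<Gamma> \<Otimes>\<^sub>M \<nu>). Q w} \<ge> 1 - p"
proof -
  let ?G = "{w \<in> space (\<Gamma> \<Otimes>\<^sub>M \<nu>). Q w}"
  define E where "E = space (\<Gamma> \<Otimes>\<^sub>M \<nu>) - ?G"
  have E: "E \<in> sets (\<Gamma> \<Otimes>\<^sub>M \<nu>)" unfolding E_def using meas by auto
  have "emeasure (\<Gamma> \<Otimes>\<^sub>M \<nu>) E = (\<integral>\<^sup>+F. emeasure \<Gamma> ((\<lambda>U. (U, F)) -` E) \<partial>\<nu>)"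
    by (rule \<Omega>.emeasure_pair_measure_alt2[OF E])
  also have "\<dots> \<le> (\<integral>\<^sup>+F. ennreal p \<partial>\<nu>)"
  proof (rule nn_integral_mono)
    fix F assume "F \<in> space \<nu>"
    then obtain B where B: "B \<in> sets \<Gamma>" "emeasure \<Gamma> B \<le> ennreal p" "\<forall>U\<in>space \<Gamma> - B. Q (U, F)"
      using fixed by (auto simp: space_\<nu>)
    have "(\<lambda>U. (U, F)) -` E \<subseteq> B" using B(3) by (auto simp: E_def space_pair_measure)
    then have "emeasure \<Gamma> ((\<lambda>U. (U, F)) -` E) \<le> emeasure \<Gamma> B" using B(1) by (rule emeasure_mono)
    then show "emeasure \<Gamma> ((\<lambda>U. (U, F)) -` E) \<le> ennreal p" using B(2) by (rule order_trans)
  qed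
  also have "\<dots> = ennreal p" by (simp add: \<nu>.emeasure_space_1)
  finally have "measure (\<Gamma> \<Otimes>\<^sub>M \<nu>) E \<le> p" using p by (simp add: \<Omega>.emeasure_eq_measure)
  moreover have "measure (\<Gamma> \<Otimes>\<^sub>M \<nu>) E = 1 - measure (\<Gamma> \<Otimes>\<^sub>M \<nu>) ?G"
    unfolding E_def by (rule \<Omega>.prob_compl[OF meas])
  ultimately show ?thesis by simp
qed

text \<open>A closed set \<open>S\<close> of pairs of height and norm covers the lower and the upper
  inclusion at once.\<close>

lemma prob_all_directions:
  assumes S: "closed S" and p: "p \<ge> 0"
    and fixed: "\<And>F. F \<in> grassmannian n k \<Longrightarrow>
      \<exists>B\<in>sets \<Gamma>. emeasure \<Gamma> B \<le> ennreal p \<and> (\<forall>U\<in>space \<Gamma> - B. \<forall>x\<in>F. (height U x, norm x) \<in> S)"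
  shows "measure (\<Gamma> \<Otimes>\<^sub>M \<nu>) {w \<in> space (\<Gamma> \<Otimes>\<^sub>M \<nu>). \<forall>x\<in>snd w. (height (fst w) x, norm x) \<in> S} \<ge> 1 - p"
proof (rule prob_pair_ge[OF _ p])
  obtain D :: "rvec set" where D: "countable D" "\<And>X. open X \<Longrightarrow> X \<noteq> {} \<Longrightarrow> \<exists>d\<in>D. d \<in> X"
    using countable_dense_setE by blast
  have dense: "closure D = UNIV"
    using D(2)[of "- closure D"] closure_subset[of D] by auto
  have "{w \<in> space (\<Gamma> \<Otimes>\<^sub>M \<nu>). \<forall>x\<in>snd w. (height (fst w) x, norm x) \<in> S} = {w \<in> space (\<Gamma> \<Otimes>\<^sub>M \<nu>).
      \<forall>x\<in>D. (height (fst w) (orth_proj (snd w) x), norm (orth_proj (snd w) x)) \<in> S}"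
  proof (intro Collect_cong conj_cong refl all_subspace_iff_dense[OF _ dense S])
    fix w assume "w \<in> space (\<Gamma> \<Otimes>\<^sub>M \<nu>)"
    then show "snd w \<in> grassmannian n k" by (auto simp: space_pair_measure space_\<nu>)
  qed
  also have "\<dots> \<in> sets (\<Gamma> \<Otimes>\<^sub>M \<nu>)"
  proof (rule sets.sets_Collect_countable_All'[OF _ D(1)])
    fix x
    have "(\<lambda>w. (height (fst w) (orth_proj (snd w) x), norm (orth_proj (snd w) x))) \<in> borel_measurable (\<Gamma> \<Otimes>\<^sub>M \<nu>)"
      by measurable
    from measurable_sets[OF this, of S] S
    show "{w \<in> space (\<Gamma> \<Otimes>\<^sub>M \<nu>). (height (fst w) (orth_proj (snd w) x), norm (orth_proj (snd w) x)) \<in> S}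
        \<in> sets (\<Gamma> \<Otimes>\<^sub>M \<nu>)"
      by (simp add: vimage_def Int_def conj_commute)
  qed
  finally show "{w \<in> space (\<Gamma> \<Otimes>\<^sub>M \<nu>). \<forall>x\<in>snd w. (height (fst w) x, norm x) \<in> S} \<in> sets (\<Gamma> \<Otimes>\<^sub>M \<nu>)" .
qed (use fixed in simp)

lemma prob_ball_subset:
  assumes r: "r \<ge> 0" and p: "p \<ge> 0"
    and fixed: "\<And>F. F \<in> grassmannian n k \<Longrightarrow>
      \<exists>B\<in>sets \<Gamma>. emeasure \<Gamma> B \<le> ennreal p \<and> (\<forall>U\<in>space \<Gamma> - B. \<forall>x\<in>F. r * norm x \<le> height U x)"
  shows "\<P>((U, F) in \<Gamma> \<Otimes>\<^sub>M \<nu>. orth_proj F ` A_lam n m lam K U \<supseteq> scaled_ball r F) \<ge> 1 - p"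
proof -
  let ?Q = "\<lambda>w. \<forall>x\<in>snd w. (height (fst w) x, norm x) \<in> {z. r * snd z \<le> fst z}"
  have iff: "orth_proj F ` A_lam n m lam K U \<supseteq> scaled_ball r F \<longleftrightarrow> ?Q (U, F)"
    if w: "(U, F) \<in> space (\<Gamma> \<Otimes>\<^sub>M \<nu>)" for U F
  proof -
    have F: "F \<in> grassmannian n k" and U: "\<forall>j\<in>{1..m}. U j \<in> orth_group n"
      using w space_\<Gamma> by (auto simp: space_pair_measure space_\<nu>)
    have "A_lam n m lam K U \<noteq> {}" using zero_in_A_lam[OF U] by auto
    moreover have "supp (A_lam n m lam K U) x = height U x" if "x \<in> F" for x
      using F that by (intro supp_A_lam[OF U]) (auto simp: grassmannian_def)
    ultimately show ?thesis
      using ball_subset_projection_iff[OF F A_lam_eq(2,3)[OF U] _ r] by simp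
  qed
  have "{(U, F). (U, F) \<in> space (\<Gamma> \<Otimes>\<^sub>M \<nu>) \<and> orth_proj F ` A_lam n m lam K U \<supseteq> scaled_ball r F}
      = {w \<in> space (\<Gamma> \<Otimes>\<^sub>M \<nu>). ?Q w}"
  proof (rule set_eqI)
    show "w \<in> {(U, F). (U, F) \<in> space (\<Gamma> \<Otimes>\<^sub>M \<nu>) \<and> orth_proj F ` A_lam n m lam K U \<supseteq> scaled_ball r F} \<longleftrightarrow>
        w \<in> {w \<in> space (\<Gamma> \<Otimes>\<^sub>M \<nu>). ?Q w}" for w
      by (cases w) (simp add: iff cong: conj_cong)
  qed
  moreover have "measure (\<Gamma> \<Otimes>\<^sub>M \<nu>) {w \<in> space (\<Gamma> \<Otimes>\<^sub>M \<nu>). ?Q w} \<ge> 1 - p"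
    using fixed by (intro prob_all_directions p closed_Collect_le continuous_intros) simp
  ultimately show ?thesis by (simp only:)
qed

lemma prob_subset_ball:
  assumes r: "r \<ge> 0" and p: "p \<ge> 0"
    and fixed: "\<And>F. F \<in> grassmannian n k \<Longrightarrow>
      \<exists>B\<in>sets \<Gamma>. emeasure \<Gamma> B \<le> ennreal p \<and> (\<forall>U\<in>space \<Gamma> - B. \<forall>x\<in>F. height U x \<le> r * norm x)"
  shows "\<P>((U, F) in \<Gamma> \<Otimes>\<^sub>M \<nu>. orth_proj F ` A_lam n m lam K U \<subseteq> scaled_ball r F) \<ge> 1 - p"
proof -
  let ?Q = "\<lambda>w. \<forall>x\<in>snd w. (height (fst w) x, norm x) \<in> {z. fst z \<le> r * snd z}"
  have iff: "orth_proj F ` A_lam n m lam K U \<subseteq> scaled_ball r F \<longleftrightarrow> ?Q (U, F)"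
    if w: "(U, F) \<in> space (\<Gamma> \<Otimes>\<^sub>M \<nu>)" for U F
  proof -
    have F: "F \<in> grassmannian n k" and U: "\<forall>j\<in>{1..m}. U j \<in> orth_group n"
      using w space_\<Gamma> by (auto simp: space_pair_measure space_\<nu>)
    have "A_lam n m lam K U \<noteq> {}" using zero_in_A_lam[OF U] by auto
    moreover have "supp (A_lam n m lam K U) x = height U x" if "x \<in> F" for x
      using F that by (intro supp_A_lam[OF U]) (auto simp: grassmannian_def)
    ultimately show ?thesis
      using projection_subset_ball_iff[OF F A_lam_eq(2)[OF U] _ r] by simp
  qed
  have "{(U, F). (U, F) \<in> space (\<Gamma> \<Otimes>\<^sub>M \<nu>) \<and> orth_proj F ` A_lam n m lam K U \<subseteq> scaled_ball r F}
      = {w \<in> space (\<Gamma> \<Otimes>\<^sub>M \<nu>). ?Q w}"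
  proof (rule set_eqI)
    show "w \<in> {(U, F). (U, F) \<in> space (\<Gamma> \<Otimes>\<^sub>M \<nu>) \<and> orth_proj F ` A_lam n m lam K U \<subseteq> scaled_ball r F} \<longleftrightarrow>
        w \<in> {w \<in> space (\<Gamma> \<Otimes>\<^sub>M \<nu>). ?Q w}" for w
      by (cases w) (simp add: iff cong: conj_cong)
  qed
  moreover have "measure (\<Gamma> \<Otimes>\<^sub>M \<nu>) {w \<in> space (\<Gamma> \<Otimes>\<^sub>M \<nu>). ?Q w} \<ge> 1 - p"
    using fixed by (intro prob_all_directions p closed_Collect_le continuous_intros) simp
  ultimately show ?thesis by (simp only:)
qed

end

theorem theorem5p4:
  shows "\<exists>c C :: real. c > 0 \<and> C > 0 \<and>
    (\<forall>(n::nat) (k::nat) (m::nat) (K :: nat \<Rightarrow> rvec set) (lam :: nat \<Rightarrow> real) (q::real)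
        (\<sigma> :: rvec measure) (\<mu> :: (rvec \<Rightarrow>\<^sub>L rvec) measure) (\<nu> :: rvec set measure).
      sphere_prob n \<sigma> \<and> haar_orth n \<mu> \<and> haar_grassmann n k \<nu> \<and>
      1 \<le> k \<and> k \<le> n \<and>
      (\<forall>j\<in>{1..m}. convex_body n (K j) \<and> 0 \<in> interior_Rn n (K j)) \<and>
      (\<forall>j\<in>{1..m}. lam j \<ge> 0) \<and> (\<Sum>j\<in>{1..m}. lam j) = 1 \<and>
      q > 0 \<and> q \<ge> 2 * real k
      \<longrightarrow>
      (let \<Omega> = (\<Pi>\<^sub>M j\<in>{1..m}. \<mu>) \<Otimes>\<^sub>M \<nu>;
           \<Delta> = q - real k + 1;
           a = a_lam \<sigma> m q lam K;
           b = b_lam n m lam K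
       in
         (\<forall>u::real. u \<ge> 0 \<longrightarrow>
            \<P>((U, F) in \<Omega>. orth_proj F ` A_lam n m lam K U \<supseteq>
                scaled_ball (c * a * (c * a / b) powr ((real k - 1) / \<Delta>) * exp (- u / \<Delta>)) F)
            \<ge> 1 - exp (- u)) \<and>
         \<P>((U, F) in \<Omega>. orth_proj F ` A_lam n m lam K U \<subseteq>
                scaled_ball (C * (M_bar \<sigma> m lam K + sqrt (real k / real n) * B_lam n m lam K)) F)
            \<ge> 1 - exp (- c * real k)))"
proof (intro exI conjI allI impI)
  \<comment> \<open>The value \<open>1 / 216\<close> comes from \<open>lower_inclusion\<close>; it
    also serves as the rate in the upper bound, which is proved with the better rate 1. The value
    \<open>48 = 2 * 24\<close> comes from \<open>upper_inclusion\<close>.\<close>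
  show "(1 / 216 :: real) > 0" "(48 :: real) > 0" by simp_all
  fix n k m :: nat and K :: "nat \<Rightarrow> rvec set" and lam :: "nat \<Rightarrow> real" and q :: real
    and \<sigma> :: "rvec measure" and \<mu> :: "(rvec \<Rightarrow>\<^sub>L rvec) measure" and \<nu> :: "rvec set measure"
  assume asm: "sphere_prob n \<sigma> \<and> haar_orth n \<mu> \<and> haar_grassmann n k \<nu> \<and>
      1 \<le> k \<and> k \<le> n \<and>
      (\<forall>j\<in>{1..m}. convex_body n (K j) \<and> 0 \<in> interior_Rn n (K j)) \<and>
      (\<forall>j\<in>{1..m}. lam j \<ge> 0) \<and> (\<Sum>j\<in>{1..m}. lam j) = 1 \<and>
      q > 0 \<and> q \<ge> 2 * real k"
  interpret random_projection n \<mu> \<sigma> m K lam k \<nu>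
    by unfold_locales (use asm in \<open>auto simp: body_def\<close>)
  have k: "k \<ge> 1" and q: "q \<ge> 2 * real k" "q > 0" using asm by auto
  let ?a = "a_lam \<sigma> m q lam K" and ?b = "b_lam n m lam K" and ?\<Delta> = "q - real k + 1"
  let ?R = "M_bar \<sigma> m lam K + sqrt (real k / real n) * B_lam n m lam K"
  have M: "0 \<le> M_bar \<sigma> m lam K"
    unfolding M_bar_def using lam_nonneg by (intro sum_nonneg mult_nonneg_nonneg) (auto simp: Mq_def)
  have lower: "\<P>((U, F) in \<Gamma> \<Otimes>\<^sub>M \<nu>. orth_proj F ` A_lam n m lam K U \<supseteq>
      scaled_ball (1 / 216 * ?a * (1 / 216 * ?a / ?b) powr ((real k - 1) / ?\<Delta>) * exp (- u / ?\<Delta>)) F) \<ge> 1 - exp (- u)"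
    if "u \<ge> 0" for u
    using lower_inclusion[OF _ k q(1) that] a_lam_powr(1)[OF q(2)]
    by (intro prob_ball_subset) auto
  have "\<P>((U, F) in \<Gamma> \<Otimes>\<^sub>M \<nu>. orth_proj F ` A_lam n m lam K U \<subseteq> scaled_ball (48 * ?R) F) \<ge> 1 - exp (- real k)"
  proof (rule prob_subset_ball)
    show "0 \<le> 48 * ?R" using M B_lam_pos by simp
    fix F assume F: "F \<in> grassmannian n k"
    obtain B where B: "B \<in> sets \<Gamma>" "emeasure \<Gamma> B \<le> ennreal (exp (- real k))"
      "\<And>U x. U \<in> space \<Gamma> - B \<Longrightarrow> x \<in> F \<Longrightarrow>
        height U x \<le> 2 * (M_bar \<sigma> m lam K + 24 * (sqrt (real k / real n) * B_lam n m lam K)) * norm x"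
      using upper_inclusion[OF F k] by blast
    \<comment> \<open>Nonnegativity of \<open>M_bar\<close> lets its coefficient 2 grow to 48, so
      that one constant multiplies both terms.\<close>
    have "2 * (M_bar \<sigma> m lam K + 24 * (sqrt (real k / real n) * B_lam n m lam K)) * norm x \<le> 48 * ?R * norm x" for x
      using M by (intro mult_right_mono) auto
    then show "\<exists>B\<in>sets \<Gamma>. emeasure \<Gamma> B \<le> ennreal (exp (- real k)) \<and>
        (\<forall>U\<in>space \<Gamma> - B. \<forall>x\<in>F. height U x \<le> 48 * ?R * norm x)"
      using B by (meson order_trans)
  qed simp
  moreover have "exp (- real k) \<le> exp (- (1 / 216) * real k)" by simp
  ultimately have upper: "\<P>((U, F) in \<Gamma> \<Otimes>\<^sub>M \<nu>. orth_proj F ` A_lam n m lam K U \<subseteq> scaled_ball (48 * ?R) F)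
      \<ge> 1 - exp (- (1 / 216) * real k)" by linarith
  show "let \<Omega> = (\<Pi>\<^sub>M j\<in>{1..m}. \<mu>) \<Otimes>\<^sub>M \<nu>;
           \<Delta> = q - real k + 1;
           a = a_lam \<sigma> m q lam K;
           b = b_lam n m lam K
       in
         (\<forall>u::real. u \<ge> 0 \<longrightarrow>
            \<P>((U, F) in \<Omega>. orth_proj F ` A_lam n m lam K U \<supseteq>
                scaled_ball (1 / 216 * a * (1 / 216 * a / b) powr ((real k - 1) / \<Delta>) * exp (- u / \<Delta>)) F)
            \<ge> 1 - exp (- u)) \<and>
         \<P>((U, F) in \<Omega>. orth_proj F ` A_lam n m lam K U \<subseteq>
                scaled_ball (48 * (M_bar \<sigma> m lam K + sqrt (real k / real n) * B_lam n m lam K)) F)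
            \<ge> 1 - exp (- (1 / 216) * real k)"
    unfolding Let_def \<Gamma>_def[symmetric] using lower upper by blast
qed

end
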